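(* Let $K$ be a field, $q\in K$ and $f,g\in K[t]$. Let $\mathcal{H}_q(f,g)$ be the quantum generalized Heisenberg algebra, i.e. the $K$-algebra generated by $x,y,t$ with defining relations $$tx=xf,\qquad yt=fy,\qquad yx-qxy=g.$$ Then $\mathcal{H}_q(f,g)$ is a skew PBW extension of $K$ if and only if $q\neq 0$, $\deg f=1$ and $\deg g\le 1$.
   Context: Algebras are associative unital $K$-algebras; $\mathbb{N}$ denotes the nonnegative integers. The condition $\deg g\le 1$ includes $g=0$. Skew PBW extension: let $R$ and $A$ be rings. $A$ is a skew PBW extension of $R$, written $A=\sigma(R)\langle x_1,\dots,x_n\rangle$, if: (1) $R$ is a subring of $A$ with the same identity; (2) there are finitely many elements $x_1,\dots,x_n\in A$ such that $A$ is a free left $R$-module with basis $\{x_1^{\alpha_1}\cdots x_n^{\alpha_n}\mid \alpha\in\mathbb{N}^n\}$; (3) for each $1\le i\le n$ and each $r\in R\setminus\{0\}$ there is $c_{i,r}\in R\setminus\{0\}$ with $x_ir-c_{i,r}x_i\in R$; (4) for all $1\le i,j\le n$ there is $d_{i,j}\in R\setminus\{0\}$ with $x_jx_i-d_{i,j}x_ix_j\in R+Rx_1+\cdots+Rx_n$. *)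

theory Defs
  imports
    "HOL-Algebra.Algebra"
    "HOL-Algebra.Algebraic_Closure_Type"
    "HOL-Library.Poly_Mapping"
begin

section \<open>Skew PBW extensions\<close>

text \<open>\<open>left_basis A R I b\<close>: the family \<open>b\<close>, indexed by \<open>I\<close>, is a basis of \<open>A\<close> as a left
  module over its subring \<open>R\<close>.  Being a basis is a property of the family, so repetitions in
  \<open>b\<close> are excluded.  Coefficient families are made \<open>undefined\<close> outside \<open>I\<close>
  so that uniqueness is meaningful for total functions.\<close>

definition left_basis ::
    "('a, 'c) ring_scheme \<Rightarrow> 'a set \<Rightarrow> 'i set \<Rightarrow> ('i \<Rightarrow> 'a) \<Rightarrow> bool" where
  "left_basis A R I b \<longleftrightarrow>
     b \<in> I \<rightarrow> carrier A \<and>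
     (\<forall>a\<in>carrier A. \<exists>!c. c \<in> (I \<rightarrow>\<^sub>E R) \<and>
        finite {i\<in>I. c i \<noteq> \<zero>\<^bsub>A\<^esub>} \<and>
        a = (\<Oplus>\<^bsub>A\<^esub>i\<in>{i\<in>I. c i \<noteq> \<zero>\<^bsub>A\<^esub>}. c i \<otimes>\<^bsub>A\<^esub> b i))"

text \<open>The ordered monomial \<open>x\<^sub>1\<^bsup>\<alpha>\<^sub>1\<^esup> \<cdots> x\<^sub>n\<^bsup>\<alpha>\<^sub>n\<^esup>\<close>, for lists of equal length \<open>n\<close>.\<close>

definition ordered_monomial ::
    "('a, 'c) ring_scheme \<Rightarrow> 'a list \<Rightarrow> nat list \<Rightarrow> 'a" where
  "ordered_monomial A xs \<alpha> =
     foldr (\<lambda>(x, k) m. (x [^]\<^bsub>A\<^esub> k) \<otimes>\<^bsub>A\<^esub> m) (zip xs \<alpha>) \<one>\<^bsub>A\<^esub>"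

text \<open>The left \<open>R\<close>-submodule \<open>R + R x\<^sub>1 + \<cdots> + R x\<^sub>n\<close>.\<close>

definition linear_part ::
    "('a, 'c) ring_scheme \<Rightarrow> 'a set \<Rightarrow> 'a list \<Rightarrow> 'a set" where
  "linear_part A R xs =
     {s \<oplus>\<^bsub>A\<^esub> (\<Oplus>\<^bsub>A\<^esub>k\<in>{..<length xs}. r k \<otimes>\<^bsub>A\<^esub> (xs ! k)) | s r.
        s \<in> R \<and> r \<in> {..<length xs} \<rightarrow> R}"

definition skew_PBW_extension :: "('a, 'c) ring_scheme \<Rightarrow> 'a set \<Rightarrow> bool" where
  "skew_PBW_extension A R \<longleftrightarrow>
     ring A \<and> subring R A \<and>
     (\<exists>xs. set xs \<subseteq> carrier A \<and>
        left_basis A R {\<alpha>. length \<alpha> = length xs} (ordered_monomial A xs) \<and>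
        (\<forall>i<length xs. \<forall>r\<in>R - {\<zero>\<^bsub>A\<^esub>}. \<exists>c\<in>R - {\<zero>\<^bsub>A\<^esub>}.
           xs ! i \<otimes>\<^bsub>A\<^esub> r \<ominus>\<^bsub>A\<^esub> c \<otimes>\<^bsub>A\<^esub> (xs ! i) \<in> R) \<and>
        (\<forall>i<length xs. \<forall>j<length xs. \<exists>d\<in>R - {\<zero>\<^bsub>A\<^esub>}.
           xs ! j \<otimes>\<^bsub>A\<^esub> xs ! i \<ominus>\<^bsub>A\<^esub> d \<otimes>\<^bsub>A\<^esub> (xs ! i \<otimes>\<^bsub>A\<^esub> xs ! j)
             \<in> linear_part A R xs))"

text \<open>The same notion when \<open>R\<close> is identified with a subring of \<open>A\<close> by means of an embedding
  \<open>\<iota>\<close>, such as the structure map of a nonzero algebra over a field.\<close>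

definition skew_PBW_extension_via ::
    "('r, 'd) ring_scheme \<Rightarrow> ('a, 'c) ring_scheme \<Rightarrow> ('r \<Rightarrow> 'a) \<Rightarrow> bool" where
  "skew_PBW_extension_via R A \<iota> \<longleftrightarrow>
     \<iota> \<in> ring_hom R A \<and> inj_on \<iota> (carrier R) \<and> skew_PBW_extension A (\<iota> ` carrier R)"


section \<open>Free algebras\<close>

text \<open>Words are a copy of lists, written additively because multiplication of
  \<open>\<Rightarrow>\<^sub>0\<close> is convolution over an additive monoid of exponents.\<close>

datatype 'a fword = FWord "'a list"

instantiation fword :: (type) monoid_add
begin

definition zero_fword :: "'a fword" where
  "0 = FWord []"

fun plus_fword :: "'a fword \<Rightarrow> 'a fword \<Rightarrow> 'a fword" where
  "FWord u + FWord v = FWord (u @ v)"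

instance
proof
  fix a b c :: "'a fword"
  show "a + b + c = a + (b + c)" by (cases a; cases b; cases c) simp
  show "0 + a = a" by (cases a) (simp add: zero_fword_def)
  show "a + 0 = a" by (cases a) (simp add: zero_fword_def)
qed

end

type_synonym ('v, 'k) free_alg = "'v fword \<Rightarrow>\<^sub>0 'k"

definition fconst :: "'k::field \<Rightarrow> ('v, 'k) free_alg" where
  "fconst c = Poly_Mapping.single 0 c"

definition fvar :: "'v \<Rightarrow> ('v, 'k::field) free_alg" where
  "fvar v = Poly_Mapping.single (FWord [v]) 1"

definition fpoly :: "'k::field poly \<Rightarrow> ('v, 'k) free_alg \<Rightarrow> ('v, 'k) free_alg" where
  "fpoly p z = (\<Sum>i\<le>Polynomial.degree p. fconst (Polynomial.coeff p i) * z ^ i)"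

lemma ring_of_type_algebra_ring: "ring (ring_of_type_algebra :: 'a::ring_1 ring)"
proof -
  have "\<exists>y. x + y = 0" for x :: 'a
    using add.right_inverse by blast
  thus ?thesis
    unfolding ring_of_type_algebra_def using add.right_inverse
    by unfold_locales (auto simp: algebra_simps Units_def)
qed


section \<open>Quantum generalized Heisenberg algebras\<close>

datatype qgh_gen = GX | GY | GT

definition qgh_relators ::
    "'k::field \<Rightarrow> 'k poly \<Rightarrow> 'k poly \<Rightarrow> (qgh_gen, 'k) free_alg set" where
  "qgh_relators q f g =
    (let x = fvar GX; y = fvar GY; t = fvar GT in
      {t * x - x * fpoly f t,
       y * t - fpoly f t * y,
       y * x - fconst q * x * y - fpoly g t})"

definition qgh_ideal ::
    "'k::field \<Rightarrow> 'k poly \<Rightarrow> 'k poly \<Rightarrow> (qgh_gen, 'k) free_alg set" where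
  "qgh_ideal q f g = Idl\<^bsub>ring_of_type_algebra\<^esub> (qgh_relators q f g)"

definition qgh_algebra ::
    "'k::field \<Rightarrow> 'k poly \<Rightarrow> 'k poly \<Rightarrow> (qgh_gen, 'k) free_alg set ring" where
  "qgh_algebra q f g = ring_of_type_algebra Quot qgh_ideal q f g"

definition qgh_scalar ::
    "'k::field \<Rightarrow> 'k poly \<Rightarrow> 'k poly \<Rightarrow> 'k \<Rightarrow> (qgh_gen, 'k) free_alg set" where
  "qgh_scalar q f g c = qgh_ideal q f g +>\<^bsub>ring_of_type_algebra\<^esub> fconst c"

end

theory Submission
  imports Defs "HOL-Computational_Algebra.Polynomial" "HOL-Library.Multiset"
begin

text \<open>The algebra has the basis \<open>x\<^sup>i t\<^sup>j y\<^sup>l\<close> for all parameters, seen by letting it act on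
  \<open>\<Prod>\<^sub>i x\<^sup>i K[t, s]\<close>.  If \<open>q \<noteq> 0\<close>, \<open>deg f = 1\<close> and \<open>deg g \<le> 1\<close>, then \<open>x, t, y\<close> are
  generators as required.

  Conversely, let \<open>u\<^sub>1, \<dots>, u\<^sub>n\<close> be generators of a skew PBW extension of \<open>K\<close>.  The algebra is
  filtered by degree in the \<open>u\<^sub>i\<close>, with associated graded algebra a quantum affine space; hence it
  is a domain of polynomial growth.  The elements \<open>x\<^sup>m p(t)\<close> arising from words in \<open>x, t\<close> grow
  exponentially if \<open>deg f \<ge> 2\<close>; if \<open>f\<close> is constant or \<open>q = 0\<close>, there are zero divisors.  So
  \<open>f = a t + b\<close> with \<open>a, q \<noteq> 0\<close>, the growth in \<open>x, t, y\<close> is cubic, and \<open>n \<le> 3\<close>.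

  Suppose that \<open>deg g \<ge> 2\<close>, and let \<open>\<pi>\<close> be the projection to \<open>K[t]/(g)\<close> killing \<open>x, y\<close>.
  A homomorphism to \<open>K[s]\<close> that lifts \<open>\<pi>\<close> and kills \<open>g(t)\<close> cannot exist, since it maps \<open>t\<close> to a
  nonconstant polynomial.  Sending \<open>u\<^sub>i\<close> to the remainder of \<open>\<pi>(u\<^sub>i)\<close> modulo \<open>g\<close> gives such a
  lift whenever all \<open>u\<^sub>j u\<^sub>i - d u\<^sub>i u\<^sub>j\<close> have images of degree less than \<open>deg g\<close>.  If
  \<open>a \<noteq> 1\<close> or \<open>q \<noteq> 1\<close>, there is a normal element \<open>w\<close> (a translate of \<open>t\<close>, or \<open>x y + h(t)\<close>),
  whose automorphism \<open>\<phi>\<close> is affine and diagonal in the \<open>u\<^sub>i\<close>; generators with eigenvalue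
  different from \<open>1\<close> have constant images, and the remaining case of two fixed generators is
  excluded by a map to the algebra itself.  If \<open>a = q = 1\<close>, the filtration by degree in
  \<open>x, t, y\<close> has a commutative associated graded algebra, so at most one \<open>d\<close> differs from \<open>1\<close>, and
  that relation expresses the third generator by the other two.\<close>

section \<open>Algebras over a field\<close>

text \<open>The generators of an arbitrary skew PBW presentation are unknown elements; what can be
  controlled is their leading terms in a filtration and their remainders P_i modulo g. A relation of
  the u_i always holds for the P_i modulo g, and it holds exactly once both sides have degree below
  deg g. Its affine part always satisfies this bound, so the only obstacle to lifting is the
  quadratic part P_j P_i - d P_i P_j, and each case looks for a reason why that part is small or can
  be absorbed. A lift kills g(t) because g(t) = y x - q x y: for q = 1 a commutative target
  suffices, and otherwise the map is made invariant under \<phi>, which scales x and y by constants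
  different from 1 and so forces their images to vanish. Two opposite orders of the variables enter
  because a map that preserves leading exponents in both can send u_i only to an affine expression
  in u_i. The quotient ring is exchanged for its image in an operator ring, so that spans and
  independence can be used in a ring of class \<open>ring_1\<close>.\<close>

locale central_algebra =
  fixes sc :: "'k::field \<Rightarrow> 'a::ring_1"
  assumes sc_add: "sc (a + b) = sc a + sc b"
    and sc_mult: "sc (a * b) = sc a * sc b"
    and sc_one [simp]: "sc 1 = 1"
    and sc_central: "sc c * z = z * sc c"
begin

lemma sc_zero [simp]: "sc 0 = 0"
  using sc_add[of 0 0] by simp

lemma sc_minus: "sc (- c) = - sc c"
  using sc_add[of c "- c"] by (simp add: eq_neg_iff_add_eq_0 add.commute)

lemma sc_diff: "sc (a - b) = sc a - sc b"
  using sc_add[of a "- b"] by (simp add: sc_minus)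

lemma sc_inverse: "c \<noteq> 0 \<Longrightarrow> sc (inverse c) * sc c = 1"
  by (simp flip: sc_mult)

lemma sc_eq_0_iff [simp]: "sc c = 0 \<longleftrightarrow> c = 0"
  using sc_inverse[of c] by (cases "c = 0") auto

lemma inj_sc: "inj sc"
  by (rule injI) (metis sc_diff sc_eq_0_iff eq_iff_diff_eq_0)

lemma sc_left_commute: "z * (sc c * w) = sc c * (z * w)"
  by (metis mult.assoc sc_central)

sublocale vs: vector_space "\<lambda>c z. sc c * z"
  by unfold_locales (auto simp: algebra_simps sc_add sc_mult)

lemma span_mult_right:
  assumes "\<And>b. b \<in> B \<Longrightarrow> b * z \<in> vs.span C" "w \<in> vs.span B"
  shows "w * z \<in> vs.span C"
  using assms(2)
proof (induct rule: vs.span_induct_alt)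
  case (step c b w)
  then show ?case
    using vs.span_add[OF vs.span_scale[OF assms(1)[of b]], of "w * z" c]
    by (simp add: distrib_right mult.assoc)
qed (simp add: vs.span_zero)

lemma span_mult_left:
  assumes "\<And>b. b \<in> B \<Longrightarrow> z * b \<in> vs.span C" "w \<in> vs.span B"
  shows "z * w \<in> vs.span C"
  using assms(2)
proof (induct rule: vs.span_induct_alt)
  case (step c b w)
  then show ?case
    using vs.span_add[OF vs.span_scale[OF assms(1)[of b]], of "z * w" c]
    by (simp add: distrib_left sc_left_commute)
qed (simp add: vs.span_zero)

lemma span_mult:
  assumes "\<And>a b. a \<in> A \<Longrightarrow> b \<in> B \<Longrightarrow> a * b \<in> vs.span C" "z \<in> vs.span A" "w \<in> vs.span B"
  shows "z * w \<in> vs.span C"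
proof (rule span_mult_right[OF _ assms(2)])
  fix a assume "a \<in> A"
  then show "a * w \<in> vs.span C"
    using assms(1) by (intro span_mult_left[OF _ assms(3)]) auto
qed

definition peval :: "'k poly \<Rightarrow> 'a \<Rightarrow> 'a" where
  "peval p z = fold_coeffs (\<lambda>c r. sc c + z * r) p 0"

lemma peval_0 [simp]: "peval 0 z = 0"
  by (simp add: peval_def)

lemma peval_pCons [simp]: "peval (pCons c p) z = sc c + z * peval p z"
  by (cases "p = 0 \<and> c = 0") (auto simp: peval_def)

lemma peval_add: "peval (p + p') z = peval p z + peval p' z"
  by (induct p p' rule: poly_induct2) (auto simp: sc_add algebra_simps)

lemma peval_smult: "peval (smult c p) z = sc c * peval p z"
  by (induct p) (auto simp: sc_mult distrib_left sc_left_commute)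

lemma peval_minus: "peval (- p) z = - peval p z"
  using peval_smult[of "-1" p z] by (simp add: sc_minus)

lemma peval_diff: "peval (p - p') z = peval p z - peval p' z"
  using peval_add[of p "- p'" z] by (simp add: peval_minus)

lemma peval_mult: "peval (p * p') z = peval p z * peval p' z"
  by (induct p) (auto simp: peval_add peval_smult distrib_right mult.assoc)

lemma peval_1 [simp]: "peval 1 z = 1"
  by (simp add: one_pCons)

lemma peval_pcompose: "peval (pcompose p p') z = peval p (peval p' z)"
  by (induct p) (auto simp: pcompose_pCons peval_add peval_mult)

lemma peval_commute: "peval p z * z = z * peval p z"
  by (induct p) (auto simp: algebra_simps sc_central)

lemma peval_monom: "peval (Polynomial.monom c i) z = sc c * z ^ i"
  by (induct i) (auto simp: monom_0 monom_Suc sc_left_commute)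

lemma peval_sum: "peval (\<Sum>i\<in>I. h i) z = (\<Sum>i\<in>I. peval (h i) z)"
  by (induct I rule: infinite_finite_induct) (auto simp: peval_add)

lemma peval_altdef:
  "peval p z = (\<Sum>i\<le>Polynomial.degree p. sc (Polynomial.coeff p i) * z ^ i)"
  by (subst poly_as_sum_of_monoms[of p, symmetric]) (simp add: peval_sum peval_monom)

lemma peval_intertwine: "z * w = w * v \<Longrightarrow> peval p z * w = w * peval p v"
  by (induct p) (auto simp: distrib_left distrib_right sc_central mult.assoc simp flip: mult.assoc[of z w])

end

text \<open>The algebras at issue are subalgebras of a ring type, not types of their own. Hence
  \<open>h\<close> is total but its laws are imposed only on \<open>S\<close>, together with the
  closure of \<open>S\<close> that makes them usable.\<close>

locale algebra_hom =
  source: central_algebra sc + target: central_algebra sc'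
  for sc :: "'k::field \<Rightarrow> 'a::ring_1" and sc' :: "'k \<Rightarrow> 'b::ring_1" +
  fixes S :: "'a set" and h :: "'a \<Rightarrow> 'b"
  assumes sc_mem: "sc c \<in> S"
    and add_mem: "z \<in> S \<Longrightarrow> w \<in> S \<Longrightarrow> z + w \<in> S"
    and mult_mem: "z \<in> S \<Longrightarrow> w \<in> S \<Longrightarrow> z * w \<in> S"
    and h_sc: "h (sc c) = sc' c"
    and h_add: "z \<in> S \<Longrightarrow> w \<in> S \<Longrightarrow> h (z + w) = h z + h w"
    and h_mult: "z \<in> S \<Longrightarrow> w \<in> S \<Longrightarrow> h (z * w) = h z * h w"
begin

lemma h_diff: "z \<in> S \<Longrightarrow> w \<in> S \<Longrightarrow> h (z - w) = h z - h w"
proof -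
  assume z: "z \<in> S" and w: "w \<in> S"
  have "h (z + sc (- 1) * w) = h z + sc' (- 1) * h w"
    using z w sc_mem[of "- 1"] mult_mem[of "sc (- 1)" w] by (simp only: h_add h_mult h_sc)
  then show ?thesis
    by (simp add: source.sc_minus target.sc_minus)
qed

lemma h_one: "h 1 = 1"
  using h_sc[of 1] by simp

lemma peval_mem: "z \<in> S \<Longrightarrow> source.peval p z \<in> S"
  using sc_mem[of 0] by (induct p) (auto intro: sc_mem add_mem mult_mem)

lemma h_peval: "z \<in> S \<Longrightarrow> h (source.peval p z) = target.peval p (h z)"
  using h_sc[of 0] by (induct p) (auto simp: h_add h_mult h_sc sc_mem mult_mem peval_mem)

end

section \<open>Ordered monomials\<close>

text \<open>Insertion sort read backwards: \<open>sort w\<close> leads back to \<open>w\<close> by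
  creating adjacent inversions one at a time, and \<open>swap\<close> carries the property across
  each of them.\<close>

lemma sorting_induct [case_names sorted swap]:
  fixes P :: "nat list \<Rightarrow> bool"
  assumes sorted: "\<And>w. sorted w \<Longrightarrow> P w"
    and swap: "\<And>u a b v. b < a \<Longrightarrow> P (u @ b # a # v) \<Longrightarrow> P (u @ a # b # v)"
  shows "P w"
proof -
  have ins: "P (u @ insort a v) \<Longrightarrow> P (u @ a # v)" for u a v
  proof (induct v arbitrary: u)
    case (Cons b v)
    show ?case
    proof (cases "a \<le> b")
      case False
      then have "P (u @ b # a # v)"
        using Cons(1)[of "u @ [b]"] Cons(2) by simp
      then show ?thesis using False swap[of b a u v] by simp
    qed (use Cons in simp)
  qed simp
  have "P (u @ sort w) \<Longrightarrow> P (u @ w)" for u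
  proof (induct w arbitrary: u)
    case (Cons a w)
    then show ?case using ins[of u a "sort w"] Cons(1)[of "u @ [a]"] by simp
  qed simp
  from this[of "[]"] show ?thesis using sorted[of "sort w"] by simp
qed

text \<open>Passage from a commutative exponent vector to the ordered word of the same multidegree.
  The offset \<open>k\<close> counts the variables already passed.\<close>

fun expand :: "nat \<Rightarrow> nat list \<Rightarrow> nat list" where
  "expand k [] = []"
| "expand k (a # \<alpha>) = replicate a k @ expand (Suc k) \<alpha>"

lemma set_expand: "set (expand k \<alpha>) \<subseteq> {k..<k + length \<alpha>}"
  by (induct k \<alpha> rule: expand.induct) (auto simp: subset_iff)

lemma sorted_expand: "sorted (expand k \<alpha>)"
proof (induct k \<alpha> rule: expand.induct)
  case (2 k a \<alpha>)
  then show ?case using set_expand[of "Suc k" \<alpha>] by (auto simp: sorted_append)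
qed simp

lemma count_list_replicate: "count_list (replicate a k) i = (if i = k then a else 0)"
  by (induct a) auto

lemma count_list_expand:
  "count_list (expand k \<alpha>) i = (if k \<le> i \<and> i < k + length \<alpha> then \<alpha> ! (i - k) else 0)"
proof (induct k \<alpha> rule: expand.induct)
  case (2 k a \<alpha>)
  then show ?case
    by (auto simp: count_list_replicate nth_Cons')
qed simp

definition letter_counts :: "nat \<Rightarrow> nat list \<Rightarrow> nat list" where
  "letter_counts n w = map (count_list w) [0..<n]"

lemma length_letter_counts [simp]: "length (letter_counts n w) = n"
  by (simp add: letter_counts_def)

lemma nth_letter_counts: "i < n \<Longrightarrow> letter_counts n w ! i = count_list w i"
  by (simp add: letter_counts_def)

lemma letter_counts_expand: "letter_counts (length \<alpha>) (expand 0 \<alpha>) = \<alpha>"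
  by (rule nth_equalityI) (auto simp: nth_letter_counts count_list_expand)

lemma letter_counts_append: "letter_counts n (u @ v) = map2 (+) (letter_counts n u) (letter_counts n v)"
  by (rule nth_equalityI) (auto simp: nth_letter_counts)

lemma letter_counts_cong: "mset u = mset v \<Longrightarrow> letter_counts n u = letter_counts n v"
  by (metis letter_counts_def map_eq_conv count_mset)

lemma letter_counts_sort [simp]: "letter_counts n (sort w) = letter_counts n w"
  by (rule letter_counts_cong) simp

lemma sort_eq_expand:
  assumes "set w \<subseteq> {..<n}"
  shows "sort w = expand 0 (letter_counts n w)"
proof (rule properties_for_sort)
  have "count_list (expand 0 (letter_counts n w)) i = count_list w i" for i
    using assms by (cases "i < n") (auto simp: count_list_expand nth_letter_counts count_list_0_iff subset_iff)
  then show "mset (expand 0 (letter_counts n w)) = mset w"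
    by (auto intro!: multiset_eqI simp: count_mset)
qed (rule sorted_expand)

definition monomial :: "'a::monoid_mult list \<Rightarrow> nat list \<Rightarrow> 'a" where
  "monomial us \<alpha> = foldr (\<lambda>(u, k) m. u ^ k * m) (zip us \<alpha>) 1"

definition word :: "'a::monoid_mult list \<Rightarrow> nat list \<Rightarrow> 'a" where
  "word us w = prod_list (map ((!) us) w)"

lemma word_Nil [simp]: "word us [] = 1"
  and word_Cons: "word us (i # w) = us ! i * word us w"
  and word_append: "word us (v @ w) = word us v * word us w"
  by (auto simp: word_def)

lemma word_replicate: "word us (replicate a k) = us ! k ^ a"
  by (induct a) (auto simp: word_Cons)

lemma monomial_drop:
  "k + length \<alpha> = length us \<Longrightarrow> monomial (drop k us) \<alpha> = word us (expand k \<alpha>)"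
proof (induct k \<alpha> rule: expand.induct)
  case (2 k a \<alpha>)
  then have "drop k us = us ! k # drop (Suc k) us"
    by (metis Cons_nth_drop_Suc add_Suc_right length_Cons less_add_Suc1)
  then show ?case using 2
    by (simp add: monomial_def word_append word_replicate)
qed (simp add: monomial_def)

lemma monomial_eq_word: "length \<alpha> = length us \<Longrightarrow> monomial us \<alpha> = word us (expand 0 \<alpha>)"
  using monomial_drop[of 0 \<alpha> us] by simp

abbreviation exponents :: "nat \<Rightarrow> nat list set" where
  "exponents n \<equiv> {\<alpha>. length \<alpha> = n}"

definition weight :: "(nat \<Rightarrow> nat) \<Rightarrow> nat list \<Rightarrow> nat" where
  "weight W \<alpha> = (\<Sum>i<length \<alpha>. \<alpha> ! i * W i)"

lemma weight_add:
  "length \<alpha> = length \<beta> \<Longrightarrow> weight W (map2 (+) \<alpha> \<beta>) = weight W \<alpha> + weight W \<beta>"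
  by (simp add: weight_def sum.distrib distrib_right)

definition word_weight :: "(nat \<Rightarrow> nat) \<Rightarrow> nat list \<Rightarrow> nat" where
  "word_weight W w = sum_list (map W w)"

lemma word_weight_simps [simp]: "word_weight W [] = 0"
    "word_weight W (i # w) = W i + word_weight W w"
    "word_weight W (v @ w) = word_weight W v + word_weight W w"
  by (auto simp: word_weight_def)

lemma weight_letter_counts: "set w \<subseteq> {..<n} \<Longrightarrow> weight W (letter_counts n w) = word_weight W w"
  unfolding word_weight_def weight_def
  by (subst sum_list_map_eq_sum_count2[of w "{..<n}"]) (auto simp: nth_letter_counts)

lemma word_weight_expand: "word_weight W (expand 0 \<alpha>) = weight W \<alpha>"
  using weight_letter_counts[of "expand 0 \<alpha>" "length \<alpha>" W] set_expand[of 0 \<alpha>]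
  by (simp add: letter_counts_expand atLeast0LessThan)

section \<open>Filtration by the weight of words\<close>

context central_algebra
begin

definition low :: "'a list \<Rightarrow> (nat \<Rightarrow> nat) \<Rightarrow> nat \<Rightarrow> 'a set" where
  "low us W m = vs.span {word us w |w. set w \<subseteq> {..<length us} \<and> word_weight W w < m}"

lemma word_in_low:
  "set w \<subseteq> {..<length us} \<Longrightarrow> word_weight W w < m \<Longrightarrow> word us w \<in> low us W m"
  by (auto simp: low_def intro!: vs.span_base)

lemma low_mono: "m \<le> m' \<Longrightarrow> low us W m \<subseteq> low us W m'"
  unfolding low_def by (rule vs.span_mono) auto

lemma low_mult_left:
  assumes "set v \<subseteq> {..<length us}" "z \<in> low us W m"
  shows "word us v * z \<in> low us W (word_weight W v + m)"
  unfolding low_def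
proof (rule span_mult_left[OF _ assms(2)[unfolded low_def]])
  fix b assume "b \<in> {word us w |w. set w \<subseteq> {..<length us} \<and> word_weight W w < m}"
  then obtain w where "b = word us w" "set w \<subseteq> {..<length us}" "word_weight W w < m"
    by blast
  then show "word us v * b
      \<in> vs.span {word us w |w. set w \<subseteq> {..<length us} \<and> word_weight W w < word_weight W v + m}"
    using assms(1) word_in_low[of "v @ w" us W] by (simp add: word_append low_def)
qed

lemma low_mult_right:
  assumes "set v \<subseteq> {..<length us}" "z \<in> low us W m"
  shows "z * word us v \<in> low us W (m + word_weight W v)"
  unfolding low_def
proof (rule span_mult_right[OF _ assms(2)[unfolded low_def]])
  fix b assume "b \<in> {word us w |w. set w \<subseteq> {..<length us} \<and> word_weight W w < m}"
  then obtain w where "b = word us w" "set w \<subseteq> {..<length us}" "word_weight W w < m"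
    by blast
  then show "b * word us v
      \<in> vs.span {word us w |w. set w \<subseteq> {..<length us} \<and> word_weight W w < m + word_weight W v}"
    using assms(1) word_in_low[of "w @ v" us W] by (simp add: word_append low_def)
qed

lemma low_mult:
  assumes "z \<in> low us W (Suc m)" "w \<in> low us W (Suc m')"
  shows "z * w \<in> low us W (Suc (m + m'))"
  using assms unfolding low_def
proof (rule span_mult[rotated])
  fix a b assume "a \<in> {word us w |w. set w \<subseteq> {..<length us} \<and> word_weight W w < Suc m}"
    "b \<in> {word us w |w. set w \<subseteq> {..<length us} \<and> word_weight W w < Suc m'}"
  then obtain w v where "a = word us w" "b = word us v" "set w \<subseteq> {..<length us}"
      "set v \<subseteq> {..<length us}" "word_weight W w < Suc m" "word_weight W v < Suc m'"
    by blast
  then show "a * b \<in> vs.span {word us w |w. set w \<subseteq> {..<length us} \<and> word_weight W w < Suc (m + m')}"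
    using word_in_low[of "w @ v" us W] by (simp add: word_append low_def)
qed

end

section \<open>Quantum spaces filtered by weights\<close>

lemma sort_cong: "mset u = mset v \<Longrightarrow> sort u = sort (v :: nat list)"
  by (rule properties_for_sort) auto

text \<open>An algebra whose associated graded algebra for the weights \<open>W\<close> is a quantum
  affine space. The set \<open>D\<close> confines the constants that reordering can produce: all
  nonzero scalars for a general skew PBW presentation, only 1 where the graded algebra is
  commutative. The algebra itself is the span \<open>S\<close>, which may be smaller than the
  type.\<close>

locale quantum_space = central_algebra sc
  for sc :: "'k::field \<Rightarrow> 'a::ring_1" +
  fixes us :: "'a list" and W :: "nat \<Rightarrow> nat" and D :: "'k set"
  assumes W_pos: "i < length us \<Longrightarrow> 0 < W i"
    and D_one: "1 \<in> D"
    and D_mult: "c \<in> D \<Longrightarrow> c' \<in> D \<Longrightarrow> c * c' \<in> D"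
    and D_nonzero: "0 \<notin> D"
    and reorder: "i < j \<Longrightarrow> j < length us \<Longrightarrow>
      \<exists>c\<in>D. us ! j * us ! i - sc c * (us ! i * us ! j) \<in> low us W (W i + W j)"
    and inj_monomial: "inj_on (monomial us) (exponents (length us))"
    and independent_monomials: "vs.independent (monomial us ` exponents (length us))"
begin

abbreviation Ex :: "nat list set" where
  "Ex \<equiv> exponents (length us)"

abbreviation mon :: "nat list \<Rightarrow> 'a" where
  "mon \<equiv> monomial us"

definition S :: "'a set" where
  "S = vs.span (mon ` Ex)"

definition co :: "'a \<Rightarrow> nat list \<Rightarrow> 'k" where
  "co z \<alpha> = vs.representation (mon ` Ex) z (mon \<alpha>)"

text \<open>Removing one inversion costs a factor in \<open>D\<close> and an error of smaller
  weight; multiplying this error by the surrounding letters keeps it below the weight of the whole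
  word.\<close>

lemma sort_word:
  "set w \<subseteq> {..<length us} \<Longrightarrow>
    \<exists>c\<in>D. word us w - sc c * word us (sort w) \<in> low us W (word_weight W w)"
proof (induct w rule: sorting_induct)
  case (sorted w)
  then show ?case
    using D_one by (intro bexI[of _ 1]) (simp_all add: low_def vs.span_zero sorted_sort_id)
next
  case (swap u a b v)
  let ?s = "word us (sort (u @ b # a # v))" and ?m = "word_weight W (u @ a # b # v)"
  have weq: "word_weight W (u @ b # a # v) = ?m"
    by simp
  have seq: "sort (u @ a # b # v) = sort (u @ b # a # v)"
    by (rule sort_cong) simp
  have sets: "set (u @ b # a # v) \<subseteq> {..<length us}" "set u \<subseteq> {..<length us}"
      "set v \<subseteq> {..<length us}" "a < length us"
    using swap(3) by auto
  from swap(2)[OF sets(1)] obtain c where c: "c \<in> D"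
      and cl: "word us (u @ b # a # v) - sc c * ?s \<in> low us W ?m"
    unfolding weq by blast
  obtain e where e: "e \<in> D" and el: "us ! a * us ! b - sc e * (us ! b * us ! a) \<in> low us W (W b + W a)"
    using reorder[OF swap(1) sets(4)] by blast
  let ?E = "us ! a * us ! b - sc e * (us ! b * us ! a)"
  have "word us u * (?E * word us v)
      \<in> low us W (word_weight W u + (W b + W a + word_weight W v))"
    by (intro low_mult_left low_mult_right el sets)
  also have "word_weight W u + (W b + W a + word_weight W v) = ?m"
    by simp
  finally have EE: "word us u * (?E * word us v) \<in> low us W ?m" .
  have "sc e * (word us (u @ b # a # v) - sc c * ?s) \<in> low us W ?m"
    using cl unfolding low_def by (rule vs.span_scale)
  with EE have "word us u * (?E * word us v) + sc e * (word us (u @ b # a # v) - sc c * ?s) \<in> low us W ?m"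
    unfolding low_def by (rule vs.span_add)
  also have "word us u * (?E * word us v) + sc e * (word us (u @ b # a # v) - sc c * ?s)
      = word us (u @ a # b # v) - sc (e * c) * ?s"
  proof -
    have "p * ((x - sc e * y) * q) + sc e * (p * (y * q) - z) = p * (x * q) - sc e * z" for p x y q z
      by (simp add: left_diff_distrib right_diff_distrib mult.assoc sc_left_commute[of p])
    from this[of "word us u" "us ! a * us ! b" "us ! b * us ! a" "word us v" "sc c * ?s"]
    show ?thesis
      by (simp only: word_append word_Cons sc_mult mult.assoc)
  qed
  finally show ?case
    unfolding seq by (rule bexI[OF _ D_mult[OF e c]])
qed

lemma mon_eq_word: "\<alpha> \<in> Ex \<Longrightarrow> mon \<alpha> = word us (expand 0 \<alpha>)"
  by (simp add: monomial_eq_word)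

lemma word_sort_eq_mon:
  "set w \<subseteq> {..<length us} \<Longrightarrow> word us (sort w) = mon (letter_counts (length us) w)"
  by (simp add: sort_eq_expand mon_eq_word)

text \<open>The errors left by sorting are combinations of words of strictly smaller weight, so
  induction on the weight turns them into ordered monomials.\<close>

lemma word_in_span:
  "set w \<subseteq> {..<length us} \<Longrightarrow> word us w \<in> vs.span (mon ` {\<alpha> \<in> Ex. weight W \<alpha> \<le> word_weight W w})"
proof (induct "word_weight W w" arbitrary: w rule: less_induct)
  case less
  obtain c where "word us w - sc c * word us (sort w) \<in> low us W (word_weight W w)"
    using sort_word less(2) by blast
  moreover have "low us W (word_weight W w)
      \<subseteq> vs.span (mon ` {\<alpha> \<in> Ex. weight W \<alpha> \<le> word_weight W w})"
    unfolding low_def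
  proof (rule vs.span_minimal)
    show "{word us v |v. set v \<subseteq> {..<length us} \<and> word_weight W v < word_weight W w}
        \<subseteq> vs.span (mon ` {\<alpha> \<in> Ex. weight W \<alpha> \<le> word_weight W w})"
    proof safe
      fix v assume v: "set v \<subseteq> {..<length us}" "word_weight W v < word_weight W w"
      have "vs.span (mon ` {\<alpha> \<in> Ex. weight W \<alpha> \<le> word_weight W v})
          \<subseteq> vs.span (mon ` {\<alpha> \<in> Ex. weight W \<alpha> \<le> word_weight W w})"
        using v by (intro vs.span_mono) auto
      then show "word us v \<in> vs.span (mon ` {\<alpha> \<in> Ex. weight W \<alpha> \<le> word_weight W w})"
        using less(1)[OF v(2) v(1)] by blast
    qed
  qed (rule vs.subspace_span)
  moreover have "word us (sort w) \<in> vs.span (mon ` {\<alpha> \<in> Ex. weight W \<alpha> \<le> word_weight W w})"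
    using less(2) by (intro vs.span_base) (auto simp: word_sort_eq_mon weight_letter_counts)
  ultimately have "(word us w - sc c * word us (sort w)) + sc c * word us (sort w)
      \<in> vs.span (mon ` {\<alpha> \<in> Ex. weight W \<alpha> \<le> word_weight W w})"
    by (intro vs.span_add vs.span_scale) auto
  then show ?case by simp
qed

lemma low_eq: "low us W m = vs.span (mon ` {\<alpha> \<in> Ex. weight W \<alpha> < m})"
proof (rule antisym)
  show "low us W m \<subseteq> vs.span (mon ` {\<alpha> \<in> Ex. weight W \<alpha> < m})"
    unfolding low_def
  proof (rule vs.span_minimal)
    show "{word us v |v. set v \<subseteq> {..<length us} \<and> word_weight W v < m}
        \<subseteq> vs.span (mon ` {\<alpha> \<in> Ex. weight W \<alpha> < m})"
    proof safe
      fix v assume v: "set v \<subseteq> {..<length us}" "word_weight W v < m"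
      have "vs.span (mon ` {\<alpha> \<in> Ex. weight W \<alpha> \<le> word_weight W v})
          \<subseteq> vs.span (mon ` {\<alpha> \<in> Ex. weight W \<alpha> < m})"
        using v by (intro vs.span_mono) auto
      then show "word us v \<in> vs.span (mon ` {\<alpha> \<in> Ex. weight W \<alpha> < m})"
        using word_in_span[OF v(1)] by blast
    qed
  qed (rule vs.subspace_span)
  show "vs.span (mon ` {\<alpha> \<in> Ex. weight W \<alpha> < m}) \<subseteq> low us W m"
  proof (rule vs.span_minimal)
    show "mon ` {\<alpha> \<in> Ex. weight W \<alpha> < m} \<subseteq> low us W m"
    proof safe
      fix \<alpha> assume "length \<alpha> = length us" "weight W \<alpha> < m"
      then show "mon \<alpha> \<in> low us W m"
        using set_expand[of 0 \<alpha>]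
        by (auto simp: mon_eq_word word_weight_expand atLeast0LessThan intro!: word_in_low)
    qed
  qed (simp add: low_def)
qed

lemma word_in_S: "set w \<subseteq> {..<length us} \<Longrightarrow> word us w \<in> S"
  using word_in_span[of w] vs.span_mono[of "mon ` {\<alpha> \<in> Ex. weight W \<alpha> \<le> word_weight W w}" "mon ` Ex"]
  by (auto simp: S_def)

lemma S_low: "z \<in> S \<Longrightarrow> \<exists>m. z \<in> low us W m"
  unfolding S_def
proof (induct rule: vs.span_induct_alt)
  case base
  then show ?case by (auto simp: low_def vs.span_zero)
next
  case (step c b z)
  then obtain m \<alpha> where m: "z \<in> low us W m" "\<alpha> \<in> Ex" "b = mon \<alpha>" by auto
  let ?m = "max m (Suc (weight W \<alpha>))"
  have "z \<in> low us W ?m"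
    using m(1) low_mono[of m ?m] by auto
  moreover have "b \<in> low us W ?m"
    unfolding low_eq using m by (intro vs.span_base) auto
  ultimately have "sc c * b + z \<in> low us W ?m"
    unfolding low_def by (intro vs.span_add vs.span_scale)
  then show ?case by blast
qed

lemma mon_mult:
  assumes "\<alpha> \<in> Ex" "\<beta> \<in> Ex"
  obtains c where "c \<in> D"
    "mon \<alpha> * mon \<beta> - sc c * mon (map2 (+) \<alpha> \<beta>) \<in> low us W (weight W \<alpha> + weight W \<beta>)"
proof -
  let ?w = "expand 0 \<alpha> @ expand 0 \<beta>"
  have w: "set ?w \<subseteq> {..<length us}"
    using assms set_expand[of 0 \<alpha>] set_expand[of 0 \<beta>] by auto
  have "letter_counts (length us) ?w = map2 (+) \<alpha> \<beta>"
    using assms letter_counts_expand[of \<alpha>] letter_counts_expand[of \<beta>]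
    by (simp add: letter_counts_append)
  then show ?thesis
    using sort_word[OF w] that assms
    by (auto simp: word_sort_eq_mon[OF w] word_append mon_eq_word word_weight_expand)
qed

lemma S_zero: "0 \<in> S" and S_add: "z \<in> S \<Longrightarrow> w \<in> S \<Longrightarrow> z + w \<in> S"
  and S_diff: "z \<in> S \<Longrightarrow> w \<in> S \<Longrightarrow> z - w \<in> S"
  and S_scale: "z \<in> S \<Longrightarrow> sc c * z \<in> S"
  and S_sum: "(\<And>i. i \<in> I \<Longrightarrow> h i \<in> S) \<Longrightarrow> sum h I \<in> S"
  unfolding S_def by (auto intro: vs.span_zero vs.span_add vs.span_diff vs.span_scale vs.span_sum)

lemma mon_in_S: "\<alpha> \<in> Ex \<Longrightarrow> mon \<alpha> \<in> S"
  unfolding S_def by (auto intro: vs.span_base)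

lemma S_one: "1 \<in> S"
  using word_in_S[of "[]"] by simp

lemma sc_in_S: "sc c \<in> S"
  using S_scale[OF S_one, of c] by simp

lemma us_in_S: "i < length us \<Longrightarrow> us ! i \<in> S"
  using word_in_S[of "[i]"] by (simp add: word_Cons)

lemma S_mult: "z \<in> S \<Longrightarrow> w \<in> S \<Longrightarrow> z * w \<in> S"
  unfolding S_def
proof (rule span_mult[rotated], assumption, assumption)
  fix a b assume "a \<in> mon ` Ex" "b \<in> mon ` Ex"
  then obtain \<alpha> \<beta> where "a * b = word us (expand 0 \<alpha> @ expand 0 \<beta>)" "length \<alpha> = length us" "length \<beta> = length us"
    by (auto simp: word_append mon_eq_word)
  then show "a * b \<in> vs.span (mon ` Ex)"
    using set_expand[of 0 \<alpha>] set_expand[of 0 \<beta>] word_in_S[of "expand 0 \<alpha> @ expand 0 \<beta>"]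
    by (auto simp: S_def atLeast0LessThan)
qed

lemma peval_in_S: "z \<in> S \<Longrightarrow> peval p z \<in> S"
  by (induct p) (auto intro: S_zero S_add S_mult sc_in_S)

lemma co_mon: "\<alpha> \<in> Ex \<Longrightarrow> \<beta> \<in> Ex \<Longrightarrow> co (mon \<alpha>) \<beta> = (if \<alpha> = \<beta> then 1 else 0)"
  using inj_monomial independent_monomials
  by (auto simp: co_def vs.representation_basis inj_on_eq_iff)

lemma co_add: "z \<in> S \<Longrightarrow> w \<in> S \<Longrightarrow> co (z + w) \<alpha> = co z \<alpha> + co w \<alpha>"
  using independent_monomials by (simp add: co_def S_def vs.representation_add)

lemma co_diff: "z \<in> S \<Longrightarrow> w \<in> S \<Longrightarrow> co (z - w) \<alpha> = co z \<alpha> - co w \<alpha>"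
  using independent_monomials by (simp add: co_def S_def vs.representation_diff)

lemma co_scale: "z \<in> S \<Longrightarrow> co (sc c * z) \<alpha> = c * co z \<alpha>"
  using independent_monomials by (simp add: co_def S_def vs.representation_scale)

lemma co_zero [simp]: "co 0 \<alpha> = 0"
  by (simp add: co_def vs.representation_zero)

lemma co_sum: "(\<And>i. i \<in> I \<Longrightarrow> h i \<in> S) \<Longrightarrow> co (sum h I) \<alpha> = (\<Sum>i\<in>I. co (h i) \<alpha>)"
  by (induct I rule: infinite_finite_induct) (auto simp: co_add S_sum)

definition supp :: "'a \<Rightarrow> nat list set" where
  "supp z = {\<alpha> \<in> Ex. co z \<alpha> \<noteq> 0}"

lemma finite_supp: "finite (supp z)"
proof (rule finite_imageD)
  show "finite (mon ` supp z)"
    by (rule finite_subset[OF _ vs.finite_representation[of "mon ` Ex" z]])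
      (auto simp: supp_def co_def)
  show "inj_on mon (supp z)"
    using inj_monomial by (rule inj_on_subset) (auto simp: supp_def)
qed

lemma S_expand: "z \<in> S \<Longrightarrow> z = (\<Sum>\<alpha>\<in>supp z. sc (co z \<alpha>) * mon \<alpha>)"
proof -
  assume z: "z \<in> S"
  have "z = (\<Sum>b | vs.representation (mon ` Ex) z b \<noteq> 0. sc (vs.representation (mon ` Ex) z b) * b)"
    using vs.sum_nonzero_representation_eq[OF independent_monomials] z by (simp add: S_def)
  also have "{b. vs.representation (mon ` Ex) z b \<noteq> 0} = mon ` supp z"
    using vs.representation_ne_zero[of "mon ` Ex" z] by (auto simp: supp_def co_def)
  also have "(\<Sum>b\<in>mon ` supp z. sc (vs.representation (mon ` Ex) z b) * b)
      = (\<Sum>\<alpha>\<in>supp z. sc (co z \<alpha>) * mon \<alpha>)"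
    using inj_monomial by (subst sum.reindex) (auto simp: supp_def co_def intro: inj_on_subset)
  finally show ?thesis .
qed

lemma S_eq_0_iff: "z \<in> S \<Longrightarrow> z = 0 \<longleftrightarrow> supp z = {}"
  using S_expand[of z] by (auto simp: supp_def)

lemma co_span:
  assumes "z \<in> vs.span (mon ` B)" "B \<subseteq> Ex" "\<gamma> \<in> Ex - B"
  shows "co z \<gamma> = 0"
proof -
  have "z \<in> S \<and> co z \<gamma> = 0"
    using assms(1)
  proof (induct rule: vs.span_induct_alt)
    case (step c b z)
    then show ?case
      using assms by (auto simp: co_add co_scale S_add S_scale mon_in_S co_mon subset_iff)
  qed (simp add: S_zero)
  then show ?thesis ..
qed

lemma co_low: "z \<in> low us W m \<Longrightarrow> \<gamma> \<in> Ex \<Longrightarrow> m \<le> weight W \<gamma> \<Longrightarrow> co z \<gamma> = 0"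
  unfolding low_eq by (rule co_span) auto

text \<open>Errors of sorting lie below the weight of \<open>w\<close> and are invisible at
  \<open>\<gamma>\<close>; what remains there is the sorted rearrangement with its constant from
  \<open>D\<close>.\<close>

lemma co_word:
  assumes w: "set w \<subseteq> {..<length us}" and \<gamma>: "\<gamma> \<in> Ex" "word_weight W w \<le> weight W \<gamma>"
  shows "co (word us w) \<gamma> = 0 \<longleftrightarrow> letter_counts (length us) w \<noteq> \<gamma>"
    and "D = {1} \<Longrightarrow> co (word us w) (letter_counts (length us) w) = 1"
proof -
  obtain c where c: "c \<in> D" "word us w - sc c * word us (sort w) \<in> low us W (word_weight W w)"
    using sort_word[OF w] by blast
  have eq: "co (word us w) \<delta> = c * co (mon (letter_counts (length us) w)) \<delta>"
    if "\<delta> \<in> Ex" "word_weight W w \<le> weight W \<delta>" for \<delta>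
  proof -
    have "co (word us w) \<delta> - co (sc c * word us (sort w)) \<delta> = 0"
      using co_low[OF c(2) that] w by (subst (asm) co_diff) (auto intro!: word_in_S S_scale)
    then show ?thesis
      using w by (simp add: word_sort_eq_mon co_scale mon_in_S)
  qed
  show "co (word us w) \<gamma> = 0 \<longleftrightarrow> letter_counts (length us) w \<noteq> \<gamma>"
    using eq[OF \<gamma>] c(1) D_nonzero \<gamma>(1) by (auto simp: co_mon)
  show "co (word us w) (letter_counts (length us) w) = 1" if "D = {1}"
    using eq[of "letter_counts (length us) w"] c(1) that w by (auto simp: co_mon weight_letter_counts)
qed

end

section \<open>Products, growth and maps out of a quantum space\<close>

context quantum_space
begin

abbreviation e0 :: "nat list" where
  "e0 \<equiv> letter_counts (length us) []"

abbreviation e1 :: "nat \<Rightarrow> nat list" where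
  "e1 i \<equiv> letter_counts (length us) [i]"

lemma mon_e0 [simp]: "mon e0 = 1"
  using word_sort_eq_mon[of "[]"] by simp

lemma mon_e1: "i < length us \<Longrightarrow> mon (e1 i) = us ! i"
  using word_sort_eq_mon[of "[i]"] by (simp add: word_Cons)

lemma map2_e0: "\<alpha> \<in> Ex \<Longrightarrow> map2 (+) e0 \<alpha> = \<alpha>"
  by (rule nth_equalityI) (auto simp: nth_letter_counts)

lemma weight_e0: "weight W e0 = 0"
  using weight_letter_counts[of "[]" "length us" W] by simp

lemma weight_pos: "\<alpha> \<in> Ex \<Longrightarrow> \<alpha> \<noteq> e0 \<Longrightarrow> 0 < weight W \<alpha>"
proof (rule ccontr)
  assume \<alpha>: "\<alpha> \<in> Ex" "\<alpha> \<noteq> e0" "\<not> 0 < weight W \<alpha>"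
  then have "\<alpha> ! i = 0" if "i < length us" for i
    using that W_pos[OF that] by (auto simp: weight_def)
  then have "\<alpha> = e0"
    using \<alpha>(1) by (intro nth_equalityI) (auto simp: nth_letter_counts)
  with \<alpha>(2) show False by simp
qed

lemma co_sc: "\<gamma> \<in> Ex \<Longrightarrow> co (sc c) \<gamma> = (if \<gamma> = e0 then c else 0)"
  using co_scale[OF S_one, of c \<gamma>] co_mon[of e0 \<gamma>] by auto

lemma supp_sc: "supp (sc c) \<subseteq> {e0}"
  by (auto simp: supp_def co_sc split: if_splits)

lemma co_mon_mult:
  assumes "\<alpha> \<in> Ex" "\<beta> \<in> Ex"
  shows "co (mon \<alpha> * mon \<beta>) (map2 (+) \<alpha> \<beta>) \<in> D"
    and "\<gamma> \<in> Ex \<Longrightarrow> co (mon \<alpha> * mon \<beta>) \<gamma> \<noteq> 0 \<Longrightarrow>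
      \<gamma> = map2 (+) \<alpha> \<beta> \<or> weight W \<gamma> < weight W \<alpha> + weight W \<beta>"
proof -
  obtain c where c: "c \<in> D" and
    lo: "mon \<alpha> * mon \<beta> - sc c * mon (map2 (+) \<alpha> \<beta>) \<in> low us W (weight W \<alpha> + weight W \<beta>)"
    using mon_mult[OF assms] .
  have len: "map2 (+) \<alpha> \<beta> \<in> Ex"
    using assms by simp
  have co: "co (mon \<alpha> * mon \<beta>) \<gamma> = c * (if map2 (+) \<alpha> \<beta> = \<gamma> then 1 else 0)"
    if "\<gamma> \<in> Ex" "weight W \<alpha> + weight W \<beta> \<le> weight W \<gamma>" for \<gamma>
  proof -
    have "co (mon \<alpha> * mon \<beta>) \<gamma> - co (sc c * mon (map2 (+) \<alpha> \<beta>)) \<gamma> = 0"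
      using co_low[OF lo that] assms len by (subst (asm) co_diff) (auto intro!: S_mult S_scale mon_in_S)
    then show ?thesis
      using co_mon[OF len that(1)] len by (simp add: co_scale mon_in_S)
  qed
  show "co (mon \<alpha> * mon \<beta>) (map2 (+) \<alpha> \<beta>) \<in> D"
    using co[OF len] c assms by (simp add: weight_add)
  show "\<gamma> \<in> Ex \<Longrightarrow> co (mon \<alpha> * mon \<beta>) \<gamma> \<noteq> 0 \<Longrightarrow>
      \<gamma> = map2 (+) \<alpha> \<beta> \<or> weight W \<gamma> < weight W \<alpha> + weight W \<beta>"
    using co[of \<gamma>] by (cases "weight W \<alpha> + weight W \<beta> \<le> weight W \<gamma>") (auto split: if_splits)
qed

lemma co_mult:
  assumes "z \<in> S" "w \<in> S"
  shows "co (z * w) \<gamma> = (\<Sum>(\<alpha>, \<beta>)\<in>supp z \<times> supp w. co z \<alpha> * co w \<beta> * co (mon \<alpha> * mon \<beta>) \<gamma>)"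
proof -
  have mem: "mon \<alpha> \<in> S" if "\<alpha> \<in> supp v" for \<alpha> v
    using that by (intro mon_in_S) (simp add: supp_def)
  have "z * w = (\<Sum>\<alpha>\<in>supp z. sc (co z \<alpha>) * mon \<alpha>) * (\<Sum>\<beta>\<in>supp w. sc (co w \<beta>) * mon \<beta>)"
    using S_expand[OF assms(1)] S_expand[OF assms(2)] by simp
  also have "\<dots> = (\<Sum>(\<alpha>, \<beta>)\<in>supp z \<times> supp w. sc (co z \<alpha> * co w \<beta>) * (mon \<alpha> * mon \<beta>))"
  proof -
    have "sc a * p * (sc b * q) = sc (a * b) * (p * q)" for a b p q
      by (metis mult.assoc sc_central sc_mult)
    then show ?thesis
      by (simp add: sum_product sum.cartesian_product)
  qed
  finally have zw: "z * w = \<dots>" .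
  show ?thesis
    unfolding zw by (subst co_sum) (auto simp: co_scale S_mult S_scale mem intro!: sum.cong)
qed

text \<open>Positive weights bound each exponent of a monomial by its weight, so
  \<open>m ^ length us\<close> monomials suffice to span a space containing
  \<open>low us W m\<close>. This polynomial growth limits both deg f and the number of
  generators.\<close>

lemma card_independent_low:
  assumes "finite A" "vs.independent A" "A \<subseteq> low us W m"
  shows "card A \<le> m ^ length us"
proof -
  let ?B = "{\<alpha>. set \<alpha> \<subseteq> {..<m} \<and> length \<alpha> = length us}"
  have "{\<alpha> \<in> Ex. weight W \<alpha> < m} \<subseteq> ?B"
  proof clarsimp
    fix \<alpha> i assume \<alpha>: "length \<alpha> = length us" "weight W \<alpha> < m" "i \<in> set \<alpha>"
    then obtain k where k: "k < length us" "i = \<alpha> ! k"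
      by (metis in_set_conv_nth)
    have "\<alpha> ! k * 1 \<le> \<alpha> ! k * W k"
      using W_pos[OF k(1)] by (intro mult_le_mono) auto
    also have "\<dots> \<le> weight W \<alpha>"
      unfolding weight_def using k \<alpha> by (intro member_le_sum) auto
    finally show "i < m" using \<alpha> k by simp
  qed
  then have "A \<subseteq> vs.span (mon ` ?B)"
    using assms(3) vs.span_mono[of "mon ` {\<alpha> \<in> Ex. weight W \<alpha> < m}" "mon ` ?B"]
    unfolding low_eq by blast
  then have "card A \<le> card (mon ` ?B)"
    using vs.independent_span_bound[of "mon ` ?B" A] assms(2) by (simp add: finite_lists_length_eq)
  also have "\<dots> \<le> card ?B"
    by (rule card_image_le) (simp add: finite_lists_length_eq)
  also have "\<dots> = m ^ length us"
    by (simp add: card_lists_length_eq)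
  finally show ?thesis .
qed

lemma card_monomials:
  "finite {\<alpha>. set \<alpha> \<subseteq> {..<m} \<and> length \<alpha> = length us} \<and>
   vs.independent (mon ` {\<alpha>. set \<alpha> \<subseteq> {..<m} \<and> length \<alpha> = length us}) \<and>
   card (mon ` {\<alpha>. set \<alpha> \<subseteq> {..<m} \<and> length \<alpha> = length us}) = m ^ length us"
proof (intro conjI)
  show "vs.independent (mon ` {\<alpha>. set \<alpha> \<subseteq> {..<m} \<and> length \<alpha> = length us})"
    by (rule vs.independent_mono[OF independent_monomials]) auto
  have "inj_on mon {\<alpha>. set \<alpha> \<subseteq> {..<m} \<and> length \<alpha> = length us}"
    by (rule inj_on_subset[OF inj_monomial]) auto
  then show "card (mon ` {\<alpha>. set \<alpha> \<subseteq> {..<m} \<and> length \<alpha> = length us}) = m ^ length us"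
    by (simp add: card_image card_lists_length_eq)
qed (simp add: finite_lists_length_eq)

text \<open>Defining the map on the monomial basis makes well-definedness automatic; the content is
  that it sends every word, ordered or not, to the corresponding word. The structure constants
  appear as functions so that the same ones can be read in both algebras.\<close>

lemma universal_property:
  fixes sc' :: "'k \<Rightarrow> 'b::ring_1"
  assumes target: "central_algebra sc'" and len: "length ps = length us"
    and rel: "\<And>i j. i < j \<Longrightarrow> j < length us \<Longrightarrow>
      us ! j * us ! i = sc (d i j) * (us ! i * us ! j) + (sc (l0 i j) + (\<Sum>k<length us. sc (l i j k) * us ! k))"
    and rel': "\<And>i j. i < j \<Longrightarrow> j < length us \<Longrightarrow>
      ps ! j * ps ! i = sc' (d i j) * (ps ! i * ps ! j) + (sc' (l0 i j) + (\<Sum>k<length us. sc' (l i j k) * ps ! k))"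
  obtains h where "algebra_hom sc sc' S h" "\<And>i. i < length us \<Longrightarrow> h (us ! i) = ps ! i"
proof -
  interpret target: central_algebra sc' by (rule target)
  interpret pair: vector_space_pair "\<lambda>c z. sc c * z" "\<lambda>c z. sc' c * z" ..
  obtain h where lin: "Vector_Spaces.linear (\<lambda>c z. sc c * z) (\<lambda>c z. sc' c * z) h"
    and h: "\<And>b. b \<in> mon ` Ex \<Longrightarrow> h b = monomial ps (inv_into Ex mon b)"
    using pair.linear_independent_extend[OF independent_monomials,
        of "\<lambda>b. monomial ps (inv_into Ex mon b)"] by blast
  interpret lin: Vector_Spaces.linear "\<lambda>c z. sc c * z" "\<lambda>c z. sc' c * z" h
    by (rule lin)
  have h_mon: "h (mon \<alpha>) = word ps (expand 0 \<alpha>)" if "\<alpha> \<in> Ex" for \<alpha>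
    using h[of "mon \<alpha>"] that inv_into_f_f[OF inj_monomial that] len
    by (simp add: monomial_eq_word[of \<alpha> ps])
  have h_word: "set w \<subseteq> {..<length us} \<Longrightarrow> h (word us w) = word ps w" for w
  proof (induct "length w" arbitrary: w rule: less_induct)
    case less
    note IH = less(1)
    \<comment> \<open>Two inductions are nested: a swap keeps the length and reduces the disorder,
      while the constant and linear terms of a relation give shorter words, covered by
      \<open>IH\<close>.\<close>
    have "length v = length w \<Longrightarrow> set v \<subseteq> {..<length us} \<Longrightarrow> h (word us v) = word ps v" for v
    proof (induct v rule: sorting_induct)
      case (sorted v)
      then have "v = expand 0 (letter_counts (length us) v)"
        using sort_eq_expand[of v "length us"] by (simp add: sorted_sort_id)
      moreover have "h (mon (letter_counts (length us) v)) = word ps (expand 0 (letter_counts (length us) v))"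
        by (rule h_mon) simp
      ultimately show ?case
        by (simp add: mon_eq_word)
    next
      case (swap u a b v)
      have sets: "set u \<subseteq> {..<length us}" "set v \<subseteq> {..<length us}" "a < length us" "b < length us"
        using swap(4) by auto
      have gen: "p * (((e * (x * y)) + (c + (\<Sum>k<n. f k))) * q)
          = p * (e * (x * y) * q) + (p * (c * q) + (\<Sum>k<n. p * (f k * q)))"
        for p q x y e c :: "'c::ring_1" and f and n :: nat
        by (simp add: distrib_left distrib_right sum_distrib_left sum_distrib_right)
      have us_eq: "word us (u @ a # b # v) = sc (d b a) * word us (u @ b # a # v) +
          (sc (l0 b a) * word us (u @ v) + (\<Sum>k<length us. sc (l b a k) * word us (u @ k # v)))"
      proof -
        have "word us (u @ a # b # v) = word us u * ((us ! a * us ! b) * word us v)"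
          by (simp add: word_append word_Cons mult.assoc)
        also have "\<dots> = word us u * (sc (d b a) * (us ! b * us ! a) * word us v) +
            (word us u * (sc (l0 b a) * word us v) + (\<Sum>k<length us. word us u * (sc (l b a k) * us ! k * word us v)))"
          unfolding rel[OF swap(1) sets(3)] by (rule gen)
        finally show ?thesis
          by (simp only: word_append word_Cons mult.assoc sc_left_commute[of "word us u"])
      qed
      have ps_eq: "word ps (u @ a # b # v) = sc' (d b a) * word ps (u @ b # a # v) +
          (sc' (l0 b a) * word ps (u @ v) + (\<Sum>k<length us. sc' (l b a k) * word ps (u @ k # v)))"
      proof -
        have "word ps (u @ a # b # v) = word ps u * ((ps ! a * ps ! b) * word ps v)"
          by (simp add: word_append word_Cons mult.assoc)
        also have "\<dots> = word ps u * (sc' (d b a) * (ps ! b * ps ! a) * word ps v) +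
            (word ps u * (sc' (l0 b a) * word ps v) + (\<Sum>k<length us. word ps u * (sc' (l b a k) * ps ! k * word ps v)))"
          unfolding rel'[OF swap(1) sets(3)] by (rule gen)
        finally show ?thesis
          by (simp only: word_append word_Cons mult.assoc target.sc_left_commute[of "word ps u"])
      qed
      have "h (word us (u @ b # a # v)) = word ps (u @ b # a # v)"
        using swap(2) swap(3,4) by simp
      moreover have "h (word us (u @ v)) = word ps (u @ v)"
        using IH[of "u @ v"] swap(3) sets by simp
      moreover have "h (word us (u @ k # v)) = word ps (u @ k # v)" if "k < length us" for k
        using IH[of "u @ k # v"] swap(3) sets that by simp
      ultimately show ?case
        unfolding us_eq ps_eq by (simp add: lin.add lin.scale lin.sum)
    qed
    then show ?case using less(2) by blast
  qed
  have h_mult_mon: "h (mon \<alpha> * mon \<beta>) = h (mon \<alpha>) * h (mon \<beta>)" if "\<alpha> \<in> Ex" "\<beta> \<in> Ex" for \<alpha> \<beta>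
  proof -
    have "set (expand 0 \<alpha> @ expand 0 \<beta>) \<subseteq> {..<length us}"
      using that set_expand[of 0 \<alpha>] set_expand[of 0 \<beta>] by auto
    from h_word[OF this] show ?thesis
      using h_mon[OF that(1)] h_mon[OF that(2)] mon_eq_word[OF that(1)] mon_eq_word[OF that(2)]
      by (simp only: word_append)
  qed
  have h_mult_mon': "h (mon \<alpha> * w) = h (mon \<alpha>) * h w" if "\<alpha> \<in> Ex" "w \<in> S" for \<alpha> w
    using that(2) unfolding S_def
  proof (induct rule: vs.span_induct_alt)
    case (step c b w)
    then show ?case
      using that(1) h_mult_mon
      by (auto simp: distrib_left lin.add lin.scale sc_left_commute[of "mon \<alpha>"] target.sc_left_commute[of "h (mon \<alpha>)"])
  qed (simp add: lin.zero)
  have h_mult: "h (z * w) = h z * h w" if "z \<in> S" "w \<in> S" for z w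
    using that(1) unfolding S_def
  proof (induct rule: vs.span_induct_alt)
    case (step c b z)
    then show ?case
      using that(2) h_mult_mon' by (auto simp: distrib_right lin.add lin.scale mult.assoc)
  qed (simp add: lin.zero)
  have h_one: "h 1 = 1"
    using h_word[of "[]"] by simp
  show ?thesis
  proof
    show "algebra_hom sc sc' S h"
      using lin.scale[of _ 1] h_one
      by unfold_locales (auto simp: sc_in_S S_add S_mult lin.add h_mult)
    show "h (us ! i) = ps ! i" if "i < length us" for i
      using h_word[of "[i]"] that by (simp add: word_Cons)
  qed
qed

end

text \<open>A monomial order presented as an additive injection into an ordered group, which turns
  comparisons of exponents into arithmetic with cancellation. Since it refines the weight, errors of
  reordering stay below the leading exponent.\<close>

locale ordered_quantum_space = quantum_space sc us W D
  for sc :: "'k::field \<Rightarrow> 'a::ring_1" and us W D +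
  fixes key :: "nat list \<Rightarrow> 'o::linordered_ab_group_add"
  assumes key_add: "\<alpha> \<in> Ex \<Longrightarrow> \<beta> \<in> Ex \<Longrightarrow> key (map2 (+) \<alpha> \<beta>) = key \<alpha> + key \<beta>"
    and inj_key: "inj_on key Ex"
    and key_weight: "\<alpha> \<in> Ex \<Longrightarrow> \<beta> \<in> Ex \<Longrightarrow> weight W \<alpha> < weight W \<beta> \<Longrightarrow> key \<alpha> < key \<beta>"
begin

lemma key_e0: "key e0 = 0"
proof -
  have "key (map2 (+) e0 e0) = key e0 + key e0"
    by (rule key_add) simp_all
  also have "map2 (+) e0 e0 = e0"
    by (rule map2_e0) simp
  finally show ?thesis by (simp only: add_cancel_right_right)
qed

lemma key_pos: "\<alpha> \<in> Ex \<Longrightarrow> \<alpha> \<noteq> e0 \<Longrightarrow> 0 < key \<alpha>"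
  using key_weight[of e0 \<alpha>] weight_pos[of \<alpha>] by (simp add: weight_e0 key_e0)

lemma key_nonneg: "\<alpha> \<in> Ex \<Longrightarrow> 0 \<le> key \<alpha>"
  using key_pos[of \<alpha>] key_e0 by (cases "\<alpha> = e0") auto

definition lead :: "'a \<Rightarrow> nat list \<Rightarrow> bool" where
  "lead z \<alpha> \<longleftrightarrow> \<alpha> \<in> supp z \<and> (\<forall>\<beta>\<in>supp z. key \<beta> \<le> key \<alpha>)"

lemma lead_Ex: "lead z \<alpha> \<Longrightarrow> \<alpha> \<in> Ex"
  by (simp add: lead_def supp_def)

lemma lead_exists:
  assumes "z \<in> S" "z \<noteq> 0" obtains \<alpha> where "lead z \<alpha>"
proof -
  have fin: "finite (key ` supp z)" "key ` supp z \<noteq> {}"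
    using assms S_eq_0_iff[of z] finite_supp by simp_all
  then obtain \<alpha> where "\<alpha> \<in> supp z" "key \<alpha> = Max (key ` supp z)"
    using Max_in[OF fin] by (elim imageE) metis
  then have "lead z \<alpha>"
    using fin unfolding lead_def by simp
  then show ?thesis by (rule that)
qed

lemma lead_unique: "lead z \<alpha> \<Longrightarrow> lead z \<beta> \<Longrightarrow> \<alpha> = \<beta>"
proof -
  assume a: "lead z \<alpha>" and b: "lead z \<beta>"
  then have "key \<alpha> = key \<beta>"
    unfolding lead_def by (meson order.antisym)
  then show "\<alpha> = \<beta>"
    by (rule inj_onD[OF inj_key _ lead_Ex[OF a] lead_Ex[OF b]])
qed

lemma lead_nonzero: "lead z \<alpha> \<Longrightarrow> z \<noteq> 0"
  by (auto simp: lead_def supp_def)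

lemma lead_e0: "z \<in> S \<Longrightarrow> lead z e0 \<Longrightarrow> z \<in> range sc"
proof -
  assume z: "z \<in> S" "lead z e0"
  have "\<beta> = e0" if "\<beta> \<in> supp z" for \<beta>
    using that z(2) key_pos[of \<beta>] key_e0 by (force simp: lead_def supp_def)
  then have supp: "supp z = {e0}"
    using z(2) unfolding lead_def by blast
  have "z = sc (co z e0)"
    by (subst S_expand[OF z(1)]) (simp add: supp)
  then show ?thesis by blast
qed

lemma lead_e1: "i < length us \<Longrightarrow> lead (us ! i) (e1 i)"
  using co_mon[of "e1 i"] by (auto simp: lead_def supp_def mon_e1 split: if_splits)

lemma key_co_mon_mult:
  assumes "\<alpha> \<in> Ex" "\<beta> \<in> Ex" "\<gamma> \<in> Ex" "co (mon \<alpha> * mon \<beta>) \<gamma> \<noteq> 0" "\<gamma> \<noteq> map2 (+) \<alpha> \<beta>"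
  shows "key \<gamma> < key \<alpha> + key \<beta>"
  using co_mon_mult(2)[OF assms(1-4)] assms key_weight[of \<gamma> "map2 (+) \<alpha> \<beta>"]
  by (simp add: weight_add key_add)

text \<open>Strict monotonicity of addition leaves the pair of leading exponents as the only
  contribution to their sum; its coefficient is a product of two nonzero scalars and an element of
  \<open>D\<close>, hence nonzero.\<close>

lemma lead_mult:
  assumes z: "z \<in> S" "lead z \<alpha>" and w: "w \<in> S" "lead w \<beta>"
  shows "lead (z * w) (map2 (+) \<alpha> \<beta>)"
    and "\<exists>c\<in>D. co (z * w) (map2 (+) \<alpha> \<beta>) = c * co z \<alpha> * co w \<beta>"
proof -
  let ?m = "map2 (+) \<alpha> \<beta>"
  note Ex = lead_Ex[OF z(2)] lead_Ex[OF w(2)]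
  have bound: "key \<gamma> \<le> key \<alpha> + key \<beta> \<and> (\<gamma> = ?m \<longrightarrow> a = \<alpha> \<and> b = \<beta>)"
    if ab: "a \<in> supp z" "b \<in> supp w" and \<gamma>: "\<gamma> \<in> Ex" "co (mon a * mon b) \<gamma> \<noteq> 0" for a b \<gamma>
  proof -
    have abEx: "a \<in> Ex" "b \<in> Ex"
      using ab by (auto simp: supp_def)
    have le: "key a \<le> key \<alpha>" "key b \<le> key \<beta>"
      using ab z(2) w(2) by (auto simp: lead_def)
    have k: "key \<gamma> \<le> key a + key b"
      using key_co_mon_mult[OF abEx \<gamma>] key_add[OF abEx] by (cases "\<gamma> = map2 (+) a b") auto
    have "a = \<alpha> \<and> b = \<beta>" if "\<gamma> = ?m"
    proof -
      have "key \<alpha> + key \<beta> \<le> key a + key b"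
        using k that key_add[OF Ex] by simp
      then have "\<not> key a < key \<alpha>" "\<not> key b < key \<beta>"
        using add_less_le_mono[of "key a" "key \<alpha>" "key b" "key \<beta>"]
          add_le_less_mono[of "key a" "key \<alpha>" "key b" "key \<beta>"] le by (meson leD)+
      then have "key a = key \<alpha>" "key b = key \<beta>"
        using le by (simp_all add: le_less)
      then show ?thesis
        using inj_onD[OF inj_key _ abEx(1) Ex(1)] inj_onD[OF inj_key _ abEx(2) Ex(2)] by simp
    qed
    moreover have "key \<gamma> \<le> key \<alpha> + key \<beta>"
      using k add_mono[OF le] by (rule order_trans)
    ultimately show ?thesis by blast
  qed
  have "co (z * w) ?m = (\<Sum>p\<in>supp z \<times> supp w. if p = (\<alpha>, \<beta>)
      then co z \<alpha> * co w \<beta> * co (mon \<alpha> * mon \<beta>) ?m else 0)"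
    unfolding co_mult[OF z(1) w(1)]
  proof (rule sum.cong[OF refl])
    fix p assume "p \<in> supp z \<times> supp w"
    then show "(case p of (a, b) \<Rightarrow> co z a * co w b * co (mon a * mon b) ?m) =
        (if p = (\<alpha>, \<beta>) then co z \<alpha> * co w \<beta> * co (mon \<alpha> * mon \<beta>) ?m else 0)"
      using bound[of "fst p" "snd p" ?m] Ex by (cases p) auto
  qed
  also have "\<dots> = co z \<alpha> * co w \<beta> * co (mon \<alpha> * mon \<beta>) ?m"
    using z(2) w(2) finite_supp by (subst sum.delta) (auto simp: lead_def)
  finally have co: "co (z * w) ?m = co (mon \<alpha> * mon \<beta>) ?m * co z \<alpha> * co w \<beta>"
    by (simp add: ac_simps)
  then show "\<exists>c\<in>D. co (z * w) ?m = c * co z \<alpha> * co w \<beta>"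
    using co_mon_mult(1)[OF Ex] by blast
  have "co (z * w) ?m \<noteq> 0"
    using co co_mon_mult(1)[OF Ex] D_nonzero z(2) w(2) by (auto simp: lead_def supp_def)
  moreover have "key \<gamma> \<le> key ?m" if \<gamma>: "\<gamma> \<in> supp (z * w)" for \<gamma>
  proof -
    have "\<exists>x\<in>supp z \<times> supp w. (case x of (a, b) \<Rightarrow> co z a * co w b * co (mon a * mon b) \<gamma>) \<noteq> 0"
    proof (rule ccontr)
      assume "\<not> ?thesis"
      then have "co (z * w) \<gamma> = 0"
        unfolding co_mult[OF z(1) w(1)] by (intro sum.neutral) blast
      with \<gamma> show False by (simp add: supp_def)
    qed
    then show ?thesis
      using bound[of _ _ \<gamma>] \<gamma> key_add[OF Ex] by (auto simp: supp_def)
  qed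
  ultimately show "lead (z * w) ?m"
    using Ex by (auto simp: lead_def supp_def)
qed

lemma mult_nonzero: "z \<in> S \<Longrightarrow> z \<noteq> 0 \<Longrightarrow> w \<in> S \<Longrightarrow> w \<noteq> 0 \<Longrightarrow> z * w \<noteq> 0"
proof -
  assume z: "z \<in> S" "z \<noteq> 0" and w: "w \<in> S" "w \<noteq> 0"
  obtain \<alpha> where "lead z \<alpha>" by (rule lead_exists[OF z])
  moreover obtain \<beta> where "lead w \<beta>" by (rule lead_exists[OF w])
  ultimately show "z * w \<noteq> 0"
    using lead_nonzero[OF lead_mult(1)] z w by blast
qed

text \<open>Nonscalar elements are transcendental. In Horner form a zero value would make z p(z) a
  scalar, although its leading exponent contains that of z and so has positive key.\<close>

lemma peval_nonzero:
  assumes z: "z \<in> S" "z \<notin> range sc"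
  shows "p \<noteq> 0 \<Longrightarrow> peval p z \<noteq> 0"
proof (induct p)
  case (pCons c p)
  show ?case
  proof (cases "p = 0")
    case False
    have "z \<noteq> 0"
      using z(2) rangeI[of sc 0] by auto
    then obtain \<alpha> where \<alpha>: "lead z \<alpha>"
      by (rule lead_exists[OF z(1)])
    obtain \<beta> where \<beta>: "lead (peval p z) \<beta>"
      by (rule lead_exists[OF peval_in_S[OF z(1)] pCons(2)[OF False]])
    have "0 < key \<alpha>"
      using \<alpha> lead_e0[OF z(1)] z(2) lead_Ex[OF \<alpha>] by (intro key_pos) auto
    then have pos: "0 < key (map2 (+) \<alpha> \<beta>)"
      using key_nonneg[of \<beta>] key_add lead_Ex[OF \<alpha>] lead_Ex[OF \<beta>] by (simp add: add_pos_nonneg)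
    have lead: "lead (z * peval p z) (map2 (+) \<alpha> \<beta>)"
      by (rule lead_mult(1)[OF z(1) \<alpha> peval_in_S[OF z(1)] \<beta>])
    show ?thesis
    proof
      assume "peval (pCons c p) z = 0"
      then have "z * peval p z = sc (- c)"
        by (simp add: sc_minus eq_neg_iff_add_eq_0 add.commute)
      with lead supp_sc[of "- c"] have "map2 (+) \<alpha> \<beta> = e0"
        by (auto simp: lead_def)
      with pos key_e0 show False by simp
    qed
  qed (use pCons in simp)
qed simp

text \<open>With \<open>D = {1}\<close> both products have the same leading coefficient, so the skew
  commutator keeps the leading exponent with the nonzero factor 1 - c.\<close>

lemma lead_skew_commutator:
  assumes "D = {1}" "c \<noteq> 1" and z: "z \<in> S" "lead z \<alpha>" and w: "w \<in> S" "lead w \<beta>"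
  shows "lead (w * z - sc c * (z * w)) (map2 (+) \<alpha> \<beta>)"
proof -
  have sym: "map2 (+) \<beta> \<alpha> = map2 (+) \<alpha> \<beta>"
    using lead_Ex[OF z(2)] lead_Ex[OF w(2)] by (intro nth_equalityI) auto
  have zw: "lead (z * w) (map2 (+) \<alpha> \<beta>)" "co (z * w) (map2 (+) \<alpha> \<beta>) = co z \<alpha> * co w \<beta>"
    using lead_mult[OF z w] assms(1) by auto
  have wz: "lead (w * z) (map2 (+) \<alpha> \<beta>)" "co (w * z) (map2 (+) \<alpha> \<beta>) = co z \<alpha> * co w \<beta>"
    using lead_mult[OF w z] assms(1) sym by (auto simp: mult.commute)
  have co: "co (w * z - sc c * (z * w)) \<gamma> = co (w * z) \<gamma> - c * co (z * w) \<gamma>" for \<gamma>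
    using z w by (simp add: co_diff co_scale S_mult S_scale)
  have "co (w * z - sc c * (z * w)) (map2 (+) \<alpha> \<beta>) = (1 - c) * (co z \<alpha> * co w \<beta>)"
    by (simp add: co zw wz left_diff_distrib)
  then show ?thesis
    using zw wz z(2) w(2) assms(2) unfolding lead_def supp_def
    by (auto simp: co)
qed

end

section \<open>Weighted lexicographic orders\<close>

lemma pos_polyI: "0 < Polynomial.lead_coeff p \<Longrightarrow> pos_poly (p :: 'c::linordered_idom poly)"
  by (auto simp: pos_poly_def last_coeffs_eq_coeff_degree)

lemma poly_lessI:
  fixes p q :: "'c::linordered_idom poly"
  assumes "Polynomial.coeff p m < Polynomial.coeff q m"
    and "\<And>i. m < i \<Longrightarrow> Polynomial.coeff p i = Polynomial.coeff q i"
  shows "p < q"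
proof -
  have "Polynomial.degree (q - p) = m"
  proof (rule antisym)
    show "Polynomial.degree (q - p) \<le> m"
      by (rule degree_le) (simp add: assms(2))
    show "m \<le> Polynomial.degree (q - p)"
      by (rule le_degree) (use assms(1) in simp)
  qed
  then have "pos_poly (q - p)"
    using assms(1) by (intro pos_polyI) simp
  then show ?thesis by (simp add: less_poly_def)
qed

context quantum_space
begin

text \<open>Integer polynomials are ordered by the sign of the leading coefficient of a difference.
  For a permutation \<open>\<sigma>\<close> of the indices, placing the weight in degree
  \<open>length us\<close> and the exponent of variable i in degree \<open>\<sigma> i\<close> gives
  the weighted order with ties broken lexicographically, the variable with the largest
  \<open>\<sigma> i\<close> counting first.\<close>

definition key :: "(nat \<Rightarrow> nat) \<Rightarrow> nat list \<Rightarrow> int poly" where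
  "key \<sigma> \<alpha> = Polynomial.monom (int (weight W \<alpha>)) (length us) +
     (\<Sum>i<length us. Polynomial.monom (int (\<alpha> ! i)) (\<sigma> i))"

lemma coeff_key:
  assumes "inj_on \<sigma> {..<length us}" "\<sigma> ` {..<length us} \<subseteq> {..<length us}"
  shows "Polynomial.coeff (key \<sigma> \<alpha>) (length us) = int (weight W \<alpha>)"
    and "i < length us \<Longrightarrow> Polynomial.coeff (key \<sigma> \<alpha>) (\<sigma> i) = int (\<alpha> ! i)"
    and "m > length us \<Longrightarrow> Polynomial.coeff (key \<sigma> \<alpha>) m = 0"
    and "m < length us \<Longrightarrow> m \<notin> \<sigma> ` {..<length us} \<Longrightarrow> Polynomial.coeff (key \<sigma> \<alpha>) m = 0"
proof -
  have lt: "\<sigma> j < length us" if "j < length us" for j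
    using assms(2) that by auto
  have ne: "(\<Sum>j<length us. Polynomial.coeff (Polynomial.monom (int (\<alpha> ! j)) (\<sigma> j)) m) = 0"
    if "length us \<le> m" for m
    using lt that by (intro sum.neutral ballI) (metis lessThan_iff Polynomial.coeff_monom not_le)
  show "Polynomial.coeff (key \<sigma> \<alpha>) (length us) = int (weight W \<alpha>)"
    unfolding key_def Polynomial.coeff_add Polynomial.coeff_sum ne[OF order_refl] by simp
  show "m > length us \<Longrightarrow> Polynomial.coeff (key \<sigma> \<alpha>) m = 0"
    unfolding key_def Polynomial.coeff_add Polynomial.coeff_sum using ne[of m] by simp
  show "m < length us \<Longrightarrow> m \<notin> \<sigma> ` {..<length us} \<Longrightarrow> Polynomial.coeff (key \<sigma> \<alpha>) m = 0"
    by (auto simp: key_def coeff_sum intro!: sum.neutral)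
  show "Polynomial.coeff (key \<sigma> \<alpha>) (\<sigma> i) = int (\<alpha> ! i)" if i: "i < length us"
  proof -
    have "(\<Sum>j<length us. Polynomial.coeff (Polynomial.monom (int (\<alpha> ! j)) (\<sigma> j)) (\<sigma> i))
        = (\<Sum>j<length us. if j = i then int (\<alpha> ! i) else 0)"
      using assms(1) i by (intro sum.cong) (auto simp: inj_on_def)
    then show ?thesis
      using lt[OF i] i by (simp add: key_def coeff_sum)
  qed
qed

lemma ordered_by_key:
  assumes \<sigma>: "inj_on \<sigma> {..<length us}" "\<sigma> ` {..<length us} \<subseteq> {..<length us}"
  shows "ordered_quantum_space sc us W D (key \<sigma>)"
proof unfold_locales
  fix \<alpha> \<beta> assume len: "\<alpha> \<in> Ex" "\<beta> \<in> Ex"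
  show "key \<sigma> (map2 (+) \<alpha> \<beta>) = key \<sigma> \<alpha> + key \<sigma> \<beta>"
    using len by (simp add: key_def weight_add sum.distrib add_monom[symmetric])
  show "key \<sigma> \<alpha> < key \<sigma> \<beta>" if "weight W \<alpha> < weight W \<beta>"
    by (rule poly_lessI[of _ "length us"]) (use that in \<open>simp_all add: coeff_key[OF \<sigma>]\<close>)
next
  show "inj_on (key \<sigma>) Ex"
  proof (rule inj_onI)
    fix \<alpha> \<beta> assume eq: "\<alpha> \<in> Ex" "\<beta> \<in> Ex" "key \<sigma> \<alpha> = key \<sigma> \<beta>"
    show "\<alpha> = \<beta>"
    proof (rule nth_equalityI)
      fix i assume "i < length \<alpha>"
      then have "int (\<alpha> ! i) = int (\<beta> ! i)"
        using coeff_key(2)[OF \<sigma>, of i \<alpha>] coeff_key(2)[OF \<sigma>, of i \<beta>] eq by simp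
      then show "\<alpha> ! i = \<beta> ! i" by simp
    qed (use eq in simp)
  qed
qed

lemma nth_e1: "i < length us \<Longrightarrow> k < length us \<Longrightarrow> e1 i ! k = (if i = k then 1 else 0)"
  by (auto simp: nth_letter_counts)

lemma weight_e1: "i < length us \<Longrightarrow> weight W (e1 i) = W i"
  using weight_letter_counts[of "[i]" "length us" W] by simp

lemma key_e1_less:
  assumes \<sigma>: "inj_on \<sigma> {..<length us}" "\<sigma> ` {..<length us} \<subseteq> {..<length us}"
    and "i < length us" "j < length us" "W i = W j" "\<sigma> i < \<sigma> j"
  shows "key \<sigma> (e1 i) < key \<sigma> (e1 j)"
proof (rule poly_lessI[of _ "\<sigma> j"])
  have ij: "i \<noteq> j" using assms by auto
  then show "Polynomial.coeff (key \<sigma> (e1 i)) (\<sigma> j) < Polynomial.coeff (key \<sigma> (e1 j)) (\<sigma> j)"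
    using assms by (simp add: coeff_key(2)[OF \<sigma>] nth_e1)
  fix m assume m: "\<sigma> j < m"
  consider "m = length us" | "m > length us" | k where "m = \<sigma> k" "k < length us"
      | "m < length us" "m \<notin> \<sigma> ` {..<length us}"
    by force
  then show "Polynomial.coeff (key \<sigma> (e1 i)) m = Polynomial.coeff (key \<sigma> (e1 j)) m"
  proof cases
    case 3
    then show ?thesis
      using m assms by (auto simp: coeff_key(2)[OF \<sigma>] nth_e1)
  qed (use assms in \<open>simp_all add: coeff_key[OF \<sigma>] weight_e1\<close>)
qed

lemma weight_one_e1:
  assumes "\<gamma> \<in> Ex" "weight W \<gamma> = 1"
  obtains j where "j < length us" "\<gamma> = e1 j"
proof -
  have "\<exists>j<length us. \<gamma> ! j \<noteq> 0"
  proof (rule ccontr)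
    assume "\<not> ?thesis"
    then have "weight W \<gamma> = 0"
      using assms(1) by (simp add: weight_def)
    then show False using assms(2) by simp
  qed
  then obtain j where j: "j < length us" "\<gamma> ! j \<noteq> 0" by blast
  have "\<gamma> ! k = e1 j ! k" if k: "k < length us" for k
  proof (cases "k = j")
    case True
    have "\<gamma> ! j * 1 \<le> \<gamma> ! j * W j"
      using W_pos[OF j(1)] by (intro mult_le_mono) auto
    also have "\<dots> \<le> 1"
      unfolding assms(2)[symmetric] weight_def using j assms(1) by (intro member_le_sum) auto
    finally show ?thesis using True j by (simp add: nth_e1)
  next
    case False
    have "1 * 1 + \<gamma> ! k * 1 \<le> \<gamma> ! j * W j + \<gamma> ! k * W k"
      using W_pos[OF j(1)] W_pos[OF k] j(2) by (intro add_mono mult_le_mono) auto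
    also have "\<dots> = (\<Sum>i\<in>{j, k}. \<gamma> ! i * W i)"
      using False by simp
    also have "\<dots> \<le> (\<Sum>i<length us. \<gamma> ! i * W i)"
      using j k by (intro sum_mono2) auto
    also have "\<dots> = 1"
      using assms by (simp add: weight_def)
    finally show ?thesis using False j k by (simp add: nth_e1)
  qed
  then have "\<gamma> = e1 j"
    using assms(1) by (intro nth_equalityI) auto
  then show ?thesis using j(1) that by blast
qed

end

text \<open>The two monomial orders obtained from opposite orders of the variables leave
  only a multiple of \<open>u\<^sub>i\<close> and a constant below \<open>u\<^sub>i\<close>.\<close>

lemma (in quantum_space) lead_e1_in_both_orders:
  assumes W1: "W = (\<lambda>_. 1)" and z: "z \<in> S" and i: "i < length us"
    and "ordered_quantum_space.lead sc us (key id) z (e1 i)"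
    and "ordered_quantum_space.lead sc us (key (\<lambda>j. length us - Suc j)) z (e1 i)"
  obtains c s where "c \<noteq> 0" "z = sc c * us ! i + sc s"
proof -
  have \<sigma>: "inj_on id {..<length us}" "id ` {..<length us} \<subseteq> {..<length us}"
      "inj_on (\<lambda>j. length us - Suc j) {..<length us}"
      "(\<lambda>j. length us - Suc j) ` {..<length us} \<subseteq> {..<length us}"
    by (auto simp: inj_on_def)
  interpret A: ordered_quantum_space sc us W D "key id"
    by (rule ordered_by_key[OF \<sigma>(1,2)])
  interpret B: ordered_quantum_space sc us W D "key (\<lambda>j. length us - Suc j)"
    by (rule ordered_by_key[OF \<sigma>(3,4)])
  have sub: "supp z \<subseteq> {e0, e1 i}"
  proof
    fix \<gamma> assume \<gamma>: "\<gamma> \<in> supp z"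
    then have Ex: "\<gamma> \<in> Ex" and le: "\<not> key id (e1 i) < key id \<gamma>"
        "\<not> key (\<lambda>j. length us - Suc j) (e1 i) < key (\<lambda>j. length us - Suc j) \<gamma>"
      using assms(4,5) by (auto simp: A.lead_def B.lead_def not_less supp_def)
    have "\<not> weight W (e1 i) < weight W \<gamma>"
      using A.key_weight[of "e1 i" \<gamma>] Ex le(1) by auto
    then have w: "weight W \<gamma> \<le> 1"
      using weight_e1[OF i] W1 by simp
    show "\<gamma> \<in> {e0, e1 i}"
    proof (cases "\<gamma> = e0")
      case False
      then have "weight W \<gamma> = 1"
        using weight_pos[OF Ex] w by simp
      then obtain j where j: "j < length us" "\<gamma> = e1 j"
        using weight_one_e1[OF Ex] by blast
      have "\<not> i < j"
        using key_e1_less[OF \<sigma>(1,2) i j(1)] le(1) j W1 by auto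
      moreover have "\<not> j < i"
      proof
        assume "j < i"
        then have "length us - Suc i < length us - Suc j"
          using i by simp
        then show False
          using key_e1_less[OF \<sigma>(3,4) i j(1)] le(2) j W1 by simp
      qed
      ultimately show ?thesis using j by simp
    qed simp
  qed
  have neq: "e0 \<noteq> e1 i"
    using weight_e1[OF i] weight_e0 W1 by (metis zero_neq_one)
  have "z = (\<Sum>\<alpha>\<in>{e0, e1 i}. sc (co z \<alpha>) * mon \<alpha>)"
  proof -
    have "(\<Sum>\<alpha>\<in>supp z. sc (co z \<alpha>) * mon \<alpha>) = (\<Sum>\<alpha>\<in>{e0, e1 i}. sc (co z \<alpha>) * mon \<alpha>)"
      using sub by (intro sum.mono_neutral_left) (auto simp: supp_def)
    then show ?thesis using S_expand[OF z] by simp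
  qed
  also have "\<dots> = sc (co z (e1 i)) * us ! i + sc (co z e0)"
    using neq by (simp add: mon_e1[OF i])
  finally have "z = sc (co z (e1 i)) * us ! i + sc (co z e0)" .
  moreover have "co z (e1 i) \<noteq> 0"
    using assms(4) by (simp add: A.lead_def supp_def)
  ultimately show ?thesis using that by blast
qed

section \<open>Normal monomials modulo an ideal\<close>

fun iter_comp :: "'k::comm_semiring_1 poly \<Rightarrow> nat \<Rightarrow> 'k poly" where
  "iter_comp f 0 = [:0, 1:]"
| "iter_comp f (Suc i) = pcompose f (iter_comp f i)"

text \<open>These polynomials satisfy \<open>y x\<^sup>i = q\<^sup>i x\<^sup>i y + x\<^bsup>i-1\<^esup> G\<^sub>i(t)\<close>.\<close>

fun qgh_poly :: "'k::comm_semiring_1 \<Rightarrow> 'k poly \<Rightarrow> 'k poly \<Rightarrow> nat \<Rightarrow> 'k poly" where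
  "qgh_poly q f g 0 = 0"
| "qgh_poly q f g (Suc i) = Polynomial.smult q (qgh_poly q f g i) + pcompose g (iter_comp f i)"

definition normal_monomial :: "'a::monoid_mult \<Rightarrow> 'a \<Rightarrow> 'a \<Rightarrow> nat \<times> nat \<times> nat \<Rightarrow> 'a" where
  "normal_monomial x y t = (\<lambda>(i, j, l). x ^ i * (t ^ j * y ^ l))"

text \<open>The relations hold only up to \<open>J\<close>, so that rewriting takes place in the
  free algebra itself, with \<open>J\<close> the defining ideal and congruences in place of
  cosets.\<close>

locale qgh_modulo = central_algebra sc
  for sc :: "'k::field \<Rightarrow> 'a::ring_1" +
  fixes J :: "'a set" and x y t :: 'a and q :: 'k and f g :: "'k poly"
  assumes J_zero: "0 \<in> J"
    and J_add: "a \<in> J \<Longrightarrow> b \<in> J \<Longrightarrow> a + b \<in> J"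
    and J_mult_left: "b \<in> J \<Longrightarrow> a * b \<in> J"
    and J_mult_right: "b \<in> J \<Longrightarrow> b * a \<in> J"
    and tx: "t * x - x * peval f t \<in> J"
    and yt: "y * t - peval f t * y \<in> J"
    and yx: "y * x - sc q * x * y - peval g t \<in> J"
begin

definition cong :: "'a \<Rightarrow> 'a \<Rightarrow> bool" (infix "\<approx>\<^sub>J" 50) where
  "a \<approx>\<^sub>J b \<longleftrightarrow> a - b \<in> J"

lemma cong_refl: "a \<approx>\<^sub>J a"
  by (simp add: cong_def J_zero)

lemma cong_trans [trans]: "a \<approx>\<^sub>J b \<Longrightarrow> b \<approx>\<^sub>J c \<Longrightarrow> a \<approx>\<^sub>J c"
  unfolding cong_def using J_add[of "a - b" "b - c"] by simp

lemma cong_eq_trans [trans]: "a \<approx>\<^sub>J b \<Longrightarrow> b = c \<Longrightarrow> a \<approx>\<^sub>J c"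
  and eq_cong_trans [trans]: "a = b \<Longrightarrow> b \<approx>\<^sub>J c \<Longrightarrow> a \<approx>\<^sub>J c"
  by simp_all

lemma cong_add: "a \<approx>\<^sub>J b \<Longrightarrow> c \<approx>\<^sub>J d \<Longrightarrow> a + c \<approx>\<^sub>J b + d"
  unfolding cong_def using J_add[of "a - b" "c - d"] by (simp add: algebra_simps)

lemma cong_left: "a \<approx>\<^sub>J b \<Longrightarrow> c * a \<approx>\<^sub>J c * b"
  unfolding cong_def using J_mult_left[of "a - b" c] by (simp add: right_diff_distrib)

lemma cong_right: "a \<approx>\<^sub>J b \<Longrightarrow> a * c \<approx>\<^sub>J b * c"
  unfolding cong_def using J_mult_right[of "a - b" c] by (simp add: left_diff_distrib)

lemma cong_peval_left: "z * w \<approx>\<^sub>J w * v \<Longrightarrow> peval p z * w \<approx>\<^sub>J w * peval p v"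
proof (induct p)
  case (pCons c p)
  have "peval (pCons c p) z * w = sc c * w + z * (peval p z * w)"
    by (simp add: distrib_right mult.assoc)
  also have "\<dots> \<approx>\<^sub>J sc c * w + z * (w * peval p v)"
    using pCons by (intro cong_add cong_refl cong_left)
  also have "\<dots> = sc c * w + (z * w) * peval p v"
    by (simp add: mult.assoc)
  also have "\<dots> \<approx>\<^sub>J sc c * w + (w * v) * peval p v"
    using pCons by (intro cong_add cong_refl cong_right)
  also have "\<dots> = w * peval (pCons c p) v"
    by (simp add: distrib_left mult.assoc sc_central)
  finally show ?case .
qed (simp add: cong_refl)

lemma cong_peval_right: "w * z \<approx>\<^sub>J v * w \<Longrightarrow> w * peval p z \<approx>\<^sub>J peval p v * w"
proof (induct p)
  case (pCons c p)
  have "w * peval (pCons c p) z = sc c * w + (w * z) * peval p z"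
    by (simp add: distrib_left mult.assoc sc_central)
  also have "\<dots> \<approx>\<^sub>J sc c * w + (v * w) * peval p z"
    using pCons by (intro cong_add cong_refl cong_right)
  also have "\<dots> = sc c * w + v * (w * peval p z)"
    by (simp add: mult.assoc)
  also have "\<dots> \<approx>\<^sub>J sc c * w + v * (peval p v * w)"
    using pCons by (intro cong_add cong_refl cong_left)
  also have "\<dots> = peval (pCons c p) v * w"
    by (simp add: distrib_right mult.assoc)
  finally show ?case .
qed (simp add: cong_refl)

lemma t_x_power: "t * x ^ i \<approx>\<^sub>J x ^ i * peval (iter_comp f i) t"
proof (induct i)
  case (Suc i)
  have "t * x ^ Suc i = (t * x) * x ^ i"
    by (simp add: mult.assoc)
  also have "\<dots> \<approx>\<^sub>J (x * peval f t) * x ^ i"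
    using tx by (intro cong_right) (simp add: cong_def)
  also have "\<dots> = x * (peval f t * x ^ i)"
    by (simp add: mult.assoc)
  also have "\<dots> \<approx>\<^sub>J x * (x ^ i * peval f (peval (iter_comp f i) t))"
    by (intro cong_left cong_peval_left Suc)
  also have "\<dots> = x ^ Suc i * peval (iter_comp f (Suc i)) t"
    by (simp add: mult.assoc peval_pcompose)
  finally show ?case .
qed (simp add: cong_refl)

text \<open>The recursion for \<open>qgh_poly\<close> comes from pushing g(t) past a power of x. At
  \<open>i = 0\<close> the truncated exponent \<open>i - 1\<close> does no harm, since the
  polynomial attached to it is 0.\<close>

lemma y_x_power: "y * x ^ i \<approx>\<^sub>J sc (q ^ i) * (x ^ i * y) + x ^ (i - 1) * peval (qgh_poly q f g i) t"
proof (induct i)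
  case (Suc i)
  have "y * x ^ Suc i = (y * x) * x ^ i"
    by (simp add: mult.assoc)
  also have "\<dots> \<approx>\<^sub>J (sc q * x * y + peval g t) * x ^ i"
    using yx by (intro cong_right) (simp add: cong_def algebra_simps)
  also have "\<dots> = sc q * x * (y * x ^ i) + peval g t * x ^ i"
    by (simp add: distrib_right mult.assoc)
  also have "\<dots> \<approx>\<^sub>J sc q * x * (sc (q ^ i) * (x ^ i * y) + x ^ (i - 1) * peval (qgh_poly q f g i) t)
      + x ^ i * peval g (peval (iter_comp f i) t)"
    by (intro cong_add cong_left cong_peval_left Suc t_x_power)
  also have "\<dots> = sc (q ^ Suc i) * (x ^ Suc i * y) + x ^ (Suc i - 1) * peval (qgh_poly q f g (Suc i)) t"
  \<comment> \<open>For positive \<open>i\<close> the new factor x merges with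
    \<open>x ^ (i - 1)\<close>; for \<open>i = 0\<close> that term vanishes.\<close>
  proof (cases i)
    case (Suc m)
    have "sc q * x * (sc c * (x * Y * y) + Y * G) + x * Y * P
        = sc (q * c) * (x * (x * Y) * y) + x * Y * (sc q * G + P)" for c Y G P
      by (simp only: distrib_left mult.assoc sc_mult sc_left_commute[of x] sc_left_commute[of Y] add.assoc)
    from this[of "q ^ i" "x ^ m"] show ?thesis
      by (simp add: Suc peval_add peval_smult peval_pcompose)
  qed (simp add: peval_pcompose mult.assoc)
  finally show ?case .
qed (simp add: cong_refl)

lemma peval_in_span:
  "x ^ i * (peval p t * y ^ l) \<in> vs.span (range (normal_monomial x y t))"
proof -
  have "x ^ i * (peval p t * y ^ l)
      = (\<Sum>j\<le>Polynomial.degree p. sc (Polynomial.coeff p j) * normal_monomial x y t (i, j, l))"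
    by (simp add: peval_altdef sum_distrib_left sum_distrib_right normal_monomial_def mult.assoc
        sc_left_commute[of "x ^ i"])
  also have "\<dots> \<in> vs.span (range (normal_monomial x y t))"
    by (intro vs.span_sum vs.span_scale vs.span_base) auto
  finally show ?thesis .
qed

text \<open>Elements that have a normal form modulo \<open>J\<close>. They include 1 and are stable
  under left multiplication by x, y and t, which in the free algebra leaves nothing outside.\<close>

definition L :: "'a set" where
  "L = {z. \<exists>w\<in>vs.span (range (normal_monomial x y t)). z \<approx>\<^sub>J w}"

lemma L_span: "z \<in> vs.span (range (normal_monomial x y t)) \<Longrightarrow> z \<in> L"
  unfolding L_def using cong_refl by blast

lemma L_cong: "z \<approx>\<^sub>J w \<Longrightarrow> w \<in> L \<Longrightarrow> z \<in> L"
  unfolding L_def using cong_trans by blast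

lemma L_add: "z \<in> L \<Longrightarrow> w \<in> L \<Longrightarrow> z + w \<in> L"
  unfolding L_def using cong_add vs.span_add by blast

lemma L_scale: "z \<in> L \<Longrightarrow> sc c * z \<in> L"
  unfolding L_def using cong_left vs.span_scale by blast

lemma L_gen:
  assumes "\<And>i j l. s * normal_monomial x y t (i, j, l) \<in> L" and "z \<in> L"
  shows "s * z \<in> L"
proof -
  obtain w where w: "w \<in> vs.span (range (normal_monomial x y t))" "z \<approx>\<^sub>J w"
    using assms(2) by (auto simp: L_def)
  have "s * w \<in> L"
    using w(1)
  proof (induct rule: vs.span_induct_alt)
    case base
    then show ?case by (simp add: L_span vs.span_zero)
  next
    case (step c b w)
    then show ?case
      using assms(1) by (auto simp: distrib_left sc_left_commute[of s] intro!: L_add L_scale)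
  qed
  then show ?thesis
    using L_cong[OF cong_left[OF w(2)]] by blast
qed

lemma L_x: "z \<in> L \<Longrightarrow> x * z \<in> L"
proof (erule L_gen[rotated])
  fix i j l
  have "x * normal_monomial x y t (i, j, l) = normal_monomial x y t (Suc i, j, l)"
    by (simp add: normal_monomial_def mult.assoc)
  then show "x * normal_monomial x y t (i, j, l) \<in> L"
    by (metis L_span rangeI vs.span_base)
qed

lemma peval_t_power: "peval p t * t ^ j = peval (p * Polynomial.monom 1 j) t"
  by (simp add: peval_mult peval_monom)

lemma L_t: "z \<in> L \<Longrightarrow> t * z \<in> L"
proof (erule L_gen[rotated])
  fix i j l
  have "t * normal_monomial x y t (i, j, l) = (t * x ^ i) * (t ^ j * y ^ l)"
    by (simp add: normal_monomial_def mult.assoc)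
  also have "\<dots> \<approx>\<^sub>J (x ^ i * peval (iter_comp f i) t) * (t ^ j * y ^ l)"
    by (intro cong_right t_x_power)
  also have "\<dots> = x ^ i * (peval (iter_comp f i * Polynomial.monom 1 j) t * y ^ l)"
    by (simp only: mult.assoc flip: peval_t_power)
  finally show "t * normal_monomial x y t (i, j, l) \<in> L"
    using L_cong L_span peval_in_span by blast
qed

lemma L_y: "z \<in> L \<Longrightarrow> y * z \<in> L"
proof (erule L_gen[rotated])
  fix i j l
  have "y * t \<approx>\<^sub>J peval f t * y"
    using yt by (simp add: cong_def)
  from cong_peval_right[OF this, of "Polynomial.monom 1 j"]
  have y_tj: "y * t ^ j \<approx>\<^sub>J peval (pcompose (Polynomial.monom 1 j) f) t * y"
    by (simp add: peval_monom peval_pcompose)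
  have "y * normal_monomial x y t (i, j, l) = (y * x ^ i) * (t ^ j * y ^ l)"
    by (simp add: normal_monomial_def mult.assoc)
  also have "\<dots> \<approx>\<^sub>J (sc (q ^ i) * (x ^ i * y) + x ^ (i - 1) * peval (qgh_poly q f g i) t) * (t ^ j * y ^ l)"
    by (intro cong_right y_x_power)
  also have "\<dots> = sc (q ^ i) * (x ^ i * ((y * t ^ j) * y ^ l))
      + x ^ (i - 1) * (peval (qgh_poly q f g i * Polynomial.monom 1 j) t * y ^ l)"
    by (simp only: distrib_right mult.assoc flip: peval_t_power)
  also have "\<dots> \<approx>\<^sub>J sc (q ^ i) * (x ^ i * ((peval (pcompose (Polynomial.monom 1 j) f) t * y) * y ^ l))
      + x ^ (i - 1) * (peval (qgh_poly q f g i * Polynomial.monom 1 j) t * y ^ l)"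
    by (intro cong_add cong_left cong_right cong_refl y_tj)
  also have "\<dots> = sc (q ^ i) * (x ^ i * (peval (pcompose (Polynomial.monom 1 j) f) t * y ^ Suc l))
      + x ^ (i - 1) * (peval (qgh_poly q f g i * Polynomial.monom 1 j) t * y ^ l)"
    by (simp add: mult.assoc)
  finally have eq: "y * normal_monomial x y t (i, j, l) \<approx>\<^sub>J \<dots>" .
  have "\<dots> \<in> L"
    by (intro L_add L_scale L_span peval_in_span)
  with eq show "y * normal_monomial x y t (i, j, l) \<in> L"
    using L_cong by blast
qed

lemma L_one: "1 \<in> L"
proof -
  have "normal_monomial x y t (0, 0, 0) = 1"
    by (simp add: normal_monomial_def)
  then show ?thesis
    by (metis L_span rangeI vs.span_base)
qed

end

section \<open>Free algebras and a faithful representation\<close>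

lemma free_alg_induct [case_names zero add single]:
  fixes P :: "('v, 'k::field) free_alg \<Rightarrow> bool"
  assumes "P 0" "\<And>a b. P a \<Longrightarrow> P b \<Longrightarrow> P (a + b)" "\<And>w c. P (Poly_Mapping.single w c)"
  shows "P p"
proof (induct p rule: update_induct)
  case (update p w c)
  have "Poly_Mapping.update w c p = p + Poly_Mapping.single w c"
    using update(1)
    by (intro poly_mapping_eqI) (auto simp: lookup_update lookup_add lookup_single in_keys_iff when_def)
  then show ?case using assms(2,3) update(3) by simp
qed (rule assms(1))

lemma central_algebra_fconst: "central_algebra (fconst :: 'k::field \<Rightarrow> ('v, 'k) free_alg)"
proof
  fix a b c :: 'k and z :: "('v, 'k) free_alg"
  show "fconst (a + b) = (fconst a + fconst b :: ('v, 'k) free_alg)"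
    by (simp add: fconst_def single_add)
  show "fconst (a * b) = (fconst a * fconst b :: ('v, 'k) free_alg)"
    by (simp add: fconst_def mult_single)
  show "fconst 1 = (1 :: ('v, 'k) free_alg)"
    by (simp add: fconst_def)
  show "fconst c * z = z * fconst c"
  proof (induct z rule: free_alg_induct)
    case (add a b)
    then show ?case by (simp add: distrib_left distrib_right)
  qed (simp_all add: fconst_def mult_single mult.commute)
qed

interpretation free: central_algebra "fconst :: 'k::field \<Rightarrow> ('v, 'k) free_alg"
  by (rule central_algebra_fconst)

fun letters :: "'v fword \<Rightarrow> 'v list" where
  "letters (FWord w) = w"

lemma letters_add: "letters (v + w) = letters v @ letters w"
  by (cases v; cases w) simp

lemma letters_0: "letters 0 = []"
  by (simp add: zero_fword_def)

lemma fpoly_eq_peval: "fpoly p z = free.peval p z"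
  by (simp add: fpoly_def free.peval_altdef)

lemma single_eq_prod_list:
  "Poly_Mapping.single w c = fconst c * prod_list (map fvar (letters w))"
proof -
  have *: "Poly_Mapping.single (FWord u) 1 = (prod_list (map fvar u) :: ('a, 'b) free_alg)" for u
  proof (induct u)
    case Nil
    then show ?case by (simp flip: zero_fword_def)
  next
    case (Cons a u)
    have "Poly_Mapping.single (FWord (a # u)) (1::'b) = fvar a * Poly_Mapping.single (FWord u) 1"
      by (simp add: fvar_def mult_single)
    with Cons show ?case by simp
  qed
  then show ?thesis
    by (cases w) (simp add: fconst_def mult_single flip: *)
qed

context central_algebra
begin

definition ev :: "('v \<Rightarrow> 'a) \<Rightarrow> ('v, 'k) free_alg \<Rightarrow> 'a" where
  "ev \<phi> p = (\<Sum>w\<in>Poly_Mapping.keys p. sc (Poly_Mapping.lookup p w) * prod_list (map \<phi> (letters w)))"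

lemma ev_zero [simp]: "ev \<phi> 0 = 0"
  by (simp add: ev_def)

lemma ev_add: "ev \<phi> (a + b) = ev \<phi> a + ev \<phi> b"
  unfolding ev_def by (rule setsum_keys_plus_distrib) (simp_all add: sc_add distrib_right)

lemma ev_single: "ev \<phi> (Poly_Mapping.single w c) = sc c * prod_list (map \<phi> (letters w))"
  by (simp add: ev_def)

lemma ev_fconst [simp]: "ev \<phi> (fconst c) = sc c"
  by (simp add: fconst_def ev_single letters_0)

lemma ev_fvar [simp]: "ev \<phi> (fvar v) = \<phi> v"
  by (simp add: fvar_def ev_single)

lemma ev_mult: "ev \<phi> (a * b) = ev \<phi> a * ev \<phi> b"
proof (induct a rule: free_alg_induct)
  case (single w c)
  show ?case
  proof (induct b rule: free_alg_induct)
    case (single v d)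
    show ?case
      by (simp add: mult_single ev_single letters_add mult.assoc
          sc_left_commute[of "prod_list (map \<phi> (letters w))"])
  qed (simp_all add: distrib_left ev_add)
qed (simp_all add: distrib_right ev_add)

lemma algebra_hom_ev: "algebra_hom fconst sc UNIV (ev \<phi>)"
  by unfold_locales (simp_all add: ev_add ev_mult)

lemma ev_one [simp]: "ev \<phi> 1 = 1"
  using ev_fconst[of \<phi> 1] by simp

lemma ev_diff: "ev \<phi> (a - b) = ev \<phi> a - ev \<phi> b"
  by (rule algebra_hom.h_diff[OF algebra_hom_ev]) simp_all

lemma ev_peval: "ev \<phi> (free.peval p z) = peval p (ev \<phi> z)"
  by (rule algebra_hom.h_peval[OF algebra_hom_ev]) simp

lemma ev_power: "ev \<phi> (z ^ k) = ev \<phi> z ^ k"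
  by (induct k) (simp_all add: ev_mult)

end

lemma free_alg_left_ideal_induct:
  fixes P :: "('v, 'k::field) free_alg \<Rightarrow> bool"
  assumes "P 1" "\<And>a b. P a \<Longrightarrow> P b \<Longrightarrow> P (a + b)" "\<And>c a. P a \<Longrightarrow> P (fconst c * a)"
    "\<And>v a. P a \<Longrightarrow> P (fvar v * a)"
  shows "P p"
proof (induct p rule: free_alg_induct)
  case zero
  show ?case using assms(3)[OF assms(1), of 0] by simp
next
  case (single w c)
  have "P (prod_list (map fvar u))" for u
    by (induct u) (use assms in auto)
  then show ?case
    unfolding single_eq_prod_list by (rule assms(3))
qed (rule assms(2))

text \<open>Linear operators on \<open>\<Prod>\<^sub>i x\<^sup>i K[t, s]\<close>, the outer polynomial variable being \<open>t\<close>
  and the inner one \<open>s\<close>.\<close>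

typedef (overloaded) 'k lop = "{h :: (nat \<Rightarrow> 'k::field poly poly) \<Rightarrow> nat \<Rightarrow> 'k poly poly.
    (\<forall>u v. h (\<lambda>i. u i + v i) = (\<lambda>i. h u i + h v i)) \<and>
    (\<forall>c u. h (\<lambda>i. Polynomial.smult [:c:] (u i)) = (\<lambda>i. Polynomial.smult [:c:] (h u i)))}"
  morphisms app Lop
  by (rule exI[of _ "\<lambda>u i. 0"]) simp

setup_lifting type_definition_lop

instantiation lop :: (field) ring_1
begin

lift_definition zero_lop :: "'a lop" is "\<lambda>u i. 0" by simp
lift_definition one_lop :: "'a lop" is "\<lambda>u. u" by simp
lift_definition plus_lop :: "'a lop \<Rightarrow> 'a lop \<Rightarrow> 'a lop" is "\<lambda>h k u i. h u i + k u i"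
  by (auto simp: algebra_simps smult_add_right)
lift_definition minus_lop :: "'a lop \<Rightarrow> 'a lop \<Rightarrow> 'a lop" is "\<lambda>h k u i. h u i - k u i"
  by (auto simp: algebra_simps smult_diff_right)
lift_definition uminus_lop :: "'a lop \<Rightarrow> 'a lop" is "\<lambda>h u i. - h u i"
  by auto
lift_definition times_lop :: "'a lop \<Rightarrow> 'a lop \<Rightarrow> 'a lop" is "\<lambda>h k u. h (k u)"
  by simp

instance
proof
  show "(0 :: 'a lop) \<noteq> 1"
  proof
    assume "(0 :: 'a lop) = 1"
    then have "app (0 :: 'a lop) (\<lambda>i. 1) 0 = app 1 (\<lambda>i. 1) 0" by simp
    then show False by (simp add: zero_lop.rep_eq one_lop.rep_eq)
  qed
qed (transfer; simp add: algebra_simps fun_eq_iff)+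

end

lift_definition lop_sc :: "'k::field \<Rightarrow> 'k lop" is "\<lambda>c u i. Polynomial.smult [:c:] (u i)"
  by (auto simp: smult_add_right mult.commute)

interpretation lop: central_algebra lop_sc
proof
  show "lop_sc (a + b) = lop_sc a + lop_sc b" for a b :: 'a
    by transfer (simp add: fun_eq_iff flip: smult_add_left)
  show "lop_sc (a * b) = lop_sc a * lop_sc b" for a b :: 'a
    by transfer (simp add: fun_eq_iff mult.commute)
  show "lop_sc 1 = (1 :: 'a lop)"
    by transfer (simp add: fun_eq_iff flip: one_pCons)
  show "lop_sc c * z = z * lop_sc c" for c :: 'a and z
    by transfer simp
qed

text \<open>The functional \<open>e a\<close> kills every other vector of the family, hence their
  span, but not \<open>v a\<close>.\<close>

lemma (in central_algebra) dual_family_independent: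
  assumes add: "\<And>a z w. e a (z + w) = e a z + e a w"
    and scale: "\<And>a c z. e a (sc c * z) = c * e a z"
    and dual: "\<And>a b. e a (v b) = (if a = b then 1 else (0 :: 'k))"
  shows "inj v" and "vs.independent (range v)"
proof -
  show "inj v"
    by (rule injI) (metis dual zero_neq_one)
  show "vs.independent (range v)"
    unfolding vs.dependent_def
  proof
    assume "\<exists>z\<in>range v. z \<in> vs.span (range v - {z})"
    then obtain a where a: "v a \<in> vs.span (range v - {v a})" by blast
    have "e a z = 0" if "z \<in> vs.span (range v - {v a})" for z
      using that
    proof (induct rule: vs.span_induct_alt)
      case base
      show ?case using scale[of a 0 0] by simp
    next
      case (step c b z)
      then show ?case using dual by (auto simp: add scale split: if_splits)
    qed
    from this[OF a] dual[of a a] show False by simp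
  qed
qed

interpretation pp: central_algebra "\<lambda>c :: 'k::field. [:[:c:]:]"
  by unfold_locales (simp_all add: mult.commute one_pCons)

definition emb :: "'k::field poly \<Rightarrow> 'k poly poly" where
  "emb p = pp.peval p [:0, 1:]"

lemma emb_0 [simp]: "emb 0 = 0"
  by (simp add: emb_def)

lemma emb_X: "emb [:0, 1:] = [:0, 1:]"
  by (simp add: emb_def)

lemma emb_add: "emb (p + p') = emb p + emb p'"
  and emb_smult: "emb (Polynomial.smult c p) = Polynomial.smult [:c:] (emb p)"
  and emb_pcompose: "emb (pcompose p p') = pp.peval p (emb p')"
  by (simp_all add: emb_def pp.peval_add pp.peval_smult pp.peval_pcompose)

lemma pcompose_peval: "pcompose (pp.peval p z) w = pp.peval p (pcompose z w)"
  by (induct p) (simp_all add: pcompose_add pcompose_mult pcompose_pCons)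

lemma pcompose_emb: "pcompose (emb p) (emb p') = emb (pcompose p p')"
  by (simp add: emb_pcompose) (simp add: emb_def pcompose_peval pcompose_pCons)

text \<open>\<open>iter_comp\<close> adds f on the outside, as t moves past one more x, whereas y
  substitutes f on the inside. Compatibility of the two is what the relation for y t demands of the
  operators.\<close>

lemma iter_comp_Suc': "pcompose (iter_comp f i) f = iter_comp f (Suc i)"
  by (induct i) (simp_all add: pcompose_pCons flip: pcompose_assoc)

text \<open>The operators \<open>opX\<close>, \<open>opT\<close> and \<open>opY\<close> are left
  multiplication by x, t and y written in normal form coordinates, with s standing for the y at the
  right end. The component with index i is the coefficient of x^i.\<close>

lift_definition opX :: "'k::field lop" is "\<lambda>u i. if i = 0 then 0 else u (i - 1)"
  by (auto simp: fun_eq_iff)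

lift_definition opT :: "'k::field poly \<Rightarrow> 'k lop" is "\<lambda>f u i. emb (iter_comp f i) * u i"
  by (simp add: fun_eq_iff distrib_left)

text \<open>Read off from y x^i p(t, s) = q^i x^i s p(f(t), s) + x^(i-1) G_i(t) p(t, s), where G_i
  is \<open>qgh_poly q f g i\<close>. Component i therefore receives its second term from index i +
  1.\<close>

lift_definition opY :: "'k::field \<Rightarrow> 'k poly \<Rightarrow> 'k poly \<Rightarrow> 'k lop" is
  "\<lambda>q f g u i. Polynomial.smult ([:q ^ i:] * [:0, 1:]) (pcompose (u i) (emb f))
     + emb (qgh_poly q f g (Suc i)) * u (Suc i)"
  by (simp add: fun_eq_iff pcompose_add pcompose_smult ring_distribs smult_add_right mult.commute)

lemma app_peval_opT:
  "app (lop.peval p (opT f)) u i = emb (pcompose p (iter_comp f i)) * u i"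
proof (induct p arbitrary: u)
  case (pCons c p)
  then show ?case
    by (simp add: plus_lop.rep_eq times_lop.rep_eq lop_sc.rep_eq opT.rep_eq emb_pcompose distrib_right
        mult.assoc)
qed (simp add: zero_lop.rep_eq)

lemma lop_eqI: "(\<And>u i. app h u i = app k u i) \<Longrightarrow> h = k"
  by (simp add: app_inject[symmetric] fun_eq_iff)

lemma op_tx: "opT f * opX = opX * lop.peval f (opT f)"
proof (rule lop_eqI)
  fix u :: "nat \<Rightarrow> 'a poly poly" and i
  show "app (opT f * opX) u i = app (opX * lop.peval f (opT f)) u i"
    by (cases i) (simp_all add: times_lop.rep_eq opT.rep_eq opX.rep_eq app_peval_opT)
qed

lemma op_yt: "opY q f g * opT f = lop.peval f (opT f) * opY q f g"
proof (rule lop_eqI)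
  fix u :: "nat \<Rightarrow> 'a poly poly" and i
  show "app (opY q f g * opT f) u i = app (lop.peval f (opT f) * opY q f g) u i"
    by (simp add: times_lop.rep_eq opT.rep_eq opY.rep_eq app_peval_opT pcompose_mult pcompose_emb
        iter_comp_Suc' distrib_left ac_simps del: iter_comp.simps qgh_poly.simps)
      (simp add: ac_simps)
qed

lemma op_yx: "opY q f g * opX = lop_sc q * opX * opY q f g + lop.peval g (opT f)"
proof (rule lop_eqI)
  fix u :: "nat \<Rightarrow> 'a poly poly" and i
  show "app (opY q f g * opX) u i = app (lop_sc q * opX * opY q f g + lop.peval g (opT f)) u i"
    by (cases i) (simp_all add: times_lop.rep_eq plus_lop.rep_eq opX.rep_eq opY.rep_eq lop_sc.rep_eq
        app_peval_opT emb_add emb_smult smult_add_right algebra_simps)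
qed

text \<open>The vector that represents 1; normal monomials send it to the distinct monomials in x, t
  and s.\<close>

definition delta0 :: "nat \<Rightarrow> 'k::field poly poly" where
  "delta0 i = (if i = 0 then 1 else 0)"

lemma app_power_Suc: "app (h ^ Suc k) u = app h (app (h ^ k) u)"
  by (simp add: times_lop.rep_eq)

lemma app_one: "app 1 u = u"
  by (simp add: one_lop.rep_eq)

lemma app_opY_power: "app (opY q f g ^ l) delta0 = (\<lambda>i. if i = 0 then [:Polynomial.monom 1 l:] else 0)"
proof (induct l)
  case (Suc l)
  then show ?case
    by (simp only: app_power_Suc) (auto simp: fun_eq_iff opY.rep_eq monom_Suc pcompose_pCons)
qed (simp add: app_one fun_eq_iff delta0_def monom_0 flip: one_pCons)

lemma app_opT_power: "app (opT f ^ j) (\<lambda>i. if i = 0 then p else 0) = (\<lambda>i. if i = 0 then [:0, 1:] ^ j * p else 0)"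
proof (induct j)
  case (Suc j)
  then show ?case
    by (simp only: app_power_Suc) (auto simp: fun_eq_iff opT.rep_eq emb_X)
qed (auto simp: app_one)

lemma app_opX_power: "app (opX ^ i) u k = (if k < i then 0 else u (k - i))"
proof (induct i arbitrary: k)
  case (Suc i)
  then show ?case
    by (simp only: app_power_Suc) (auto simp: opX.rep_eq)
qed (auto simp: app_one)

lemma app_normal_monomial:
  "app (normal_monomial opX (opY q f g) (opT f) (i, j, l)) delta0 k
    = (if k = i then Polynomial.monom (Polynomial.monom 1 l) j else 0)"
proof -
  have "[:0, 1:] ^ j * [:p:] = Polynomial.monom p j" for p :: "'a poly"
    by (induct j) (simp_all add: monom_0 monom_Suc)
  then show ?thesis
    by (auto simp: normal_monomial_def times_lop.rep_eq app_opY_power app_opT_power app_opX_power)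
qed

text \<open>Extracting the coefficient of x^i t^j s^l from the image of \<open>delta0\<close> gives
  functionals dual to the normal monomials.\<close>

lemma normal_monomials_independent:
  "inj (normal_monomial opX (opY q f g) (opT f))"
  "lop.vs.independent (range (normal_monomial opX (opY q f g) (opT f)))"
proof -
  define e :: "nat \<times> nat \<times> nat \<Rightarrow> 'a lop \<Rightarrow> 'a"
    where "e = (\<lambda>(i, j, l) h. Polynomial.coeff (Polynomial.coeff (app h delta0 i) j) l)"
  have 1: "e a (z + w) = e a z + e a w" for a z w
    by (cases a) (simp add: e_def plus_lop.rep_eq)
  have 2: "e a (lop_sc c * z) = c * e a z" for a c z
    by (cases a) (simp add: e_def times_lop.rep_eq lop_sc.rep_eq)
  have 3: "e a (normal_monomial opX (opY q f g) (opT f) b) = (if a = b then 1 else 0)" for a b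
    by (cases a; cases b) (auto simp: e_def app_normal_monomial)
  show "inj (normal_monomial opX (opY q f g) (opT f))"
    by (rule lop.dual_family_independent(1)[of e, OF 1 2 3])
  show "lop.vs.independent (range (normal_monomial opX (opY q f g) (opT f)))"
    by (rule lop.dual_family_independent(2)[of e, OF 1 2 3])
qed

text \<open>Modulo \<open>g\<close>, this is the quotient map of the algebra by the ideal generated by \<open>x\<close> and \<open>y\<close>.\<close>

definition op_pi :: "'k::field lop \<Rightarrow> 'k poly" where
  "op_pi h = map_poly (\<lambda>p. Polynomial.coeff p 0) (app h delta0 0)"

lemma coeff_op_pi: "Polynomial.coeff (op_pi h) j = Polynomial.coeff (Polynomial.coeff (app h delta0 0) j) 0"
  by (simp add: op_pi_def coeff_map_poly)

lemma op_pi_add: "op_pi (h + k) = op_pi h + op_pi k"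
  by (rule poly_eqI) (simp add: coeff_op_pi plus_lop.rep_eq)

lemma op_pi_sc_mult: "op_pi (lop_sc c * h) = Polynomial.smult c (op_pi h)"
  by (rule poly_eqI) (simp add: coeff_op_pi times_lop.rep_eq lop_sc.rep_eq)

lemma op_pi_one: "op_pi 1 = 1"
  by (rule poly_eqI) (simp add: coeff_op_pi app_one delta0_def)

lemma op_pi_x: "op_pi (opX * h) = 0"
  by (rule poly_eqI) (simp add: coeff_op_pi times_lop.rep_eq opX.rep_eq)

lemma op_pi_t: "op_pi (opT f * h) = pCons 0 (op_pi h)"
  by (rule poly_eqI) (simp add: coeff_op_pi times_lop.rep_eq opT.rep_eq emb_X coeff_pCons split: nat.split)

lemma map_poly_emb_mult:
  "map_poly (\<lambda>p. Polynomial.coeff p 0) (emb p * P) = p * map_poly (\<lambda>p. Polynomial.coeff p 0) (P :: 'k::field poly poly)"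
proof (induct p)
  case (pCons c p)
  have "emb (pCons c p) * P = Polynomial.smult [:c:] P + pCons 0 (emb p * P)"
    by (simp add: emb_def distrib_right)
  then have "map_poly (\<lambda>p. Polynomial.coeff p 0) (emb (pCons c p) * P)
      = Polynomial.smult c (map_poly (\<lambda>p. Polynomial.coeff p 0) P)
        + pCons 0 (map_poly (\<lambda>p. Polynomial.coeff p 0) (emb p * P))"
    by (intro poly_eqI) (simp add: coeff_map_poly coeff_pCons split: nat.split)
  then show ?case using pCons by simp
qed simp

text \<open>At s = 0 the twisted term of \<open>opY\<close> disappears, and only G_1 = g times the
  next component is left.\<close>

lemma op_pi_y: "g dvd op_pi (opY q f g * h)"
proof -
  let ?u = "app h delta0"
  have "op_pi (opY q f g * h) = map_poly (\<lambda>p. Polynomial.coeff p 0) (emb g * ?u (Suc 0))"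
    by (intro poly_eqI)
      (simp add: op_pi_def times_lop.rep_eq opY.rep_eq coeff_map_poly)
  then show ?thesis by (simp add: map_poly_emb_mult)
qed

section \<open>Transfer to HOL-Algebra\<close>

context central_algebra
begin

text \<open>Independence is a property of sets and does not see repetitions; injectivity turns it
  into the property of families that \<open>left_basis\<close> expresses.\<close>

lemma independent_family_iff:
  "inj_on v I \<and> vs.independent (v ` I) \<longleftrightarrow>
    (\<forall>J c. finite J \<longrightarrow> J \<subseteq> I \<longrightarrow> (\<Sum>i\<in>J. sc (c i) * v i) = 0 \<longrightarrow> (\<forall>i\<in>J. c i = 0))"
proof (intro iffI allI impI ballI conjI; (elim conjE)?)
  fix J c i
  assume inj: "inj_on v I" and ind: "vs.independent (v ` I)" and J: "finite J" "J \<subseteq> I"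
    and sum: "(\<Sum>i\<in>J. sc (c i) * v i) = 0" and i: "i \<in> J"
  have injJ: "inj_on v J" using inj J(2) by (rule inj_on_subset)
  have "(\<Sum>b\<in>v ` J. sc (c (inv_into J v b)) * b) = 0"
    using sum injJ by (simp add: sum.reindex)
  then have "c (inv_into J v (v i)) = 0"
    using J i by (intro vs.independentD[OF ind, of "v ` J" "\<lambda>b. c (inv_into J v b)"]) auto
  then show "c i = 0" using injJ i by simp
next
  assume *: "\<forall>J c. finite J \<longrightarrow> J \<subseteq> I \<longrightarrow> (\<Sum>i\<in>J. sc (c i) * v i) = 0 \<longrightarrow> (\<forall>i\<in>J. c i = 0)"
  show inj: "inj_on v I"
  proof (rule inj_onI, rule ccontr)
    fix i j assume ij: "i \<in> I" "j \<in> I" "v i = v j" "i \<noteq> j"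
    have "(\<Sum>k\<in>{i, j}. sc (if k = i then 1 else - 1) * v k) = 0"
      using ij by (simp add: sc_minus)
    from *[rule_format, OF _ _ this, of i] ij show False by simp
  qed
  show "vs.independent (v ` I)"
    unfolding vs.independent_explicit_module
  proof (intro allI impI)
    fix T c b
    assume T: "finite T" "T \<subseteq> v ` I" "(\<Sum>b\<in>T. sc (c b) * b) = 0" "b \<in> T"
    then obtain J where J: "J \<subseteq> I" "finite J" "T = v ` J"
      by (meson finite_subset_image)
    have "inj_on v J" using inj J(1) by (rule inj_on_subset)
    then have "(\<Sum>i\<in>J. sc (c (v i)) * v i) = 0"
      using T(3) J(3) by (simp add: sum.reindex)
    from *[rule_format, OF J(2,1) this] T(4) J(3) show "c b = 0" by auto
  qed
qed

lemma span_family: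
  assumes "z \<in> vs.span (v ` I)"
  obtains J c where "finite J" "J \<subseteq> I" "z = (\<Sum>i\<in>J. sc (c i) * v i)"
proof -
  obtain T c where T: "finite T" "T \<subseteq> v ` I" "z = (\<Sum>b\<in>T. sc (c b) * b)"
    using assms unfolding vs.span_explicit by blast
  obtain J where J: "J \<subseteq> I" "inj_on v J" "T = v ` J"
    using T(2) unfolding subset_image_inj by blast
  then have eq: "z = (\<Sum>i\<in>J. sc (c (v i)) * v i)"
    unfolding T(3) by (simp add: sum.reindex)
  have "finite J"
    using T(1) J by (simp add: finite_image_iff)
  then show ?thesis by (rule that[OF _ J(1) eq])
qed

definition skew_commute :: "'a list \<Rightarrow> nat \<Rightarrow> nat \<Rightarrow> bool" where
  "skew_commute us i j \<longleftrightarrow> (\<exists>d l0 l. d \<noteq> 0 \<and>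
    us ! j * us ! i = sc d * (us ! i * us ! j) + (sc l0 + (\<Sum>k<length us. sc (l k) * us ! k)))"

definition skew_PBW_gens :: "'a list \<Rightarrow> 'a set \<Rightarrow> bool" where
  "skew_PBW_gens us S \<longleftrightarrow> set us \<subseteq> S \<and> S \<subseteq> vs.span (monomial us ` exponents (length us)) \<and>
    inj_on (monomial us) (exponents (length us)) \<and>
    vs.independent (monomial us ` exponents (length us)) \<and>
    (\<forall>i<length us. \<forall>j<length us. skew_commute us i j)"

end

lemma ring_of_type_algebra_simps [simp]:
  "carrier ring_of_type_algebra = UNIV"
  "a \<otimes>\<^bsub>ring_of_type_algebra\<^esub> b = a * b"
  "a \<oplus>\<^bsub>ring_of_type_algebra\<^esub> b = a + b"
  "\<one>\<^bsub>ring_of_type_algebra\<^esub> = 1"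
  "\<zero>\<^bsub>ring_of_type_algebra\<^esub> = 0"
  by (simp_all add: ring_of_type_algebra_def)

lemma finsum_ring_of_type_algebra:
  "finsum (ring_of_type_algebra :: 'a::ring_1 ring) F I = sum F I"
proof -
  interpret ring "ring_of_type_algebra :: 'a ring"
    by (rule ring_of_type_algebra_ring)
  show ?thesis
    by (induct I rule: infinite_finite_induct) simp_all
qed

text \<open>Bridge between carrier-based rings and the type class: \<open>A\<close> is identified
  with its image under \<open>h\<close>, and its coefficient ring \<open>R\<close> with the
  scalars.\<close>

locale embedded_algebra = central_algebra sc + h: ring_hom_ring A "ring_of_type_algebra :: 'a ring" h
  for sc :: "'k::field \<Rightarrow> 'a::ring_1" and A :: "('b, 'm) ring_scheme" and h :: "'b \<Rightarrow> 'a" +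
  fixes R :: "'b set"
  assumes inj_h: "inj_on h (carrier A)" and R_carrier: "R \<subseteq> carrier A"
    and h_R: "h ` R = range sc"
begin

lemma h_finsum: "F \<in> I \<rightarrow> carrier A \<Longrightarrow> h (finsum A F I) = (\<Sum>i\<in>I. h (F i))"
  by (simp add: finsum_ring_of_type_algebra)

lemma h_eq_iff: "a \<in> carrier A \<Longrightarrow> b \<in> carrier A \<Longrightarrow> h a = h b \<longleftrightarrow> a = b"
  using inj_h by (simp add: inj_on_eq_iff)

lemma h_eq_0_iff: "a \<in> carrier A \<Longrightarrow> h a = 0 \<longleftrightarrow> a = \<zero>\<^bsub>A\<^esub>"
  using h_eq_iff[of a "\<zero>\<^bsub>A\<^esub>"] h.hom_zero by simp

lemma h_minus: "a \<in> carrier A \<Longrightarrow> b \<in> carrier A \<Longrightarrow> h (a \<ominus>\<^bsub>A\<^esub> b) = h a - h b"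
proof -
  assume a: "a \<in> carrier A" and b: "b \<in> carrier A"
  have "a \<ominus>\<^bsub>A\<^esub> b \<oplus>\<^bsub>A\<^esub> b = a"
    using a b by (simp add: a_minus_def h.R.a_assoc h.R.l_neg)
  then have "h (a \<ominus>\<^bsub>A\<^esub> b) + h b = h a"
    using a b h.hom_add[of "a \<ominus>\<^bsub>A\<^esub> b" b] by simp
  then show ?thesis by (simp add: eq_diff_eq)
qed

lemma h_pow: "a \<in> carrier A \<Longrightarrow> h (a [^]\<^bsub>A\<^esub> (k::nat)) = h a ^ k"
  by (induct k) (simp_all add: power_Suc2 del: power_Suc)

lemma h_monomial:
  assumes "set xs \<subseteq> carrier A"
  shows "ordered_monomial A xs \<alpha> \<in> carrier A"
    and "h (ordered_monomial A xs \<alpha>) = monomial (map h xs) \<alpha>"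
proof -
  have "ordered_monomial A xs \<alpha> \<in> carrier A \<and> h (ordered_monomial A xs \<alpha>) = monomial (map h xs) \<alpha>"
    using assms
  proof (induct xs arbitrary: \<alpha>)
    case (Cons a xs)
    then show ?case
      by (cases \<alpha>) (auto simp: ordered_monomial_def monomial_def h_pow)
  qed (simp add: ordered_monomial_def monomial_def)
  then show "ordered_monomial A xs \<alpha> \<in> carrier A"
    "h (ordered_monomial A xs \<alpha>) = monomial (map h xs) \<alpha>" by simp_all
qed

definition \<kappa> :: "'k \<Rightarrow> 'b" where
  "\<kappa> k = inv_into R h (sc k)"

lemma \<kappa>: "\<kappa> k \<in> R" "h (\<kappa> k) = sc k" "\<kappa> k \<in> carrier A"
proof -
  have "sc k \<in> h ` R" using h_R by simp
  then show "\<kappa> k \<in> R" "h (\<kappa> k) = sc k"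
    unfolding \<kappa>_def by (rule inv_into_into, rule f_inv_into_f)
  then show "\<kappa> k \<in> carrier A" using R_carrier by blast
qed

lemma \<kappa>_eq_0_iff: "\<kappa> k = \<zero>\<^bsub>A\<^esub> \<longleftrightarrow> k = 0"
  using h_eq_0_iff[OF \<kappa>(3), of k] \<kappa>(2)[of k] by simp

lemma R_scalar: "r \<in> R \<Longrightarrow> \<exists>k. r = \<kappa> k"
proof -
  assume r: "r \<in> R"
  then obtain k where "h r = sc k" using h_R by blast
  then have "r = \<kappa> k"
    using r R_carrier \<kappa>[of k] h_eq_iff[of r "\<kappa> k"] by auto
  then show ?thesis by blast
qed

lemma combination:
  assumes "b \<in> I \<rightarrow> carrier A" "J \<subseteq> I"
  shows "(\<Oplus>\<^bsub>A\<^esub>i\<in>J. \<kappa> (c i) \<otimes>\<^bsub>A\<^esub> b i) \<in> carrier A"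
    and "h (\<Oplus>\<^bsub>A\<^esub>i\<in>J. \<kappa> (c i) \<otimes>\<^bsub>A\<^esub> b i) = (\<Sum>i\<in>J. sc (c i) * h (b i))"
proof -
  have F: "(\<lambda>i. \<kappa> (c i) \<otimes>\<^bsub>A\<^esub> b i) \<in> J \<rightarrow> carrier A"
    using assms \<kappa>(3) by auto
  then show "(\<Oplus>\<^bsub>A\<^esub>i\<in>J. \<kappa> (c i) \<otimes>\<^bsub>A\<^esub> b i) \<in> carrier A"
    by (rule h.R.finsum_closed)
  have "h (\<kappa> (c i) \<otimes>\<^bsub>A\<^esub> b i) = sc (c i) * h (b i)" if "i \<in> J" for i
    using that assms \<kappa>(3)[of "c i"] \<kappa>(2)[of "c i"] by (subst h.hom_mult) auto
  then show "h (\<Oplus>\<^bsub>A\<^esub>i\<in>J. \<kappa> (c i) \<otimes>\<^bsub>A\<^esub> b i) = (\<Sum>i\<in>J. sc (c i) * h (b i))"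
    by (subst h_finsum[OF F]) (rule sum.cong[OF refl])
qed

text \<open>Existence of coordinates amounts to spanning, uniqueness to independence of the
  family.\<close>

lemma left_basis_iff:
  assumes b: "b \<in> I \<rightarrow> carrier A"
  shows "left_basis A R I b \<longleftrightarrow>
    h ` carrier A \<subseteq> vs.span ((\<lambda>i. h (b i)) ` I) \<and>
    inj_on (\<lambda>i. h (b i)) I \<and> vs.independent ((\<lambda>i. h (b i)) ` I)"
    (is "?l \<longleftrightarrow> ?span \<and> ?ind")
proof -
  \<comment> \<open>The coefficients now lie in the field, and their values outside \<open>I\<close>
    are arbitrary; uniqueness is therefore stated on \<open>I\<close> only, in place of extensional
    functions.\<close>
  define P where "P a e \<longleftrightarrow> finite {i\<in>I. e i \<noteq> 0} \<and> h a = (\<Sum>i | i \<in> I \<and> e i \<noteq> 0. sc (e i) * h (b i))" for a e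
  have fam: "(\<exists>!c. c \<in> (I \<rightarrow>\<^sub>E R) \<and> finite {i\<in>I. c i \<noteq> \<zero>\<^bsub>A\<^esub>} \<and>
        a = (\<Oplus>\<^bsub>A\<^esub>i\<in>{i\<in>I. c i \<noteq> \<zero>\<^bsub>A\<^esub>}. c i \<otimes>\<^bsub>A\<^esub> b i)) \<longleftrightarrow>
      (\<exists>e. P a e) \<and> (\<forall>e e'. P a e \<longrightarrow> P a e' \<longrightarrow> (\<forall>i\<in>I. e i = e' i))" (is "(\<exists>!c. ?Q c) \<longleftrightarrow> _")
    if a: "a \<in> carrier A" for a
  proof -
    have Q\<kappa>: "?Q (\<lambda>i\<in>I. \<kappa> (e i)) \<longleftrightarrow> P a e" for e
    proof -
      have set: "{i\<in>I. (\<lambda>i\<in>I. \<kappa> (e i)) i \<noteq> \<zero>\<^bsub>A\<^esub>} = {i\<in>I. e i \<noteq> 0}"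
        by (auto simp: \<kappa>_eq_0_iff)
      have eq: "(\<Oplus>\<^bsub>A\<^esub>i\<in>{i\<in>I. e i \<noteq> 0}. (\<lambda>i\<in>I. \<kappa> (e i)) i \<otimes>\<^bsub>A\<^esub> b i) = (\<Oplus>\<^bsub>A\<^esub>i\<in>{i\<in>I. e i \<noteq> 0}. \<kappa> (e i) \<otimes>\<^bsub>A\<^esub> b i)"
        using b \<kappa>(3) by (intro h.R.finsum_cong') auto
      have "(\<lambda>i\<in>I. \<kappa> (e i)) \<in> (I \<rightarrow>\<^sub>E R)"
        using \<kappa>(1) by auto
      moreover have "a = (\<Oplus>\<^bsub>A\<^esub>i\<in>{i\<in>I. e i \<noteq> 0}. \<kappa> (e i) \<otimes>\<^bsub>A\<^esub> b i) \<longleftrightarrow>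
          h a = (\<Sum>i | i \<in> I \<and> e i \<noteq> 0. sc (e i) * h (b i))"
        using h_eq_iff[OF a combination(1)[OF b, of "{i\<in>I. e i \<noteq> 0}" e]]
          combination(2)[OF b, of "{i\<in>I. e i \<noteq> 0}" e] by auto
      ultimately show ?thesis
        unfolding P_def set eq by simp
    qed
    have c: "\<exists>e. c = (\<lambda>i\<in>I. \<kappa> (e i))" if c: "c \<in> (I \<rightarrow>\<^sub>E R)" for c
    proof -
      have "\<forall>i\<in>I. \<exists>k. c i = \<kappa> k"
        using c R_scalar by blast
      then obtain e where "\<forall>i\<in>I. c i = \<kappa> (e i)" by metis
      then have "c = (\<lambda>i\<in>I. \<kappa> (e i))"
        using c by (intro ext) (auto simp: PiE_def extensional_def)
      then show ?thesis by blast
    qed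
    have inj: "(\<lambda>i\<in>I. \<kappa> (e i)) = (\<lambda>i\<in>I. \<kappa> (e' i)) \<longleftrightarrow> (\<forall>i\<in>I. e i = e' i)" for e e'
    proof
      assume eq: "(\<lambda>i\<in>I. \<kappa> (e i)) = (\<lambda>i\<in>I. \<kappa> (e' i))"
      show "\<forall>i\<in>I. e i = e' i"
      proof
        fix i assume "i \<in> I"
        then have "\<kappa> (e i) = \<kappa> (e' i)"
          using fun_cong[OF eq, of i] by simp
        then have "sc (e i) = sc (e' i)"
          by (metis \<kappa>(2))
        then show "e i = e' i"
          using inj_sc by (simp add: inj_eq)
      qed
    qed auto
    show ?thesis
    proof
      assume ex1: "\<exists>!c. ?Q c"
      then obtain c0 where c0: "?Q c0" by blast
      then obtain e0 where "c0 = (\<lambda>i\<in>I. \<kappa> (e0 i))" using c by blast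
      then have "P a e0" using c0 Q\<kappa> by blast
      moreover have "\<forall>i\<in>I. e i = e' i" if "P a e" "P a e'" for e e'
      proof -
        have "(\<lambda>i\<in>I. \<kappa> (e i)) = (\<lambda>i\<in>I. \<kappa> (e' i))"
          using ex1 that(1)[folded Q\<kappa>] that(2)[folded Q\<kappa>] by blast
        then show ?thesis using inj by blast
      qed
      ultimately show "(\<exists>e. P a e) \<and> (\<forall>e e'. P a e \<longrightarrow> P a e' \<longrightarrow> (\<forall>i\<in>I. e i = e' i))" by blast
    next
      assume r: "(\<exists>e. P a e) \<and> (\<forall>e e'. P a e \<longrightarrow> P a e' \<longrightarrow> (\<forall>i\<in>I. e i = e' i))"
      then obtain e where e: "P a e" by blast
      show "\<exists>!c. ?Q c"
      proof (rule ex1I[of _ "\<lambda>i\<in>I. \<kappa> (e i)"])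
        show "?Q (\<lambda>i\<in>I. \<kappa> (e i))" using e Q\<kappa> by blast
        fix c' assume c': "?Q c'"
        then obtain e' where e': "c' = (\<lambda>i\<in>I. \<kappa> (e' i))" using c by blast
        then have "P a e'" using c' Q\<kappa> by blast
        then have "\<forall>i\<in>I. e' i = e i" using r e by blast
        then show "c' = (\<lambda>i\<in>I. \<kappa> (e i))"
          unfolding e' inj .
      qed
    qed
  qed
  have PJ: "P a (\<lambda>i. if i \<in> J then e i else 0) \<longleftrightarrow> h a = (\<Sum>i\<in>J. sc (e i) * h (b i))"
    if J: "finite J" "J \<subseteq> I" for a e J
  proof -
    have "{i\<in>I. (if i \<in> J then e i else 0) \<noteq> 0} \<subseteq> J" by auto
    moreover have "(\<Sum>i | i \<in> I \<and> (if i \<in> J then e i else 0) \<noteq> 0. sc (if i \<in> J then e i else 0) * h (b i))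
        = (\<Sum>i\<in>J. sc (e i) * h (b i))"
      using J by (intro sum.mono_neutral_cong_left) auto
    ultimately show ?thesis
      unfolding P_def using finite_subset[OF _ J(1)] by metis
  qed
  have lb: "?l \<longleftrightarrow> (\<forall>a\<in>carrier A. (\<exists>e. P a e) \<and> (\<forall>e e'. P a e \<longrightarrow> P a e' \<longrightarrow> (\<forall>i\<in>I. e i = e' i)))"
    unfolding left_basis_def using b fam by simp
  show ?thesis
  proof
    assume l: ?l
    have ?span
    proof
      fix z assume "z \<in> h ` carrier A"
      then obtain a where a: "a \<in> carrier A" "z = h a" by blast
      then obtain e where "P a e" using l lb by blast
      then have "z = (\<Sum>i | i \<in> I \<and> e i \<noteq> 0. sc (e i) * h (b i))"
        using a by (simp add: P_def)
      also have "\<dots> \<in> vs.span ((\<lambda>i. h (b i)) ` I)"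
        by (intro vs.span_sum vs.span_scale vs.span_base) auto
      finally show "z \<in> vs.span ((\<lambda>i. h (b i)) ` I)" .
    qed
    moreover have ?ind
      unfolding independent_family_iff
    proof (intro allI impI ballI)
      fix J c i
      assume J: "finite J" "J \<subseteq> I" "(\<Sum>i\<in>J. sc (c i) * h (b i)) = 0" "i \<in> J"
      \<comment> \<open>A linear relation and the trivial one are two expansions of zero; uniqueness
        makes them agree.\<close>
      have "P \<zero>\<^bsub>A\<^esub> (\<lambda>i. if i \<in> J then c i else 0)"
        using PJ[OF J(1,2), of "\<zero>\<^bsub>A\<^esub>" c] J(3) h.hom_zero by simp
      moreover have "P \<zero>\<^bsub>A\<^esub> (\<lambda>i. 0)"
        using h.hom_zero by (simp add: P_def)
      moreover have "\<forall>e e'. P \<zero>\<^bsub>A\<^esub> e \<longrightarrow> P \<zero>\<^bsub>A\<^esub> e' \<longrightarrow> (\<forall>i\<in>I. e i = e' i)"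
        using l lb h.R.zero_closed by blast
      ultimately have "\<forall>i\<in>I. (if i \<in> J then c i else 0) = 0"
        by blast
      then show "c i = 0"
        using J(2,4) by (metis subsetD)
    qed
    ultimately show "?span \<and> ?ind" by blast
  next
    assume r: "?span \<and> ?ind"
    show ?l
      unfolding lb
    proof (intro ballI conjI allI impI)
      fix a assume a: "a \<in> carrier A"
      then have "h a \<in> vs.span ((\<lambda>i. h (b i)) ` I)" using r by blast
      then obtain J c where "finite J" "J \<subseteq> I" "h a = (\<Sum>i\<in>J. sc (c i) * h (b i))"
        by (rule span_family)
      then have "P a (\<lambda>i. if i \<in> J then c i else 0)"
        using PJ by blast
      then show "\<exists>e. P a e" by blast
    next
      fix a e e' i assume a: "a \<in> carrier A" and e: "P a e" "P a e'" and i: "i \<in> I"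
      define J where "J = {i\<in>I. e i \<noteq> 0} \<union> {i\<in>I. e' i \<noteq> 0}"
      have J: "finite J" "J \<subseteq> I"
        using e by (auto simp: J_def P_def)
      have "(\<Sum>i | i \<in> I \<and> e i \<noteq> 0. sc (e i) * h (b i)) = (\<Sum>i\<in>J. sc (e i) * h (b i))"
        using J by (intro sum.mono_neutral_left) (auto simp: J_def)
      moreover have "(\<Sum>i | i \<in> I \<and> e' i \<noteq> 0. sc (e' i) * h (b i)) = (\<Sum>i\<in>J. sc (e' i) * h (b i))"
        using J by (intro sum.mono_neutral_left) (auto simp: J_def)
      ultimately have "(\<Sum>i\<in>J. sc (e i) * h (b i)) = (\<Sum>i\<in>J. sc (e' i) * h (b i))"
        using e by (simp add: P_def)
      then have zero: "(\<Sum>i\<in>J. sc (e i - e' i) * h (b i)) = 0"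
        by (simp add: sc_diff left_diff_distrib sum_subtractf)
      have "e i - e' i = 0" if "i \<in> J" for i
        using r[THEN conjunct2, unfolded independent_family_iff, rule_format, OF J, of "\<lambda>i. e i - e' i"]
          zero that by simp
      then show "e i = e' i"
        using i by (cases "i \<in> J") (auto simp: J_def)
    qed
  qed
qed


lemma linear_part_iff:
  assumes xs: "set xs \<subseteq> carrier A" and z: "z \<in> carrier A"
  shows "z \<in> linear_part A R xs \<longleftrightarrow>
    (\<exists>l0 l. h z = sc l0 + (\<Sum>k<length xs. sc (l k) * h (xs ! k)))"
proof -
  have b: "(!) xs \<in> {..<length xs} \<rightarrow> carrier A"
    using xs by auto
  have eq: "z = \<kappa> l0 \<oplus>\<^bsub>A\<^esub> (\<Oplus>\<^bsub>A\<^esub>k\<in>{..<length xs}. \<kappa> (l k) \<otimes>\<^bsub>A\<^esub> xs ! k) \<longleftrightarrow>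
      h z = sc l0 + (\<Sum>k<length xs. sc (l k) * h (xs ! k))" for l0 l
  proof -
    note comb = combination[OF b order_refl, of l]
    have "h (\<kappa> l0 \<oplus>\<^bsub>A\<^esub> (\<Oplus>\<^bsub>A\<^esub>k\<in>{..<length xs}. \<kappa> (l k) \<otimes>\<^bsub>A\<^esub> xs ! k))
        = sc l0 + (\<Sum>k<length xs. sc (l k) * h (xs ! k))"
      using h.hom_add[OF \<kappa>(3)[of l0] comb(1)] comb(2) \<kappa>(2)[of l0] by simp
    moreover have "\<kappa> l0 \<oplus>\<^bsub>A\<^esub> (\<Oplus>\<^bsub>A\<^esub>k\<in>{..<length xs}. \<kappa> (l k) \<otimes>\<^bsub>A\<^esub> xs ! k) \<in> carrier A"
      using \<kappa>(3)[of l0] comb(1) by (rule h.R.a_closed)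
    ultimately show ?thesis
      using h_eq_iff[OF z] by metis
  qed
  show ?thesis
  proof
    assume "z \<in> linear_part A R xs"
    then obtain s r where sr: "s \<in> R" "r \<in> {..<length xs} \<rightarrow> R"
      "z = s \<oplus>\<^bsub>A\<^esub> (\<Oplus>\<^bsub>A\<^esub>k\<in>{..<length xs}. r k \<otimes>\<^bsub>A\<^esub> xs ! k)"
      unfolding linear_part_def by blast
    obtain l0 where l0: "s = \<kappa> l0"
      using R_scalar sr(1) by blast
    have "\<forall>k\<in>{..<length xs}. \<exists>m. r k = \<kappa> m"
      using R_scalar sr(2) by blast
    then obtain l where l: "\<forall>k\<in>{..<length xs}. r k = \<kappa> (l k)"
      by metis
    have "(\<Oplus>\<^bsub>A\<^esub>k\<in>{..<length xs}. r k \<otimes>\<^bsub>A\<^esub> xs ! k) = (\<Oplus>\<^bsub>A\<^esub>k\<in>{..<length xs}. \<kappa> (l k) \<otimes>\<^bsub>A\<^esub> xs ! k)"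
      using b \<kappa>(3) l by (intro h.R.finsum_cong') auto
    with sr(3) l0 eq show "\<exists>l0 l. h z = sc l0 + (\<Sum>k<length xs. sc (l k) * h (xs ! k))"
      by metis
  next
    assume "\<exists>l0 l. h z = sc l0 + (\<Sum>k<length xs. sc (l k) * h (xs ! k))"
    then obtain l0 l where "z = \<kappa> l0 \<oplus>\<^bsub>A\<^esub> (\<Oplus>\<^bsub>A\<^esub>k\<in>{..<length xs}. \<kappa> (l k) \<otimes>\<^bsub>A\<^esub> xs ! k)"
      unfolding eq[symmetric] by blast
    then show "z \<in> linear_part A R xs"
      unfolding linear_part_def using \<kappa>(1) by (intro CollectI exI[of _ "\<kappa> l0"] exI[of _ "\<lambda>k. \<kappa> (l k)"]) auto
  qed
qed

lemma skew_commute_iff: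
  assumes xs: "set xs \<subseteq> carrier A" and ij: "i < length xs" "j < length xs"
  shows "(\<exists>d\<in>R - {\<zero>\<^bsub>A\<^esub>}. xs ! j \<otimes>\<^bsub>A\<^esub> xs ! i \<ominus>\<^bsub>A\<^esub> d \<otimes>\<^bsub>A\<^esub> (xs ! i \<otimes>\<^bsub>A\<^esub> xs ! j) \<in> linear_part A R xs)
    \<longleftrightarrow> skew_commute (map h xs) i j"
proof -
  have mem: "xs ! i \<in> carrier A" "xs ! j \<in> carrier A"
    using xs ij by auto
  have sum: "(\<Sum>k<length (map h xs). sc (l k) * map h xs ! k) = (\<Sum>k<length xs. sc (l k) * h (xs ! k))" for l
    by (intro sum.cong) auto
  have iff: "xs ! j \<otimes>\<^bsub>A\<^esub> xs ! i \<ominus>\<^bsub>A\<^esub> \<kappa> d \<otimes>\<^bsub>A\<^esub> (xs ! i \<otimes>\<^bsub>A\<^esub> xs ! j) \<in> linear_part A R xs \<longleftrightarrow>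
      (\<exists>l0 l. h (xs ! j) * h (xs ! i) = sc d * (h (xs ! i) * h (xs ! j)) +
        (sc l0 + (\<Sum>k<length xs. sc (l k) * h (xs ! k))))" for d
  proof -
    have prod: "\<kappa> d \<otimes>\<^bsub>A\<^esub> (xs ! i \<otimes>\<^bsub>A\<^esub> xs ! j) \<in> carrier A" "xs ! j \<otimes>\<^bsub>A\<^esub> xs ! i \<in> carrier A"
      using mem \<kappa>(3) by auto
    have "h (xs ! j \<otimes>\<^bsub>A\<^esub> xs ! i \<ominus>\<^bsub>A\<^esub> \<kappa> d \<otimes>\<^bsub>A\<^esub> (xs ! i \<otimes>\<^bsub>A\<^esub> xs ! j))
        = h (xs ! j) * h (xs ! i) - sc d * (h (xs ! i) * h (xs ! j))"
      using h_minus[OF prod(2,1)] mem \<kappa>(2,3) by simp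
    then show ?thesis
      using linear_part_iff[OF xs h.R.minus_closed[OF prod(2,1)]] by (simp add: diff_eq_eq add.commute)
  qed
  show ?thesis
  proof
    assume "\<exists>d\<in>R - {\<zero>\<^bsub>A\<^esub>}. xs ! j \<otimes>\<^bsub>A\<^esub> xs ! i \<ominus>\<^bsub>A\<^esub> d \<otimes>\<^bsub>A\<^esub> (xs ! i \<otimes>\<^bsub>A\<^esub> xs ! j) \<in> linear_part A R xs"
    then obtain d where d: "\<kappa> d \<noteq> \<zero>\<^bsub>A\<^esub>"
        "xs ! j \<otimes>\<^bsub>A\<^esub> xs ! i \<ominus>\<^bsub>A\<^esub> \<kappa> d \<otimes>\<^bsub>A\<^esub> (xs ! i \<otimes>\<^bsub>A\<^esub> xs ! j) \<in> linear_part A R xs"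
      using R_scalar by blast
    then show "skew_commute (map h xs) i j"
      using ij unfolding skew_commute_def sum iff \<kappa>_eq_0_iff by auto
  next
    assume "skew_commute (map h xs) i j"
    then obtain d where "d \<noteq> 0"
        "xs ! j \<otimes>\<^bsub>A\<^esub> xs ! i \<ominus>\<^bsub>A\<^esub> \<kappa> d \<otimes>\<^bsub>A\<^esub> (xs ! i \<otimes>\<^bsub>A\<^esub> xs ! j) \<in> linear_part A R xs"
      using ij unfolding skew_commute_def sum iff by auto
    then show "\<exists>d\<in>R - {\<zero>\<^bsub>A\<^esub>}. xs ! j \<otimes>\<^bsub>A\<^esub> xs ! i \<ominus>\<^bsub>A\<^esub> d \<otimes>\<^bsub>A\<^esub> (xs ! i \<otimes>\<^bsub>A\<^esub> xs ! j) \<in> linear_part A R xs"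
      using \<kappa>(1)[of d] \<kappa>_eq_0_iff[of d] by blast
  qed
qed

lemma scalar_commute: "a \<in> carrier A \<Longrightarrow> r \<in> R \<Longrightarrow> a \<otimes>\<^bsub>A\<^esub> r \<ominus>\<^bsub>A\<^esub> r \<otimes>\<^bsub>A\<^esub> a = \<zero>\<^bsub>A\<^esub>"
proof -
  assume a: "a \<in> carrier A" and r: "r \<in> R"
  have rc: "r \<in> carrier A" using r R_carrier by blast
  obtain k where "h r = sc k" using r h_R by blast
  then have "h (a \<otimes>\<^bsub>A\<^esub> r) = h (r \<otimes>\<^bsub>A\<^esub> a)"
    using a rc by (simp add: sc_central)
  then have "a \<otimes>\<^bsub>A\<^esub> r = r \<otimes>\<^bsub>A\<^esub> a"
    using h_eq_iff[OF h.R.m_closed[OF a rc] h.R.m_closed[OF rc a]] by blast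
  then show ?thesis
    using a rc by (simp add: a_minus_def h.R.r_neg)
qed

lemma skew_PBW_extension_iff:
  assumes "subring R A"
  shows "skew_PBW_extension A R \<longleftrightarrow> (\<exists>us. skew_PBW_gens us (h ` carrier A))"
proof -
  have zero: "\<zero>\<^bsub>A\<^esub> \<in> R"
    using \<kappa>(1)[of 0] \<kappa>_eq_0_iff[of 0] by simp
  have basis: "left_basis A R {\<alpha>. length \<alpha> = length xs} (ordered_monomial A xs) \<longleftrightarrow>
      h ` carrier A \<subseteq> vs.span (monomial (map h xs) ` exponents (length (map h xs))) \<and>
      inj_on (monomial (map h xs)) (exponents (length (map h xs))) \<and>
      vs.independent (monomial (map h xs) ` exponents (length (map h xs)))" if "set xs \<subseteq> carrier A" for xs
    using left_basis_iff[of "ordered_monomial A xs" "{\<alpha>. length \<alpha> = length xs}"] h_monomial[OF that] by simp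
  \<comment> \<open>Elements of \<open>R\<close> are central, so the choice c = r makes the
    difference zero.\<close>
  have comm: "\<forall>i<length xs. \<forall>r\<in>R - {\<zero>\<^bsub>A\<^esub>}. \<exists>c\<in>R - {\<zero>\<^bsub>A\<^esub>}. xs ! i \<otimes>\<^bsub>A\<^esub> r \<ominus>\<^bsub>A\<^esub> c \<otimes>\<^bsub>A\<^esub> (xs ! i) \<in> R"
    if "set xs \<subseteq> carrier A" for xs
  proof (intro allI impI ballI)
    fix i r assume i: "i < length xs" and r: "r \<in> R - {\<zero>\<^bsub>A\<^esub>}"
    have "xs ! i \<in> carrier A" using that i by auto
    then have "xs ! i \<otimes>\<^bsub>A\<^esub> r \<ominus>\<^bsub>A\<^esub> r \<otimes>\<^bsub>A\<^esub> (xs ! i) \<in> R"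
      using scalar_commute r zero by simp
    then show "\<exists>c\<in>R - {\<zero>\<^bsub>A\<^esub>}. xs ! i \<otimes>\<^bsub>A\<^esub> r \<ominus>\<^bsub>A\<^esub> c \<otimes>\<^bsub>A\<^esub> (xs ! i) \<in> R"
      using r by blast
  qed
  have iff: "(left_basis A R {\<alpha>. length \<alpha> = length xs} (ordered_monomial A xs) \<and>
        (\<forall>i<length xs. \<forall>r\<in>R - {\<zero>\<^bsub>A\<^esub>}. \<exists>c\<in>R - {\<zero>\<^bsub>A\<^esub>}.
           xs ! i \<otimes>\<^bsub>A\<^esub> r \<ominus>\<^bsub>A\<^esub> c \<otimes>\<^bsub>A\<^esub> (xs ! i) \<in> R) \<and>
        (\<forall>i<length xs. \<forall>j<length xs. \<exists>d\<in>R - {\<zero>\<^bsub>A\<^esub>}.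
           xs ! j \<otimes>\<^bsub>A\<^esub> xs ! i \<ominus>\<^bsub>A\<^esub> d \<otimes>\<^bsub>A\<^esub> (xs ! i \<otimes>\<^bsub>A\<^esub> xs ! j) \<in> linear_part A R xs)) \<longleftrightarrow>
      skew_PBW_gens (map h xs) (h ` carrier A)" if xs: "set xs \<subseteq> carrier A" for xs
    using basis[OF xs] comm[OF xs] skew_commute_iff[OF xs] xs
    unfolding skew_PBW_gens_def by (auto simp: image_mono)
  show ?thesis
  proof
    assume "skew_PBW_extension A R"
    then show "\<exists>us. skew_PBW_gens us (h ` carrier A)"
      unfolding skew_PBW_extension_def using iff by metis
  next
    assume "\<exists>us. skew_PBW_gens us (h ` carrier A)"
    then obtain us where us: "skew_PBW_gens us (h ` carrier A)" by blast
    define xs where "xs = map (inv_into (carrier A) h) us"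
    have sub: "set us \<subseteq> h ` carrier A" using us by (simp add: skew_PBW_gens_def)
    have xs: "set xs \<subseteq> carrier A"
      using sub by (auto simp: xs_def intro: inv_into_into)
    have "map h xs = us"
      unfolding xs_def map_map using sub by (intro map_idI) (auto simp: f_inv_into_f)
    then show "skew_PBW_extension A R"
      unfolding skew_PBW_extension_def using iff[OF xs] us xs assms h.R.ring_axioms by blast
  qed
qed

end

section \<open>The quotient as an algebra of operators\<close>

context
  fixes q :: "'k::field" and f g :: "'k poly"
begin

definition rho :: "(qgh_gen, 'k) free_alg \<Rightarrow> 'k lop" where
  "rho = lop.ev (\<lambda>v. case v of GX \<Rightarrow> opX | GY \<Rightarrow> opY q f g | GT \<Rightarrow> opT f)"

abbreviation op_monomial :: "nat \<times> nat \<times> nat \<Rightarrow> 'k lop" where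
  "op_monomial \<equiv> normal_monomial opX (opY q f g) (opT f)"

abbreviation free_monomial :: "nat \<times> nat \<times> nat \<Rightarrow> (qgh_gen, 'k) free_alg" where
  "free_monomial \<equiv> normal_monomial (fvar GX) (fvar GY) (fvar GT)"

lemma rho_gens: "rho (fvar GX) = opX" "rho (fvar GY) = opY q f g" "rho (fvar GT) = opT f"
  by (simp_all add: rho_def)

lemma rho_relators: "r \<in> qgh_relators q f g \<Longrightarrow> rho r = 0"
  unfolding qgh_relators_def Let_def fpoly_eq_peval
  by (auto simp: rho_def lop.ev_diff lop.ev_mult lop.ev_peval op_tx op_yt op_yx)

lemma ring_hom_rho:
  "ring_hom_ring (ring_of_type_algebra :: (qgh_gen, 'k) free_alg ring) (ring_of_type_algebra :: 'k lop ring) rho"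
  by (intro ring_hom_ringI2 ring_of_type_algebra_ring)
    (auto simp: ring_hom_def rho_def lop.ev_add lop.ev_mult)

lemma ideal_qgh: "ideal (qgh_ideal q f g) (ring_of_type_algebra :: (qgh_gen, 'k) free_alg ring)"
  unfolding qgh_ideal_def by (intro ring.genideal_ideal ring_of_type_algebra_ring) simp

lemma relators_subset: "qgh_relators q f g \<subseteq> qgh_ideal q f g"
  unfolding qgh_ideal_def by (intro ring.genideal_self ring_of_type_algebra_ring) simp

lemma rho_free_monomial: "rho (free_monomial a) = op_monomial a"
  by (cases a) (simp add: normal_monomial_def rho_def lop.ev_mult lop.ev_power)

lemma qgh_modulo_ideal:
  "qgh_modulo fconst (qgh_ideal q f g) (fvar GX) (fvar GY) (fvar GT) q f g"
proof -
  interpret I: ideal "qgh_ideal q f g" "ring_of_type_algebra :: (qgh_gen, 'k) free_alg ring"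
    by (rule ideal_qgh)
  have rel: "fvar GT * fvar GX - fvar GX * fpoly f (fvar GT) \<in> qgh_ideal q f g"
    "fvar GY * fvar GT - fpoly f (fvar GT) * fvar GY \<in> qgh_ideal q f g"
    "fvar GY * fvar GX - fconst q * fvar GX * fvar GY - fpoly g (fvar GT) \<in> qgh_ideal q f g"
    using relators_subset by (auto simp: qgh_relators_def Let_def)
  show ?thesis
    using additive_subgroup.zero_closed[OF I.additive_subgroup_axioms]
      additive_subgroup.a_closed[OF I.additive_subgroup_axioms] I.I_l_closed I.I_r_closed rel
    by unfold_locales (simp_all add: fpoly_eq_peval)
qed

lemma free_alg_reduce: "\<exists>w\<in>free.vs.span (range free_monomial). p - w \<in> qgh_ideal q f g"
proof -
  interpret M: qgh_modulo fconst "qgh_ideal q f g" "fvar GX" "fvar GY" "fvar GT" q f g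
    by (rule qgh_modulo_ideal)
  have "p \<in> M.L"
  proof (induct p rule: free_alg_left_ideal_induct)
    case (4 v a)
    then show ?case
      by (cases v) (auto intro: M.L_x M.L_y M.L_t)
  qed (auto intro: M.L_one M.L_add M.L_scale)
  then show ?thesis
    by (simp add: M.L_def M.cong_def)
qed

lemma linear_rho: "Vector_Spaces.linear (\<lambda>c z. fconst c * z) (\<lambda>c z. lop_sc c * z) rho"
  by unfold_locales (simp_all add: rho_def lop.ev_add lop.ev_mult)

lemma kernel_eq:
  "a_kernel (ring_of_type_algebra :: (qgh_gen, 'k) free_alg ring) (ring_of_type_algebra :: 'k lop ring) rho
    = {p. rho p = 0}"
  by (simp add: a_kernel_def')

lemma rho_qgh_ideal: "p \<in> qgh_ideal q f g \<Longrightarrow> rho p = 0"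
proof -
  assume p: "p \<in> qgh_ideal q f g"
  interpret h: ring_hom_ring "ring_of_type_algebra :: (qgh_gen, 'k) free_alg ring"
    "ring_of_type_algebra :: 'k lop ring" rho
    by (rule ring_hom_rho)
  have "qgh_relators q f g \<subseteq> {p. rho p = 0}"
    using rho_relators by blast
  from h.R.genideal_minimal[OF h.kernel_is_ideal, unfolded kernel_eq, OF this] p
  show "rho p = 0"
    unfolding qgh_ideal_def by blast
qed

text \<open>The normal monomials span a complement of the ideal: every coset meets their span, and
  \<open>rho\<close> is injective there because their images are independent. An element of the
  kernel thus has normal form 0.\<close>

lemma kernel_rho:
  "a_kernel (ring_of_type_algebra :: (qgh_gen, 'k) free_alg ring) (ring_of_type_algebra :: 'k lop ring) rho
    = qgh_ideal q f g"
proof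
  interpret h: ring_hom_ring "ring_of_type_algebra :: (qgh_gen, 'k) free_alg ring"
    "ring_of_type_algebra :: 'k lop ring" rho
    by (rule ring_hom_rho)
  interpret I: ideal "qgh_ideal q f g" "ring_of_type_algebra :: (qgh_gen, 'k) free_alg ring"
    by (rule ideal_qgh)
  interpret rho: Vector_Spaces.linear "\<lambda>c z. fconst c * z" "\<lambda>c z. lop_sc c * z" rho
    by (rule linear_rho)
  show "qgh_ideal q f g \<subseteq> a_kernel ring_of_type_algebra ring_of_type_algebra rho"
    unfolding kernel_eq using rho_qgh_ideal by blast
  have comp: "rho ` range free_monomial = range op_monomial"
    by (auto simp: rho_free_monomial image_image)
  have inj: "inj_on rho (free.vs.span (range free_monomial))"
  proof (rule rho.inj_on_span_independent_image)
    show "lop.vs.independent (rho ` range free_monomial)"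
      unfolding comp by (rule normal_monomials_independent)
    show "inj_on rho (range free_monomial)"
      using normal_monomials_independent(1)[of q f g]
      by (intro inj_onI) (auto simp: rho_free_monomial inj_eq)
  qed
  show "a_kernel ring_of_type_algebra ring_of_type_algebra rho \<subseteq> qgh_ideal q f g"
  proof
    fix p assume "p \<in> a_kernel (ring_of_type_algebra :: (qgh_gen, 'k) free_alg ring) ring_of_type_algebra rho"
    then have p: "rho p = 0" unfolding kernel_eq by simp
    obtain w where w: "w \<in> free.vs.span (range free_monomial)" "p - w \<in> qgh_ideal q f g"
      using free_alg_reduce by blast
    have "rho w = 0"
      using rho_qgh_ideal[OF w(2)] p by (simp add: rho.diff)
    then have "w = 0"
      using inj_onD[OF inj _ w(1) free.vs.span_zero] rho.zero by simp
    then show "p \<in> qgh_ideal q f g" using w(2) by simp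
  qed
qed

lemma range_rho: "range rho = lop.vs.span (range op_monomial)"
proof
  interpret rho: Vector_Spaces.linear "\<lambda>c z. fconst c * z" "\<lambda>c z. lop_sc c * z" rho
    by (rule linear_rho)
  have comp: "rho ` range free_monomial = range op_monomial"
    by (auto simp: rho_free_monomial image_image)
  have img: "rho ` free.vs.span (range free_monomial) = lop.vs.span (range op_monomial)"
    using rho.span_image[of "range free_monomial"] comp by simp
  show "range rho \<subseteq> lop.vs.span (range op_monomial)"
  proof safe
    fix p
    obtain w where w: "w \<in> free.vs.span (range free_monomial)" "p - w \<in> qgh_ideal q f g"
      using free_alg_reduce by blast
    then have "rho p = rho w"
      using rho_qgh_ideal[OF w(2)] by (simp add: rho.diff)
    then show "rho p \<in> lop.vs.span (range op_monomial)"
      using w(1) img by blast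
  qed
  show "lop.vs.span (range op_monomial) \<subseteq> range rho"
    using img by blast
qed

text \<open>First isomorphism theorem: each coset goes to the single value that \<open>rho\<close>
  takes on it. This exchanges the quotient ring for the span of the operator monomials, with
  \<open>qgh_scalar\<close> becoming \<open>lop_sc\<close>.\<close>

lemma skew_PBW_extension_via_iff:
  "skew_PBW_extension_via (ring_of_type_algebra :: 'k ring) (qgh_algebra q f g) (qgh_scalar q f g)
    \<longleftrightarrow> (\<exists>us. lop.skew_PBW_gens us (lop.vs.span (range op_monomial)))"
proof -
  let ?F = "ring_of_type_algebra :: (qgh_gen, 'k) free_alg ring"
  let ?L = "ring_of_type_algebra :: 'k lop ring"
  let ?K = "ring_of_type_algebra :: 'k ring"
  let ?h = "\<lambda>C. the_elem (rho ` C)"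
  interpret r: ring_hom_ring ?F ?L rho
    by (rule ring_hom_rho)
  have A: "qgh_algebra q f g = ?F Quot (a_kernel ?F ?L rho)"
    by (simp add: qgh_algebra_def kernel_rho)
  interpret I: ideal "qgh_ideal q f g" ?F
    by (rule ideal_qgh)
  have ringA: "ring (qgh_algebra q f g)"
    unfolding qgh_algebra_def by (rule I.quotient_is_ring)
  have hom: "?h \<in> ring_hom (qgh_algebra q f g) ?L"
    unfolding A by (rule r.the_elem_hom)
  have inj: "inj_on ?h (carrier (qgh_algebra q f g))"
    unfolding A by (rule inj_onI) (rule r.the_elem_inj)
  have img: "?h ` carrier (qgh_algebra q f g) = lop.vs.span (range op_monomial)"
    unfolding A r.the_elem_surj by (simp add: range_rho)
  have rho_fconst: "rho (fconst c) = lop_sc c" for c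
    by (simp add: rho_def)
  have sc: "?h (qgh_scalar q f g c) = lop_sc c" for c
    using r.the_elem_simp[of "fconst c", unfolded kernel_rho]
    by (simp add: qgh_scalar_def rho_fconst)
  have proj: "(+>\<^bsub>?F\<^esub>) (qgh_ideal q f g) \<in> ring_hom ?F (qgh_algebra q f g)"
    unfolding qgh_algebra_def by (rule I.rcos_ring_hom)
  have "fconst \<in> ring_hom ?K ?F"
    by (auto simp: ring_hom_def free.sc_add free.sc_mult simp del: free.vs.scale_scale)
  from ring_hom_trans[OF this proj] have scalar: "qgh_scalar q f g \<in> ring_hom ?K (qgh_algebra q f g)"
    by (simp add: qgh_scalar_def[abs_def] comp_def)
  have inj_scalar: "inj_on (qgh_scalar q f g) (carrier ?K)"
    by (rule inj_onI) (metis sc lop.inj_sc injD)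
  interpret s: ring_hom_ring ?K "qgh_algebra q f g" "qgh_scalar q f g"
    by (intro ring_hom_ringI2 ring_of_type_algebra_ring ringA scalar)
  have sub: "subring (qgh_scalar q f g ` carrier ?K) (qgh_algebra q f g)"
    by (rule s.img_is_subring[OF s.R.carrier_is_subring])
  interpret E: embedded_algebra lop_sc "qgh_algebra q f g" ?h "qgh_scalar q f g ` carrier ?K"
  proof (intro embedded_algebra.intro embedded_algebra_axioms.intro)
    show "ring_hom_ring (qgh_algebra q f g) ?L ?h"
      by (intro ring_hom_ringI2 ring_of_type_algebra_ring ringA hom)
    show "qgh_scalar q f g ` carrier ?K \<subseteq> carrier (qgh_algebra q f g)"
      using s.hom_closed by blast
    show "?h ` qgh_scalar q f g ` carrier ?K = range lop_sc"
      by (simp only: image_image sc ring_of_type_algebra_simps)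
  qed (rule lop.central_algebra_axioms inj)+
  show ?thesis
    unfolding skew_PBW_extension_via_def
    using scalar inj_scalar E.skew_PBW_extension_iff[OF sub] by (simp add: img)
qed

text \<open>Induction over the left factor, built up by left multiplication: t acts as
  multiplication by the variable, x gives zero, and y gives multiples of g. The right factor stays
  arbitrary throughout.\<close>

lemma op_pi_mult:
  assumes "a \<in> lop.vs.span (range op_monomial)"
  shows "g dvd op_pi (a * r) - op_pi a * op_pi r"
proof -
  have "\<forall>r. g dvd op_pi (rho p * r) - op_pi (rho p) * op_pi r" for p
  proof (induct p rule: free_alg_left_ideal_induct)
    case 1
    then show ?case by (simp add: rho_def op_pi_one)
  next
    case (2 a b)
    show ?case
    proof
      fix r
      have "op_pi (rho (a + b) * r) - op_pi (rho (a + b)) * op_pi r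
          = (op_pi (rho a * r) - op_pi (rho a) * op_pi r) + (op_pi (rho b * r) - op_pi (rho b) * op_pi r)"
        by (simp add: rho_def lop.ev_add op_pi_add algebra_simps)
      then show "g dvd op_pi (rho (a + b) * r) - op_pi (rho (a + b)) * op_pi r"
        using 2 dvd_add by metis
    qed
  next
    case (3 c a)
    show ?case
    proof
      fix r
      have "op_pi (rho (fconst c * a) * r) - op_pi (rho (fconst c * a)) * op_pi r
          = Polynomial.smult c (op_pi (rho a * r) - op_pi (rho a) * op_pi r)"
        by (simp add: rho_def lop.ev_mult mult.assoc op_pi_sc_mult smult_diff_right)
      then show "g dvd op_pi (rho (fconst c * a) * r) - op_pi (rho (fconst c * a)) * op_pi r"
        using 3 dvd_smult by metis
    qed
  next
    case (4 v a)
    show ?case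
    proof
      fix r
      have eq: "rho (fvar v * a) = rho (fvar v) * rho a"
        by (simp add: rho_def lop.ev_mult)
      show "g dvd op_pi (rho (fvar v * a) * r) - op_pi (rho (fvar v * a)) * op_pi r"
      proof (cases v)
        case GX
        then show ?thesis
          unfolding eq by (simp add: rho_gens mult.assoc op_pi_x)
      next
        case GY
        then show ?thesis
          unfolding eq by (simp add: rho_gens mult.assoc op_pi_y)
      next
        case GT
        have "op_pi (rho (fvar v) * rho a * r) - op_pi (rho (fvar v) * rho a) * op_pi r
            = [:0, 1:] * (op_pi (rho a * r) - op_pi (rho a) * op_pi r)"
          by (simp add: GT rho_gens mult.assoc op_pi_t)
        then show ?thesis
          unfolding eq using 4 dvd_mult by metis
      qed
    qed
  qed
  then show ?thesis
    using assms range_rho by (metis rangeE)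
qed

end

section \<open>Growth and zero divisors\<close>

text \<open>The polynomial p for which x^n p(t) is a product of n factors, each of them x or t x;
  the head of the list records the last factor.\<close>

fun growth_poly :: "'k::field poly \<Rightarrow> bool list \<Rightarrow> 'k poly" where
  "growth_poly f [] = 1"
| "growth_poly f (b # bs) = pcompose (growth_poly f bs * (if b then [:0, 1:] else 1)) f"

lemma growth_poly_nonzero: "0 < Polynomial.degree f \<Longrightarrow> growth_poly f bs \<noteq> 0"
  by (induct bs) (auto simp: pcompose_eq_0_iff)

lemma degree_growth_poly:
  assumes "0 < Polynomial.degree f"
  shows "Polynomial.degree (growth_poly f (b # bs)) =
    (Polynomial.degree (growth_poly f bs) + of_bool b) * Polynomial.degree f"
  using growth_poly_nonzero[OF assms, of bs] by (auto simp: degree_pcompose degree_mult_eq)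

text \<open>The flags are digits. Every growth polynomial has degree divisible by deg f, so after
  division by deg f the head flag is the residue modulo deg f, and deg f >= 2 keeps 0 and 1
  apart.\<close>

lemma growth_poly_inj:
  assumes f: "2 \<le> Polynomial.degree f"
  shows "length bs = length bs' \<Longrightarrow>
    Polynomial.degree (growth_poly f bs) = Polynomial.degree (growth_poly f bs') \<Longrightarrow> bs = bs'"
proof (induct bs bs' rule: list_induct2)
  case (Cons b bs b' bs')
  let ?d = "\<lambda>bs. Polynomial.degree (growth_poly f bs)"
  have "(?d bs + of_bool b) * Polynomial.degree f = (?d bs' + of_bool b') * Polynomial.degree f"
    using Cons(3) f by (simp add: degree_growth_poly del: growth_poly.simps)
  then have eq: "?d bs + of_bool b = ?d bs' + of_bool b'"
    using f by simp
  have mod: "?d bs mod Polynomial.degree f = 0" for bs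
    using f by (cases bs) (simp_all add: degree_growth_poly del: growth_poly.simps(2))
  have "(?d bs + of_bool b) mod Polynomial.degree f = of_bool b" for bs b
    using mod[of bs] f by (subst mod_add_left_eq[symmetric]) auto
  then have "of_bool b = (of_bool b' :: nat)"
    using eq by metis
  then have "b = b'" by (cases b; cases b') simp_all
  then show ?case using Cons(2) eq by simp
qed simp

lemma distinct_degrees_independent:
  fixes p :: "'i \<Rightarrow> 'k::field poly"
  assumes "finite J" "inj_on (\<lambda>i. Polynomial.degree (p i)) J" "\<And>i. i \<in> J \<Longrightarrow> p i \<noteq> 0"
    and sum: "(\<Sum>i\<in>J. Polynomial.smult (c i) (p i)) = 0" and "i \<in> J"
  shows "c i = 0"
proof (rule ccontr)
  assume "c i \<noteq> 0"
  let ?J = "{i \<in> J. c i \<noteq> 0}"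
  let ?d = "\<lambda>i. Polynomial.degree (p i)"
  have fin: "finite (?d ` ?J)" "?d ` ?J \<noteq> {}"
    using assms(1,5) \<open>c i \<noteq> 0\<close> by auto
  then have "Max (?d ` ?J) \<in> ?d ` ?J"
    by (rule Max_in)
  then obtain j where j: "j \<in> ?J" "?d j = Max (?d ` ?J)" by force
  have zero: "c k * Polynomial.coeff (p k) (?d j) = 0" if "k \<in> J" "k \<noteq> j" for k
  proof (cases "c k = 0")
    case False
    then have "?d k \<le> ?d j"
      using fin that j(2) by simp
    moreover have "?d k \<noteq> ?d j"
      using inj_onD[OF assms(2), of k j] that j(1) by auto
    ultimately show ?thesis by (simp add: coeff_eq_0)
  qed simp
  have "0 = (\<Sum>k\<in>J. c k * Polynomial.coeff (p k) (?d j))"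
    using arg_cong[OF sum, of "\<lambda>p. Polynomial.coeff p (?d j)"] by (simp add: Polynomial.coeff_sum)
  also have "\<dots> = (\<Sum>k\<in>{j}. c k * Polynomial.coeff (p k) (?d j))"
    using assms(1) j(1) zero by (intro sum.mono_neutral_right) auto
  finally show False
    using j(1) assms(3)[of j] by simp
qed

lemma exponential_beats_polynomial: "\<exists>n. (2 * n * s + 1) ^ N < (2::nat) ^ n"
proof -
  define a where "a = 2 * s + 1"
  \<comment> \<open>The number \<open>n\<close> is a power of 2 so that powers of 2 can be compared
    by their exponents, and \<open>j\<close> is chosen to give (2 j + a) N <= j^2, which is less
    than \<open>n\<close>.\<close>
  define j where "j = (a + 2) * N"
  define n where "n = (2::nat) ^ (2 * j)"
  have "a < 2 ^ a" by (rule less_exp)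
  have "2 * n * s + 1 \<le> n * a"
    by (simp add: a_def n_def algebra_simps)
  also have "\<dots> \<le> n * 2 ^ a"
    using \<open>a < 2 ^ a\<close> by simp
  also have "\<dots> = 2 ^ (2 * j + a)"
    by (simp add: n_def power_add)
  finally have "(2 * n * s + 1) ^ N \<le> (2 ^ (2 * j + a)) ^ N"
    by (rule power_mono) simp
  also have "\<dots> = 2 ^ ((2 * j + a) * N)"
    by (simp add: power_mult)
  also have "\<dots> < 2 ^ n"
  proof (rule power_strict_increasing)
    have "(2 * j + a) * N \<le> j * j"
    proof (cases "N = 0")
      case False
      then have "1 \<le> j" by (simp add: j_def)
      then have "2 * j + a \<le> (a + 2) * j"
        by (simp add: algebra_simps)
      then have "(2 * j + a) * N \<le> (a + 2) * j * N"
        by simp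
      also have "\<dots> = j * j" by (simp only: j_def ac_simps)
      finally show ?thesis .
    qed simp
    also have "j * j < 2 ^ j * 2 ^ j"
      by (intro mult_strict_mono) (auto intro: less_exp)
    also have "\<dots> = n"
      by (simp add: n_def power_add[symmetric] mult_2)
    finally show "(2 * j + a) * N < n" .
  qed simp
  finally show ?thesis by blast
qed

text \<open>Interface between the operators and the classification: the relations, the normal
  monomial basis of \<open>S\<close>, and a linear \<open>\<pi>\<close> that is multiplicative
  modulo g when the left factor lies in \<open>S\<close>.\<close>

locale qgh_model = central_algebra sc
  for sc :: "'k::field \<Rightarrow> 'a::ring_1" +
  fixes x y t :: 'a and q :: 'k and f g :: "'k poly" and S :: "'a set" and \<pi> :: "'a \<Rightarrow> 'k poly"
  assumes tx: "t * x = x * peval f t"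
    and yt: "y * t = peval f t * y"
    and yx: "y * x = sc q * x * y + peval g t"
    and inj_nm: "inj (normal_monomial x y t)"
    and independent_nm: "vs.independent (range (normal_monomial x y t))"
    and S_eq: "S = vs.span (range (normal_monomial x y t))"
    and S_mult: "z \<in> S \<Longrightarrow> w \<in> S \<Longrightarrow> z * w \<in> S"
    and pi_add: "\<pi> (z + w) = \<pi> z + \<pi> w"
    and pi_scale: "\<pi> (sc c * z) = Polynomial.smult c (\<pi> z)"
    and pi_one: "\<pi> 1 = 1"
    and pi_mult: "z \<in> S \<Longrightarrow> g dvd \<pi> (z * w) - \<pi> z * \<pi> w"
    and pi_x: "\<pi> x = 0" and pi_y: "g dvd \<pi> y" and pi_t: "\<pi> t = [:0, 1:]"
begin

abbreviation nm :: "nat \<times> nat \<times> nat \<Rightarrow> 'a" where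
  "nm \<equiv> normal_monomial x y t"

lemma nm_eq: "nm (i, j, l) = x ^ i * (t ^ j * y ^ l)"
  by (simp add: normal_monomial_def)

lemma nm_in_S: "nm a \<in> S"
  unfolding S_eq by (rule vs.span_base) simp

lemma x_in_S: "x \<in> S" and y_in_S: "y \<in> S" and t_in_S: "t \<in> S" and one_in_S: "1 \<in> S"
  using nm_in_S[of "(1, 0, 0)"] nm_in_S[of "(0, 0, 1)"] nm_in_S[of "(0, 1, 0)"] nm_in_S[of "(0, 0, 0)"]
  by (simp_all add: nm_eq)

lemma S_add: "z \<in> S \<Longrightarrow> w \<in> S \<Longrightarrow> z + w \<in> S"
  and S_diff: "z \<in> S \<Longrightarrow> w \<in> S \<Longrightarrow> z - w \<in> S"
  and S_scale: "z \<in> S \<Longrightarrow> sc c * z \<in> S"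
  and S_zero: "0 \<in> S"
  unfolding S_eq by (auto intro: vs.span_add vs.span_diff vs.span_scale vs.span_zero)

lemma sc_in_S: "sc c \<in> S"
  using S_scale[OF one_in_S, of c] by simp

lemma peval_in_S: "z \<in> S \<Longrightarrow> peval p z \<in> S"
  by (induct p) (auto intro: S_zero S_add S_mult sc_in_S)

lemma x_peval_zero: "x ^ i * peval p t = 0 \<Longrightarrow> p = 0"
proof -
  assume zero: "x ^ i * peval p t = 0"
  let ?J = "(\<lambda>j. (i, j, 0)) ` {..Polynomial.degree p}"
  have "(\<Sum>a\<in>?J. sc (Polynomial.coeff p (fst (snd a))) * nm a) = x ^ i * peval p t"
    by (subst sum.reindex) (auto simp: inj_on_def peval_altdef nm_eq sum_distrib_left sc_left_commute[of "x ^ i"])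
  then have sum: "(\<Sum>a\<in>?J. sc (Polynomial.coeff p (fst (snd a))) * nm a) = 0"
    using zero by simp
  have fin: "finite ?J" by simp
  have "Polynomial.coeff p (fst (snd (i, Polynomial.degree p, 0 :: nat))) = 0"
    by (rule independent_family_iff[THEN iffD1, OF conjI[OF inj_nm independent_nm], rule_format, OF fin _ sum])
      auto
  then have "Polynomial.coeff p (Polynomial.degree p) = 0" by simp
  then show "p = 0" by simp
qed

lemma t_nonscalar: "t - sc c \<noteq> 0"
  using x_peval_zero[of 0 "[:- c, 1:]"] by (auto simp: sc_minus)

lemma x_nonzero: "x \<noteq> 0"
  using x_peval_zero[of 1 1] by auto

lemma y_nonzero: "y \<noteq> 0"
proof -
  have "nm (0, 0, 1) \<noteq> 0"
    using vs.dependent_zero[of "range nm"] independent_nm by (metis rangeI)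
  then show ?thesis by (simp add: nm_eq)
qed

lemma xy_plus_peval_nonzero: "x * y + peval p t \<noteq> 0"
proof
  assume "x * y + peval p t = 0"
  then have "nm (1, 0, 1) = - peval p t"
    by (simp add: nm_eq eq_neg_iff_add_eq_0)
  also have "- peval p t = (\<Sum>j\<le>Polynomial.degree p. sc (- Polynomial.coeff p j) * nm (0, j, 0))"
    by (simp add: peval_altdef nm_eq sc_minus sum_negf)
  also have "\<dots> \<in> vs.span (range nm - {nm (1, 0, 1)})"
    using inj_nm by (intro vs.span_sum vs.span_scale vs.span_base) (auto simp: inj_eq)
  finally show False
    using independent_nm unfolding vs.dependent_def by blast
qed

lemma peval_x: "peval p t * x = x * peval p (peval f t)"
  by (rule peval_intertwine[OF tx])

lemma y_peval: "y * peval p t = peval p (peval f t) * y"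
proof (induct p)
  case (pCons c p)
  have "y * peval (pCons c p) t = sc c * y + (y * t) * peval p t"
    by (simp add: distrib_left sc_central mult.assoc)
  also have "\<dots> = sc c * y + peval f t * (y * peval p t)"
    by (simp add: yt mult.assoc)
  finally show ?case
    using pCons by (simp add: distrib_right mult.assoc)
qed simp

end

locale qgh_PBW = qgh_model sc x y t q f g S \<pi> + U: quantum_space sc us "\<lambda>_. 1" "UNIV - {0}"
  for sc :: "'k::field \<Rightarrow> 'a::ring_1" and x y t q f g S \<pi> us +
  assumes U_S: "U.S = S"
    and U_rel: "i < length us \<Longrightarrow> j < length us \<Longrightarrow> skew_commute us i j"
begin

interpretation O: ordered_quantum_space sc us "\<lambda>_. 1" "UNIV - {0}" "U.key id"
  by (rule U.ordered_by_key) auto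

lemma mult_nonzero: "z \<in> S \<Longrightarrow> z \<noteq> 0 \<Longrightarrow> w \<in> S \<Longrightarrow> w \<noteq> 0 \<Longrightarrow> z * w \<noteq> 0"
  using O.mult_nonzero by (simp add: U_S)

lemma peval_nonzero: "z \<in> S \<Longrightarrow> z \<notin> range sc \<Longrightarrow> p \<noteq> 0 \<Longrightarrow> peval p z \<noteq> 0"
  using O.peval_nonzero by (simp add: U_S)

text \<open>A constant f = c would give (t - c) x = 0 with both factors nonzero.\<close>

lemma degree_f_pos: "0 < Polynomial.degree f"
proof (rule ccontr)
  assume "\<not> 0 < Polynomial.degree f"
  then obtain c where f: "f = [:c:]"
    by (metis degree_eq_zeroE gr0I)
  have "(t - sc c) * x = 0"
    using tx by (simp add: f left_diff_distrib sc_central)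
  moreover have "t - sc c \<in> S"
    by (intro S_diff t_in_S sc_in_S)
  ultimately show False
    using mult_nonzero t_nonscalar x_in_S x_nonzero by blast
qed

lemma low_bound: "z \<in> S \<Longrightarrow> w \<in> S \<Longrightarrow>
    \<exists>s. z \<in> low us (\<lambda>_. 1) (Suc s) \<and> w \<in> low us (\<lambda>_. 1) (Suc s)"
proof -
  assume "z \<in> S" "w \<in> S"
  then obtain m m' where "z \<in> low us (\<lambda>_. 1) m" "w \<in> low us (\<lambda>_. 1) m'"
    using U.S_low U_S by blast
  then show ?thesis
    using low_mono[of m "Suc (max m m')"] low_mono[of m' "Suc (max m m')"] by (meson in_mono le_SucI max.cobounded1 max.cobounded2)
qed

lemma degree_f_less_2: "Polynomial.degree f < 2"
proof (rule ccontr)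
  assume "\<not> Polynomial.degree f < 2"
  then have f: "2 \<le> Polynomial.degree f" by simp
  \<comment> \<open>Products of factors x and t x in normal form. There are 2^n of them of length n,
    independent because their polynomials have pairwise different degrees.\<close>
  define e where "e bs = x ^ length bs * peval (growth_poly f bs) t" for bs
  have e_Cons: "e (b # bs) = e bs * ((if b then t else 1) * x)" for b bs
  proof -
    have "e bs * ((if b then t else 1) * x)
        = x ^ length bs * (peval (growth_poly f bs * (if b then [:0, 1:] else 1)) t * x)"
      by (auto simp: e_def peval_mult mult.assoc)
    also have "\<dots> = x ^ length bs * (x * peval (growth_poly f (b # bs)) t)"
      by (simp add: peval_x peval_pcompose)
    finally show ?thesis
      by (simp add: e_def power_Suc2 mult.assoc del: power_Suc)
  qed
  obtain s where s: "x \<in> low us (\<lambda>_. 1) (Suc s)" "t \<in> low us (\<lambda>_. 1) (Suc s)"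
    using low_bound[OF x_in_S t_in_S] by blast
  have one: "1 \<in> low us (\<lambda>_. 1) (Suc s)"
    using word_in_low[of "[]" us "\<lambda>_. 1" "Suc s"] by simp
  have e_low: "e bs \<in> low us (\<lambda>_. 1) (Suc (2 * length bs * s))" for bs
  proof (induct bs)
    case Nil
    show ?case
      using word_in_low[of "[]" us "\<lambda>_. 1" 1] by (simp add: e_def)
  next
    case (Cons b bs)
    have "(if b then t else 1) * x \<in> low us (\<lambda>_. 1) (Suc (s + s))"
      using s one by (intro low_mult) auto
    from low_mult[OF Cons this] show ?case
      by (simp add: e_Cons algebra_simps)
  qed
  have ind: "inj_on e {bs. length bs = n} \<and> vs.independent (e ` {bs. length bs = n})" for n
    unfolding independent_family_iff
  proof (intro allI impI ballI)
    fix J c bs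
    assume J: "finite J" "J \<subseteq> {bs. length bs = n}" "(\<Sum>bs\<in>J. sc (c bs) * e bs) = 0" "bs \<in> J"
    have "(\<Sum>bs\<in>J. sc (c bs) * e bs) = x ^ n * peval (\<Sum>bs\<in>J. Polynomial.smult (c bs) (growth_poly f bs)) t"
      using J(2) by (auto simp: e_def peval_sum peval_smult sum_distrib_left sc_left_commute[of "x ^ n"] intro!: sum.cong)
    then have "(\<Sum>bs\<in>J. Polynomial.smult (c bs) (growth_poly f bs)) = 0"
      using J(3) x_peval_zero by simp
    moreover have "inj_on (\<lambda>bs. Polynomial.degree (growth_poly f bs)) J"
      using J(2) by (intro inj_onI growth_poly_inj[OF f]) auto
    ultimately show "c bs = 0"
      using distinct_degrees_independent[OF J(1)] growth_poly_nonzero[OF degree_f_pos] J(4) by blast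
  qed
  \<comment> \<open>Each factor has degree at most 2 s in the generators u, so a product of n
    factors has degree at most 2 n s, where the growth bound applies.\<close>
  have "2 ^ n \<le> (2 * n * s + 1) ^ length us" for n
  proof -
    have card: "card {bs :: bool list. length bs = n} = 2 ^ n"
      using card_lists_length_eq[of "UNIV :: bool set" n] by simp
    have fin: "finite {bs :: bool list. length bs = n}"
      using finite_lists_length_eq[of "UNIV :: bool set" n] by simp
    have "card (e ` {bs. length bs = n}) \<le> Suc (2 * n * s) ^ length us"
      using ind[of n] fin e_low by (intro U.card_independent_low) auto
    then show ?thesis
      using card_image[of e "{bs. length bs = n}"] ind[of n] card by simp
  qed
  then show False
    using exponential_beats_polynomial[of s "length us"] by (meson not_le)
qed

lemma degree_f: "Polynomial.degree f = 1"
  using degree_f_pos degree_f_less_2 by simp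

lemma f_linear: obtains a b where "f = [:b, a:]" "a \<noteq> 0"
proof -
  have "f = [:Polynomial.coeff f 0, Polynomial.coeff f 1:]"
    using degree_f by (intro poly_eqI) (auto simp: coeff_pCons coeff_eq_0 split: nat.split)
  moreover have "Polynomial.coeff f 1 \<noteq> 0"
    using degree_f leading_coeff_0_iff[of f] by auto
  ultimately show ?thesis by (rule that)
qed

lemma q_nonzero: "q \<noteq> 0"
proof
  assume q: "q = 0"
  obtain a b where f: "f = [:b, a:]" "a \<noteq> 0" by (rule f_linear)
  \<comment> \<open>Composing g with the inverse of the affine map f gives Q with Q(f(t)) = g(t).
    For q = 0, multiplying x y - Q(t) by y on the left then yields zero.\<close>
  define Q where "Q = pcompose g [:- b / a, 1 / a:]"
  have "pcompose [:- b / a, 1 / a:] f = [:0, 1:]"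
    using f(2) by (simp add: f(1) pcompose_pCons)
  then have Q: "pcompose Q f = g"
    by (simp add: Q_def flip: pcompose_assoc)
  have "y * (x * y + peval (- Q) t) = (y * x) * y - y * peval Q t"
    by (simp add: right_diff_distrib peval_minus mult.assoc)
  also have "\<dots> = peval g t * y - peval (pcompose Q f) t * y"
    by (simp add: yx q y_peval peval_pcompose)
  finally have "y * (x * y + peval (- Q) t) = 0"
    by (simp add: Q)
  moreover have "x * y + peval (- Q) t \<in> S"
    by (intro S_add S_mult x_in_S y_in_S peval_in_S t_in_S)
  ultimately show False
    using mult_nonzero y_in_S y_nonzero xy_plus_peval_nonzero by blast
qed

end

section \<open>Reduction modulo g\<close>

interpretation pc: central_algebra "\<lambda>c :: 'k::field. [:c:]"
  by unfold_locales simp_all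

lemma pc_peval: "pc.peval p z = pcompose p z"
  by (induct p) (simp_all add: pcompose_pCons)

context qgh_model
begin

text \<open>Index 1 is t. The letters x and y are made heavy enough for g(t) to count as an error
  term in y x - q x y: its weight deg g is less than 2 max(1, deg g).\<close>

definition heis_weight :: "nat \<Rightarrow> nat" where
  "heis_weight i = (if i = 1 then 1 else max 1 (Polynomial.degree g))"

lemma monomial_xty: "length \<alpha> = 3 \<Longrightarrow> monomial [x, t, y] \<alpha> = nm (\<alpha> ! 0, \<alpha> ! 1, \<alpha> ! 2)"
  by (auto simp: numeral_3_eq_3 length_Suc_conv monomial_def nm_eq)

lemma range_monomial_xty: "monomial [x, t, y] ` exponents (length [x, t, y]) = range nm"
proof safe
  fix i j l
  have "nm (i, j, l) = monomial [x, t, y] [i, j, l]"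
    by (simp add: monomial_xty)
  then show "nm (i, j, l) \<in> monomial [x, t, y] ` exponents (length [x, t, y])"
    by (rule image_eqI) simp
qed (simp add: monomial_xty)

lemma inj_monomial_xty: "inj_on (monomial [x, t, y]) (exponents (length [x, t, y]))"
proof (rule inj_onI)
  fix \<alpha> \<beta> :: "nat list"
  assume "\<alpha> \<in> exponents (length [x, t, y])" "\<beta> \<in> exponents (length [x, t, y])"
    "monomial [x, t, y] \<alpha> = monomial [x, t, y] \<beta>"
  then show "\<alpha> = \<beta>"
    using injD[OF inj_nm, of "(\<alpha> ! 0, \<alpha> ! 1, \<alpha> ! 2)" "(\<beta> ! 0, \<beta> ! 1, \<beta> ! 2)"]
    by (simp add: monomial_xty) (auto simp: numeral_3_eq_3 length_Suc_conv)
qed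

text \<open>Leaving \<open>D\<close> open allows two uses: all nonzero scalars when only growth
  matters, and 1 alone when a = q = 1.\<close>

lemma heis_quantum_space:
  assumes f: "f = [:b, a:]" and D: "1 \<in> D" "a \<in> D" "q \<in> D" "0 \<notin> D"
    "\<And>c c'. c \<in> D \<Longrightarrow> c' \<in> D \<Longrightarrow> c * c' \<in> D"
  shows "quantum_space sc [x, t, y] heis_weight D"
proof (intro quantum_space.intro quantum_space_axioms.intro)
  let ?low = "low [x, t, y] heis_weight"
  let ?k = "max 1 (Polynomial.degree g)"
  have x: "word [x, t, y] [0] = x" and y: "word [x, t, y] [2] = y"
    by (simp_all add: word_def)
  have t: "word [x, t, y] (replicate j 1) = t ^ j" for j
    by (simp add: word_replicate)
  have wt: "word_weight heis_weight (replicate j 1) = j" for j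
    by (induct j) (simp_all add: heis_weight_def)
  have pf: "peval f t = sc b + sc a * t"
    by (simp add: f sc_central[of a t])
  have scale: "z \<in> ?low m \<Longrightarrow> sc c * z \<in> ?low m" for z c m
    unfolding low_def by (rule vs.span_scale)
  have xl: "x \<in> ?low (Suc ?k)" and yl: "y \<in> ?low (Suc ?k)"
    using word_in_low[of "[0]" "[x, t, y]" heis_weight "Suc ?k"] word_in_low[of "[2]" "[x, t, y]" heis_weight "Suc ?k"]
    by (simp_all add: x y heis_weight_def)
  show "\<exists>c\<in>D. [x, t, y] ! j * [x, t, y] ! i - sc c * ([x, t, y] ! i * [x, t, y] ! j)
      \<in> ?low (heis_weight i + heis_weight j)" if ij: "i < j" "j < length [x, t, y]" for i j
  proof -
    consider "i = 0" "j = 1" | "i = 0" "j = 2" | "i = 1" "j = 2"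
      using ij by (fastforce simp: less_Suc_eq numeral_2_eq_2)
    then show ?thesis
    proof cases
      case 1
      have "t * x - sc a * (x * t) = sc b * x"
        by (simp add: tx pf distrib_left sc_left_commute[of x] flip: sc_central[of b x])
      then show ?thesis
        using 1 D(2) scale[OF xl] by (intro bexI[of _ a]) (simp_all add: heis_weight_def)
    next
      case 2
      have "t ^ j' \<in> ?low (2 * ?k)" if "j' \<le> Polynomial.degree g" for j'
      proof -
        have "set (replicate j' (1::nat)) \<subseteq> {..<length [x, t, y]}" by auto
        moreover have "word_weight heis_weight (replicate j' 1) < 2 * ?k"
          unfolding wt using that by linarith
        ultimately show ?thesis
          using word_in_low[of "replicate j' 1" "[x, t, y]" heis_weight "2 * ?k"] by (simp only: t)
      qed
      then have "peval g t \<in> ?low (2 * ?k)"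
        unfolding peval_altdef low_def by (intro vs.span_sum vs.span_scale) auto
      moreover have "y * x - sc q * (x * y) = peval g t"
        by (simp add: yx mult.assoc)
      ultimately show ?thesis
        using 2 D(3) by (intro bexI[of _ q]) (simp_all add: heis_weight_def mult_2)
    next
      case 3
      have "y * t - sc a * (t * y) = sc b * y"
        by (simp add: yt pf distrib_right mult.assoc)
      then show ?thesis
        using 3 D(2) scale[OF yl] by (intro bexI[of _ a]) (simp_all add: heis_weight_def)
    qed
  qed
  show "inj_on (monomial [x, t, y]) (exponents (length [x, t, y]))"
    by (rule inj_monomial_xty)
  show "vs.independent (monomial [x, t, y] ` exponents (length [x, t, y]))"
    unfolding range_monomial_xty by (rule independent_nm)
qed (use D in \<open>auto simp: heis_weight_def central_algebra_axioms\<close>)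

lemma pi_zero: "\<pi> 0 = 0"
  using pi_scale[of 0 0] by simp

lemma pi_sc: "\<pi> (sc c) = [:c:]"
  using pi_scale[of c 1] by (simp add: pi_one)

lemma pi_sum: "\<pi> (\<Sum>i\<in>I. h i) = (\<Sum>i\<in>I. \<pi> (h i))"
  by (induct I rule: infinite_finite_induct) (simp_all add: pi_zero pi_add)

lemma pi_mult_mod: "z \<in> S \<Longrightarrow> \<pi> (z * w) mod g = (\<pi> z * \<pi> w) mod g"
  using pi_mult by (simp add: mod_eq_dvd_iff)

text \<open>A homomorphism to \<open>K[s]\<close> lifting \<open>\<pi>\<close> sends \<open>t\<close> to a nonconstant polynomial,
  at which \<open>g\<close> does not vanish.\<close>

lemma no_lift:
  assumes "algebra_hom sc (\<lambda>c. [:c:]) S h" and lift: "\<And>z. z \<in> S \<Longrightarrow> h z mod g = \<pi> z mod g"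
    and g: "2 \<le> Polynomial.degree g" and zero: "h (peval g t) = 0"
  shows False
proof -
  interpret h: algebra_hom sc "\<lambda>c. [:c:]" S h by (rule assms(1))
  have "pcompose g (h t) = 0"
    using zero h.h_peval[OF t_in_S, of g] by (simp add: pc_peval)
  then have "Polynomial.degree (h t) = 0"
    using g pcompose_eq_0_iff[of "h t" g] by (cases "Polynomial.degree (h t) = 0") auto
  then obtain c where "h t = [:c:]" by (rule degree_eq_zeroE)
  then have "[:c:] mod g = [:0, 1:] mod g"
    using lift[OF t_in_S] by (simp add: pi_t)
  then have "g dvd [:c:] - [:0, 1:]"
    by (simp only: mod_eq_dvd_iff)
  then have "Polynomial.degree g \<le> Polynomial.degree ([:c:] - [:0, 1:] :: 'k poly)"
    by (rule dvd_imp_degree_le) simp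
  then show False using g by simp
qed

end

context qgh_PBW
begin

lemma us_in_S: "i < length us \<Longrightarrow> us ! i \<in> S"
  using U.us_in_S U_S by simp

lemma word_in_S: "set w \<subseteq> {..<length us} \<Longrightarrow> word us w \<in> S"
  using U.word_in_S U_S by simp

lemma S_span: "S = vs.span (monomial us ` exponents (length us))"
  using U_S by (simp add: U.S_def)

lemma hom_eqI:
  assumes h: "algebra_hom sc sc' S h" and k: "algebra_hom sc sc' S k"
    and eq: "\<And>i. i < length us \<Longrightarrow> h (us ! i) = k (us ! i)" and z: "z \<in> S"
  shows "h z = k z"
proof -
  interpret h: algebra_hom sc sc' S h by (rule h)
  interpret k: algebra_hom sc sc' S k by (rule k)
  have word: "set w \<subseteq> {..<length us} \<Longrightarrow> h (word us w) = k (word us w)" for w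
    by (induct w) (simp_all add: h.h_one k.h_one word_Cons h.h_mult k.h_mult us_in_S word_in_S eq)
  have "z \<in> S \<and> h z = k z"
    using z unfolding S_span
  proof (induct rule: vs.span_induct_alt)
    case base
    show ?case using h.h_sc[of 0] k.h_sc[of 0] by (simp add: vs.span_zero)
  next
    case (step c b z)
    then obtain \<alpha> where "length \<alpha> = length us" "b = word us (expand 0 \<alpha>)"
      by (auto simp: monomial_eq_word)
    then have b: "b \<in> S" "h b = k b"
      using word[of "expand 0 \<alpha>"] word_in_S[of "expand 0 \<alpha>"] set_expand[of 0 \<alpha>]
      by (auto simp: atLeast0LessThan)
    then have "h (sc c * b + z) = k (sc c * b + z)"
      using step(2) unfolding S_span[symmetric]
      by (simp add: h.h_add k.h_add h.h_mult k.h_mult h.h_sc k.h_sc S_scale sc_in_S)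
    moreover have "sc c * b + z \<in> S"
      using step(2) b unfolding S_span[symmetric] by (simp add: S_add S_scale)
    ultimately show ?case unfolding S_span[symmetric] by simp
  qed
  then show ?thesis by simp
qed

lemma hom_lifts_pi:
  assumes h: "algebra_hom sc (\<lambda>c. [:c:]) S h"
    and eq: "\<And>i. i < length us \<Longrightarrow> h (us ! i) mod g = \<pi> (us ! i) mod g" and z: "z \<in> S"
  shows "h z mod g = \<pi> z mod g"
proof -
  interpret h: algebra_hom sc "\<lambda>c. [:c:]" S h by (rule h)
  have word: "set w \<subseteq> {..<length us} \<Longrightarrow> h (word us w) mod g = \<pi> (word us w) mod g" for w
  proof (induct w)
    case (Cons i w)
    then show ?case
      using mod_mult_cong[OF eq[of i], of "h (word us w)" "\<pi> (word us w)"]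
      by (simp add: word_Cons h.h_mult us_in_S word_in_S pi_mult_mod)
  qed (simp add: h.h_one pi_one)
  have "z \<in> S \<and> h z mod g = \<pi> z mod g"
    using z unfolding S_span
  proof (induct rule: vs.span_induct_alt)
    case base
    show ?case using h.h_sc[of 0] by (simp add: pi_zero vs.span_zero)
  next
    case (step c b z)
    then obtain \<alpha> where "length \<alpha> = length us" "b = word us (expand 0 \<alpha>)"
      by (auto simp: monomial_eq_word)
    then have b: "b \<in> S" "h b mod g = \<pi> b mod g"
      using word[of "expand 0 \<alpha>"] word_in_S[of "expand 0 \<alpha>"] set_expand[of 0 \<alpha>]
      by (auto simp: atLeast0LessThan)
    then have "h (sc c * b + z) mod g = \<pi> (sc c * b + z) mod g"
      using step(2) unfolding S_span[symmetric]
      by (simp add: h.h_add h.h_mult h.h_sc S_scale sc_in_S pi_add pi_scale poly_mod_add_left mod_smult_left)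
    moreover have "sc c * b + z \<in> S"
      using step(2) b unfolding S_span[symmetric] by (simp add: S_add S_scale)
    ultimately show ?case unfolding S_span[symmetric] by simp
  qed
  then show ?thesis by simp
qed

lemma form_mod:
  assumes "0 < Polynomial.degree g"
  shows "[:l0:] + (\<Sum>k<length us. [:l k:] * (\<pi> (us ! k) mod g))
    = \<pi> (sc l0 + (\<Sum>k<length us. sc (l k) * us ! k)) mod g"
proof -
  have "(\<Sum>k\<in>I. Polynomial.smult (l k) (\<pi> (us ! k))) mod g = (\<Sum>k\<in>I. Polynomial.smult (l k) (\<pi> (us ! k) mod g))"
    for I :: "nat set"
    by (induct I rule: infinite_finite_induct) (simp_all add: poly_mod_add_left mod_smult_left)
  then show ?thesis
    using assms by (simp add: pi_add pi_sum pi_scale pi_sc poly_mod_add_left mod_poly_less)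
qed

text \<open>Applying \<open>\<pi>\<close> turns a relation into a congruence modulo g. The affine
  part has degree below deg g on remainders, and the last hypothesis says the same of the quadratic
  part, so the congruence is an equality.\<close>

lemma relation_mod:
  assumes g: "0 < Polynomial.degree g" and ij: "i < length us" "j < length us"
    and rel: "us ! j * us ! i = sc d * (us ! i * us ! j) + (sc l0 + (\<Sum>k<length us. sc (l k) * us ! k))"
    and deg: "Polynomial.degree ((\<pi> (us ! j) mod g) * (\<pi> (us ! i) mod g)
      - [:d:] * ((\<pi> (us ! i) mod g) * (\<pi> (us ! j) mod g))) < Polynomial.degree g"
  shows "(\<pi> (us ! j) mod g) * (\<pi> (us ! i) mod g) = [:d:] * ((\<pi> (us ! i) mod g) * (\<pi> (us ! j) mod g))
    + ([:l0:] + (\<Sum>k<length us. [:l k:] * (\<pi> (us ! k) mod g)))"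
proof -
  let ?P = "\<lambda>i. \<pi> (us ! i) mod g"
  let ?form = "sc l0 + (\<Sum>k<length us. sc (l k) * us ! k)"
  have "?P j * ?P i - [:d:] * (?P i * ?P j) = (?P j * ?P i - [:d:] * (?P i * ?P j)) mod g"
    using deg by (simp add: mod_poly_less)
  also have "\<dots> = (\<pi> (us ! j) * \<pi> (us ! i) - [:d:] * (\<pi> (us ! i) * \<pi> (us ! j))) mod g"
    by (intro mod_diff_cong mod_mult_cong) simp_all
  also have "\<dots> = (\<pi> (us ! j * us ! i) - [:d:] * \<pi> (us ! i * us ! j)) mod g"
    using ij by (intro mod_diff_cong mod_mult_cong) (simp_all add: pi_mult_mod us_in_S)
  also have "\<pi> (us ! j * us ! i) - [:d:] * \<pi> (us ! i * us ! j) = \<pi> ?form"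
    by (simp add: rel pi_add pi_scale)
  also have "\<pi> ?form mod g = [:l0:] + (\<Sum>k<length us. [:l k:] * ?P k)"
    by (rule form_mod[OF g, symmetric])
  finally show ?thesis by (simp only: diff_eq_eq add.commute)
qed

lemma length_us_le_3: "length us \<le> 3"
proof (rule ccontr)
  assume "\<not> length us \<le> 3"
  then have n: "4 \<le> length us" by simp
  obtain a b where f: "f = [:b, a:]" "a \<noteq> 0" by (rule f_linear)
  interpret H: quantum_space sc "[x, t, y]" heis_weight "UNIV - {0}"
    by (rule heis_quantum_space[OF f(1)]) (use f(2) q_nonzero in auto)
  have H_S: "H.S = S"
    unfolding H.S_def range_monomial_xty S_eq ..
  let ?low = "low [x, t, y] heis_weight"
  have "\<exists>s. \<forall>i<m. us ! i \<in> ?low (Suc s)" if "m \<le> length us" for m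
    using that
  proof (induct m)
    case (Suc m)
    then obtain s where s: "\<forall>i<m. us ! i \<in> ?low (Suc s)" by auto
    obtain s' where s': "us ! m \<in> ?low s'"
      using H.S_low[of "us ! m"] us_in_S[of m] Suc(2) H_S by auto
    have "\<forall>i<Suc m. us ! i \<in> ?low (Suc (max s s'))"
      using s s' low_mono[of "Suc s" "Suc (max s s')" "[x, t, y]" heis_weight]
        low_mono[OF le_SucI[OF max.cobounded2[of s' s]], of "[x, t, y]" heis_weight] by (auto simp: less_Suc_eq)
    then show ?case by blast
  qed simp
  then obtain s where s: "\<forall>i<length us. us ! i \<in> ?low (Suc s)" by blast
  have word: "set w \<subseteq> {..<length us} \<Longrightarrow> word us w \<in> ?low (Suc (length w * s))" for w
  proof (induct w)
    case Nil
    show ?case using word_in_low[of "[]" "[x, t, y]" heis_weight 1] by simp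
  next
    case (Cons i w)
    then show ?case
      using low_mult[of "us ! i" _ _ s "word us w" "length w * s"] s by (simp add: word_Cons)
  qed
  define c where "c = length us * s + 1"
  \<comment> \<open>With this \<open>m\<close> the cubic bound (m c)^3 = m^3 c^3 falls below m^4,
    while four or more generators would give at least m^4 independent monomials.\<close>
  define m where "m = c ^ 3 + 1"
  have length_expand: "length (expand k \<alpha>) = sum_list \<alpha>" for k \<alpha>
    by (induct k \<alpha> rule: expand.induct) simp_all
  let ?E = "{\<alpha>. set \<alpha> \<subseteq> {..<m} \<and> length \<alpha> = length us}"
  have "monomial us \<alpha> \<in> ?low (Suc (length us * m * s))" if \<alpha>: "\<alpha> \<in> ?E" for \<alpha>
  proof -
    have "sum_list \<alpha> \<le> length \<alpha> * m"
      using \<alpha> by (intro order_trans[OF sum_list_mono[of \<alpha> id "\<lambda>_. m", simplified]])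
        (auto simp: sum_list_triv intro: less_imp_le)
    then have "Suc (sum_list \<alpha> * s) \<le> Suc (length us * m * s)"
      using \<alpha> by simp
    moreover have "monomial us \<alpha> \<in> ?low (Suc (sum_list \<alpha> * s))"
      using word[of "expand 0 \<alpha>"] set_expand[of 0 \<alpha>] \<alpha>
      by (simp add: monomial_eq_word length_expand atLeast0LessThan)
    ultimately show ?thesis using low_mono by blast
  qed
  then have "card (monomial us ` ?E) \<le> Suc (length us * m * s) ^ length [x, t, y]"
    using U.card_monomials[of m] by (intro H.card_independent_low) auto
  then have "m ^ length us \<le> Suc (length us * m * s) ^ 3"
    using U.card_monomials[of m] by (simp add: numeral_3_eq_3)
  also have "\<dots> \<le> (m * c) ^ 3"
    by (rule power_mono) (simp_all add: m_def c_def algebra_simps)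
  also have "\<dots> = m ^ 3 * c ^ 3"
    by (rule power_mult_distrib)
  also have "\<dots> < m ^ 3 * m"
    by (rule mult_strict_left_mono) (simp_all add: m_def)
  also have "\<dots> = m ^ 4"
    by (simp add: eval_nat_numeral)
  also have "\<dots> \<le> m ^ length us"
    using n by (intro power_increasing) (simp_all add: m_def)
  finally show False by simp
qed

end

section \<open>Normal elements\<close>

text \<open>Leading exponents add in a commutative group even if the factors do not commute, so the
  contribution of \<open>w\<close> cancels.\<close>

lemma (in ordered_quantum_space) lead_intertwine:
  assumes z: "z \<in> S" "lead z \<alpha>" and z': "z' \<in> S" and w: "w \<in> S" "w \<noteq> 0" and eq: "w * z = z' * w"
  shows "lead z' \<alpha>"
proof -
  obtain \<tau> where \<tau>: "lead w \<tau>" by (rule lead_exists[OF w])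
  have wz: "lead (w * z) (map2 (+) \<tau> \<alpha>)"
    by (rule lead_mult(1)[OF w(1) \<tau> z])
  have "z' \<noteq> 0"
    using lead_nonzero[OF wz] eq by auto
  then obtain \<beta> where \<beta>: "lead z' \<beta>" by (rule lead_exists[OF z'])
  have "map2 (+) \<tau> \<alpha> = map2 (+) \<beta> \<tau>"
    using lead_unique[OF wz] lead_mult(1)[OF z' \<beta> w(1) \<tau>] eq by simp
  then have "key (map2 (+) \<tau> \<alpha>) = key (map2 (+) \<beta> \<tau>)" by simp
  then have "key \<alpha> = key \<beta>"
    using lead_Ex[OF z(2)] lead_Ex[OF \<tau>] lead_Ex[OF \<beta>] by (simp add: key_add add.commute)
  then have "\<alpha> = \<beta>"
    by (rule inj_onD[OF inj_key _ lead_Ex[OF z(2)] lead_Ex[OF \<beta>]])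
  then show ?thesis using \<beta> by simp
qed

lemma (in qgh_model) S_algebra_induct [consumes 1, case_names sc add mult x y t]:
  assumes "z \<in> S" and sc: "\<And>c. P (sc c)"
    and add: "\<And>z w. z \<in> S \<Longrightarrow> w \<in> S \<Longrightarrow> P z \<Longrightarrow> P w \<Longrightarrow> P (z + w)"
    and mult: "\<And>z w. z \<in> S \<Longrightarrow> w \<in> S \<Longrightarrow> P z \<Longrightarrow> P w \<Longrightarrow> P (z * w)"
    and gens: "P x" "P y" "P t"
  shows "P z"
proof -
  have pow: "z \<in> S \<and> P z \<Longrightarrow> z ^ k \<in> S \<and> P (z ^ k)" for z k
    using sc[of 1] by (induct k) (auto intro: one_in_S S_mult mult)
  have nm: "P (nm (i, j, l))" for i j l
    using pow[of x i] pow[of y l] pow[of t j] gens x_in_S y_in_S t_in_S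
    unfolding nm_eq by (intro mult S_mult) auto
  have "z \<in> S \<and> P z"
    using assms(1) unfolding S_eq
  proof (induct rule: vs.span_induct_alt)
    case base
    show ?case using sc[of 0] by (simp add: vs.span_zero)
  next
    case (step c b z)
    then have b: "b \<in> S" "P b" using nm nm_in_S by auto
    have "sc c * b \<in> S" "P (sc c * b)"
      using b sc sc_in_S by (auto intro: S_mult mult)
    then show ?case
      using step(2) unfolding S_eq[symmetric] by (auto intro: S_add add)
  qed
  then show ?thesis by simp
qed

context qgh_PBW
begin

lemma us_nonscalar: "i < length us \<Longrightarrow> us ! i \<notin> range sc"
proof
  assume i: "i < length us" and "us ! i \<in> range sc"
  then obtain c where c: "us ! i = sc c" by blast
  have neq: "U.e1 i \<noteq> U.e0"
    using U.weight_e1[OF i] U.weight_e0 by (metis zero_neq_one)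
  have "U.co (us ! i) (U.e1 i) = 1"
    using U.co_mon[of "U.e1 i" "U.e1 i"] i by (simp add: U.mon_e1)
  moreover have "U.co (us ! i) (U.e1 i) = 0"
    using U.co_sc[of "U.e1 i" c] neq c by simp
  ultimately show False by simp
qed

lemma hom_maps_into:
  assumes h: "algebra_hom sc sc' S h" and sc: "\<And>c. P (sc' c)"
    and add: "\<And>z w. P z \<Longrightarrow> P w \<Longrightarrow> P (z + w)" and mult: "\<And>z w. P z \<Longrightarrow> P w \<Longrightarrow> P (z * w)"
    and us: "\<And>i. i < length us \<Longrightarrow> P (h (us ! i))" and z: "z \<in> S"
  shows "P (h z)"
proof -
  interpret h: algebra_hom sc sc' S h by (rule h)
  have word: "set w \<subseteq> {..<length us} \<Longrightarrow> P (h (word us w))" for w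
  proof (induct w)
    case Nil
    show ?case using sc[of 1] by (simp add: h.h_one)
  next
    case (Cons i w)
    then show ?case
      using mult us by (simp add: word_Cons h.h_mult us_in_S word_in_S)
  qed
  have "z \<in> S \<and> P (h z)"
    using z unfolding S_span
  proof (induct rule: vs.span_induct_alt)
    case base
    show ?case using h.h_sc[of 0] sc[of 0] by (simp add: vs.span_zero)
  next
    case (step c b z)
    then obtain \<alpha> where "length \<alpha> = length us" "b = word us (expand 0 \<alpha>)"
      by (auto simp: monomial_eq_word)
    then have b: "b \<in> S" "P (h b)"
      using word[of "expand 0 \<alpha>"] word_in_S[of "expand 0 \<alpha>"] set_expand[of 0 \<alpha>]
      by (auto simp: atLeast0LessThan)
    have z: "z \<in> S" "P (h z)"
      using step(2) unfolding S_span[symmetric] by auto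
    have "h (sc c * b + z) = sc' c * h b + h z"
      using b z by (simp add: h.h_add h.h_mult h.h_sc S_scale sc_in_S)
    then have "P (h (sc c * b + z))"
      using add mult sc b z by simp
    moreover have "sc c * b + z \<in> S"
      using z b by (simp add: S_add S_scale)
    ultimately show ?case unfolding S_span[symmetric] by simp
  qed
  then show ?thesis by simp
qed

lemma relation_coefficients:
  obtains d l0 l where "\<And>i j. i < length us \<Longrightarrow> j < length us \<Longrightarrow> d i j \<noteq> 0"
    "\<And>i j. i < length us \<Longrightarrow> j < length us \<Longrightarrow>
      us ! j * us ! i = sc (d i j) * (us ! i * us ! j) + (sc (l0 i j) + (\<Sum>k<length us. sc (l i j k) * us ! k))"
proof -
  define R where "R i j p \<longleftrightarrow> (case p of (d, l0, l) \<Rightarrow> d \<noteq> 0 \<and>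
    us ! j * us ! i = sc d * (us ! i * us ! j) + (sc l0 + (\<Sum>k<length us. sc (l k) * us ! k)))" for i j p
  define F where "F i j = (SOME p. R i j p)" for i j
  have F: "R i j (F i j)" if ij: "i < length us" "j < length us" for i j
  proof -
    obtain d l0 l where "R i j (d, l0, l)"
      using U_rel[OF ij] unfolding skew_commute_def R_def by auto
    then show ?thesis unfolding F_def by (rule someI)
  qed
  show ?thesis
  proof
    fix i j assume "i < length us" "j < length us"
    note F[OF this]
    then show "fst (F i j) \<noteq> 0"
      and "us ! j * us ! i = sc (fst (F i j)) * (us ! i * us ! j)
        + (sc (fst (snd (F i j))) + (\<Sum>k<length us. sc (snd (snd (F i j)) k) * us ! k))"
      by (auto simp: R_def split: prod.splits)
  qed
qed

end

text \<open>The relations say that conjugation by \<open>w\<close> multiplies x by c and y by the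
  inverse of c and fixes t. The scalar c will be the slope a of f for the translate of t, and q for
  x y + h(t).\<close>

locale qgh_normal = qgh_PBW sc x y t q f g S \<pi> us
  for sc :: "'k::field \<Rightarrow> 'a::ring_1" and x y t q f g S \<pi> us +
  fixes w :: 'a and c :: 'k
  assumes degree_g: "2 \<le> Polynomial.degree g"
    and w: "w \<in> S" "w \<noteq> 0" and c: "c \<noteq> 0" "c \<noteq> 1"
    and wx: "w * x = sc c * x * w" and yw: "y * w = sc c * w * y" and wt: "w * t = t * w"
begin

lemma wy: "w * y = sc (inverse c) * y * w"
proof -
  have "sc (inverse c) * y * w = sc (inverse c) * (sc c * (w * y))"
    by (simp add: yw mult.assoc)
  also have "\<dots> = (sc (inverse c) * sc c) * (w * y)"
    by (simp only: mult.assoc)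
  finally show ?thesis using c by (simp add: sc_inverse)
qed

text \<open>Conjugation by \<open>w\<close>, formulated without inverses: the image of z is what z
  becomes when \<open>w\<close> is moved across it. It is unique because the algebra is a
  domain.\<close>

definition \<phi> :: "'a \<Rightarrow> 'a" where
  "\<phi> z = (SOME z'. z' \<in> S \<and> w * z = z' * w)"

lemma \<phi>: assumes "z \<in> S" shows "\<phi> z \<in> S" "w * z = \<phi> z * w"
proof -
  have "\<exists>z'. z' \<in> S \<and> w * z = z' * w"
    using assms
  proof (induct rule: S_algebra_induct)
    case (sc c)
    show ?case using sc_central[of c w] sc_in_S by metis
  next
    case (add z v)
    then show ?case using S_add distrib_left distrib_right by metis
  next
    case (mult z v)
    then show ?case using S_mult mult.assoc by metis
  qed (use wx wy wt x_in_S y_in_S t_in_S S_scale in blast)+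
  then have "\<phi> z \<in> S \<and> w * z = \<phi> z * w"
    unfolding \<phi>_def by (rule someI_ex)
  then show "\<phi> z \<in> S" "w * z = \<phi> z * w" by simp_all
qed

lemma \<phi>_unique: "z \<in> S \<Longrightarrow> z' \<in> S \<Longrightarrow> w * z = z' * w \<Longrightarrow> \<phi> z = z'"
proof (rule ccontr)
  assume z: "z \<in> S" "z' \<in> S" "w * z = z' * w" and "\<phi> z \<noteq> z'"
  then have "(\<phi> z - z') * w \<noteq> 0"
    using \<phi>(1)[OF z(1)] w by (intro mult_nonzero S_diff) auto
  then show False
    using \<phi>(2)[OF z(1)] z(3) by (simp add: left_diff_distrib)
qed

lemma \<phi>_hom: "algebra_hom sc sc S \<phi>"
proof
  show "\<phi> (sc c) = sc c" for c
    by (rule \<phi>_unique) (simp_all add: sc_in_S sc_central)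
  show "\<phi> (z + v) = \<phi> z + \<phi> v" if "z \<in> S" "v \<in> S" for z v
    using that \<phi> by (intro \<phi>_unique) (simp_all add: S_add distrib_left distrib_right)
  show "\<phi> (z * v) = \<phi> z * \<phi> v" if "z \<in> S" "v \<in> S" for z v
  proof (rule \<phi>_unique)
    have "w * (z * v) = \<phi> z * (w * v)"
      using \<phi>(2)[OF that(1)] by (simp flip: mult.assoc)
    then show "w * (z * v) = \<phi> z * \<phi> v * w"
      using \<phi>(2)[OF that(2)] by (simp add: mult.assoc)
  qed (use that \<phi> S_mult in auto)
qed (auto intro: sc_in_S S_add S_mult)

interpretation \<phi>: algebra_hom sc sc S \<phi> by (rule \<phi>_hom)

lemma \<phi>_x: "\<phi> x = sc c * x" and \<phi>_y: "\<phi> y = sc (inverse c) * y" and \<phi>_t: "\<phi> t = t"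
  using wx wy wt x_in_S y_in_S t_in_S S_scale by (auto intro!: \<phi>_unique)

text \<open>Only x and y are rescaled, and \<open>\<pi>\<close> sends both to 0 modulo g.\<close>

lemma pi_\<phi>: "z \<in> S \<Longrightarrow> \<pi> (\<phi> z) mod g = \<pi> z mod g"
proof (induct rule: S_algebra_induct)
  case (add z v)
  then show ?case by (simp add: \<phi>.h_add pi_add poly_mod_add_left)
next
  case (mult z v)
  then show ?case
    using mod_mult_cong[of "\<pi> (\<phi> z)" g "\<pi> z" "\<pi> (\<phi> v)" "\<pi> v"]
    by (simp add: \<phi>.h_mult pi_mult_mod \<phi>(1))
next
  case y
  show ?case using pi_y by (simp add: \<phi>_y pi_scale mod_smult_left)
qed (simp_all add: \<phi>.h_sc \<phi>_x \<phi>_t pi_x pi_scale)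

text \<open>Conjugation preserves leading exponents for every monomial order. Applied to two
  opposite orders this leaves an affine expression in \<open>us ! i\<close> alone.\<close>

lemma \<phi>_us:
  assumes i: "i < length us"
  obtains e s where "e \<noteq> 0" "\<phi> (us ! i) = sc e * us ! i + sc s"
proof -
  have ord: "ordered_quantum_space.lead sc us (U.key \<sigma>) (\<phi> (us ! i)) (U.e1 i)"
    if \<sigma>: "inj_on \<sigma> {..<length us}" "\<sigma> ` {..<length us} \<subseteq> {..<length us}" for \<sigma>
  proof -
    interpret O: ordered_quantum_space sc us "\<lambda>_. 1" "UNIV - {0}" "U.key \<sigma>"
      by (rule U.ordered_by_key[OF \<sigma>])
    show ?thesis
      using O.lead_intertwine[OF _ O.lead_e1[OF i], of "\<phi> (us ! i)" w] us_in_S[OF i] \<phi>[OF us_in_S[OF i]] w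
      by (simp add: U_S)
  qed
  have "ordered_quantum_space.lead sc us (U.key id) (\<phi> (us ! i)) (U.e1 i)"
    by (rule ord) auto
  moreover have "ordered_quantum_space.lead sc us (U.key (\<lambda>j. length us - Suc j)) (\<phi> (us ! i)) (U.e1 i)"
    by (rule ord) (auto simp: inj_on_def)
  moreover have "\<phi> (us ! i) \<in> U.S"
    using \<phi>(1)[OF us_in_S[OF i]] by (simp add: U_S)
  ultimately show ?thesis
    using U.lead_e1_in_both_orders[OF refl _ i, of "\<phi> (us ! i)"] that by metis
qed

text \<open>Invariance extends from the generators to \<open>S\<close> and gives h(x) = c h(x) and
  h(y) = c^(-1) h(y), with c different from 1.\<close>

lemma hom_invariant:
  assumes "algebra_hom sc sc' S h" and eq: "\<And>i. i < length us \<Longrightarrow> h (\<phi> (us ! i)) = h (us ! i)"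
  shows "h x = 0" "h y = 0"
proof -
  interpret h: algebra_hom sc sc' S h by (rule assms(1))
  have "algebra_hom sc sc' S (\<lambda>z. h (\<phi> z))"
    by unfold_locales
      (auto simp: sc_in_S S_add S_mult \<phi>.h_sc h.h_sc \<phi>.h_add h.h_add \<phi>.h_mult h.h_mult \<phi>(1))
  from hom_eqI[OF this assms(1) eq] have inv: "h (\<phi> z) = h z" if "z \<in> S" for z
    using that by simp
  have zero: "v = 0" if "sc' e * v = v" "e \<noteq> 1" for e v
  proof -
    have "sc' (e - 1) * v = 0"
      using that(1) by (simp add: h.target.sc_diff left_diff_distrib)
    then have "(sc' (inverse (e - 1)) * sc' (e - 1)) * v = 0"
      by (simp only: mult.assoc mult_zero_right)
    then show ?thesis using that(2) by (simp add: h.target.sc_inverse)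
  qed
  show "h x = 0"
    using inv[OF x_in_S] c(2) by (intro zero[of c]) (simp_all add: \<phi>_x h.h_mult h.h_sc sc_in_S x_in_S)
  show "h y = 0"
    using inv[OF y_in_S] c by (intro zero[of "inverse c"]) (simp_all add: \<phi>_y h.h_mult h.h_sc sc_in_S y_in_S)
qed

lemma hom_kills_g:
  assumes h: "algebra_hom sc sc' S h" and "h x = 0" "h y = 0"
  shows "h (peval g t) = 0"
proof -
  interpret h: algebra_hom sc sc' S h by (rule h)
  have "peval g t = y * x - sc q * (x * y)"
    by (simp add: yx mult.assoc)
  then show ?thesis
    using assms(2,3) by (simp add: h.h_diff h.h_mult x_in_S y_in_S S_mult sc_in_S)
qed

lemma contradiction: False
proof -
  define T where "T i p \<longleftrightarrow> fst p \<noteq> 0 \<and> \<phi> (us ! i) = sc (fst p) * us ! i + sc (snd p)" for i p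
  define E where "E i = (SOME p. T i p)" for i
  have TE: "T i (E i)" if i: "i < length us" for i
  proof -
    obtain e s where "e \<noteq> 0" "\<phi> (us ! i) = sc e * us ! i + sc s"
      by (rule \<phi>_us[OF i])
    then have "T i (e, s)" by (simp add: T_def)
    then show ?thesis unfolding E_def by (rule someI)
  qed
  define e where "e i = fst (E i)" for i
  define s where "s i = snd (E i)" for i
  have es: "\<phi> (us ! i) = sc (e i) * us ! i + sc (s i)" if "i < length us" for i
    using TE[OF that] by (simp add: T_def e_def s_def)
  let ?P = "\<lambda>i. \<pi> (us ! i) mod g"
  \<comment> \<open>For \<open>e i\<close> different from 1 this is the fixed point of the affine
    map z -> e z + s. Remainders are invariant under \<open>\<phi>\<close>, so such a generator has
    the constant \<open>\<tau> i\<close> as its remainder; for \<open>e i = 1\<close> the same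
    invariance forces \<open>s i = 0\<close>.\<close>
  define \<tau> where "\<tau> i = - s i / (e i - 1)" for i
  have g: "0 < Polynomial.degree g" using degree_g by simp
  have red: "Polynomial.smult (e i - 1) (?P i) + [:s i:] = 0" if i: "i < length us" for i
  proof -
    have "(Polynomial.smult (e i) (\<pi> (us ! i)) + [:s i:]) mod g = \<pi> (us ! i) mod g"
      using pi_\<phi>[OF us_in_S[OF i]] by (simp add: es[OF i] pi_add pi_scale pi_sc)
    then have "Polynomial.smult (e i) (?P i) + [:s i:] = ?P i"
      using g by (simp add: poly_mod_add_left mod_smult_left mod_poly_less)
    moreover have "Polynomial.smult (e i - 1) (?P i) + [:s i:] = (Polynomial.smult (e i) (?P i) + [:s i:]) - ?P i"
      by (simp add: smult_diff_left)
    ultimately show ?thesis by simp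
  qed
  have s0: "s i = 0" if "i < length us" "e i = 1" for i
    using red[OF that(1)] that(2) by simp
  have P\<tau>: "?P i = [:\<tau> i:]" if "i < length us" "e i \<noteq> 1" for i
  proof -
    have "Polynomial.smult (e i - 1) (?P i) = [:- s i:]"
      using red[OF that(1)] eq_neg_iff_add_eq_0[of "Polynomial.smult (e i - 1) (?P i)" "[:s i:]"] by simp
    then have "Polynomial.smult (inverse (e i - 1)) (Polynomial.smult (e i - 1) (?P i)) = [:\<tau> i:]"
      by (simp add: \<tau>_def divide_inverse mult.commute)
    then show ?thesis using that(2) by simp
  qed
  have \<tau>: "e i * \<tau> i + s i = \<tau> i" if "e i \<noteq> 1" for i
    using that by (simp add: \<tau>_def field_simps)
  obtain d l0 l where "\<And>i j. i < length us \<Longrightarrow> j < length us \<Longrightarrow> d i j \<noteq> 0"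
    and rel: "\<And>i j. i < length us \<Longrightarrow> j < length us \<Longrightarrow>
      us ! j * us ! i = sc (d i j) * (us ! i * us ! j) + (sc (l0 i j) + (\<Sum>k<length us. sc (l i j k) * us ! k))"
    by (rule relation_coefficients, rule that)
  have inv: "h (\<phi> (us ! i)) = h (us ! i)"
    if h: "algebra_hom sc sc' S h" and i: "i < length us" and "e i \<noteq> 1 \<Longrightarrow> h (us ! i) = sc' (\<tau> i)"
    for sc' :: "'k \<Rightarrow> 'c::ring_1" and h i
  proof -
    interpret h: algebra_hom sc sc' S h by (rule h)
    have eq: "h (\<phi> (us ! i)) = sc' (e i) * h (us ! i) + sc' (s i)"
      using i by (simp add: es h.h_add h.h_mult h.h_sc sc_in_S us_in_S S_scale)
    show ?thesis
    proof (cases "e i = 1")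
      case True
      then show ?thesis using eq s0[OF i] by simp
    next
      case False
      then have "h (\<phi> (us ! i)) = sc' (e i * \<tau> i + s i)"
        unfolding eq that(3)[OF False] by (simp only: h.target.sc_mult h.target.sc_add)
      then show ?thesis using \<tau>[OF False] that(3) False by simp
    qed
  qed
  show False
  proof (cases "\<forall>i j. i < j \<longrightarrow> j < length us \<longrightarrow> e i \<noteq> 1 \<or> e j \<noteq> 1")
    case True
    have deg: "Polynomial.degree (?P i) < Polynomial.degree g" for i
    proof -
      have "g \<noteq> 0" using g by auto
      from degree_mod_less[OF this, of "\<pi> (us ! i)"] show ?thesis
        using g by (elim disjE) simp_all
    qed
    have relP: "?P j * ?P i = [:d i j:] * (?P i * ?P j)
        + ([:l0 i j:] + (\<Sum>k<length us. [:l i j k:] * ?P k))" if ij: "i < j" "j < length us" for i j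
    proof (rule relation_mod[OF g _ _ rel])
      \<comment> \<open>One of the two remainders is constant, so the quadratic part is a scalar
        multiple of the other remainder and has degree below deg g.\<close>
      have "e i \<noteq> 1 \<or> e j \<noteq> 1" using True ij by blast
      then obtain m b where "?P j * ?P i - [:d i j:] * (?P i * ?P j) = Polynomial.smult b (?P m)"
      proof
        assume "e i \<noteq> 1"
        then have "?P j * ?P i - [:d i j:] * (?P i * ?P j) = Polynomial.smult (\<tau> i - d i j * \<tau> i) (?P j)"
          using P\<tau>[of i] ij by (simp add: smult_diff_left mult.commute)
        then show ?thesis by (rule that)
      next
        assume "e j \<noteq> 1"
        then have "?P j * ?P i - [:d i j:] * (?P i * ?P j) = Polynomial.smult (\<tau> j - d i j * \<tau> j) (?P i)"
          using P\<tau>[of j] ij by (simp add: smult_diff_left mult.commute)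
        then show ?thesis by (rule that)
      qed
      then show "Polynomial.degree (?P j * ?P i - [:d i j:] * (?P i * ?P j)) < Polynomial.degree g"
        using degree_smult_le[of b "?P m"] deg[of m] by simp
    qed (use ij in auto)
    obtain h where h: "algebra_hom sc (\<lambda>c. [:c:]) S h" and hP: "\<And>i. i < length us \<Longrightarrow> h (us ! i) = ?P i"
    proof (rule U.universal_property[OF pc.central_algebra_axioms, of "map ?P [0..<length us]" d l0 l])
      fix i j assume ij: "i < j" "j < length us"
      then show "us ! j * us ! i = sc (d i j) * (us ! i * us ! j) + (sc (l0 i j) + (\<Sum>k<length us. sc (l i j k) * us ! k))"
        by (intro rel) simp_all
      have "(\<Sum>k<length us. [:l i j k:] * map ?P [0..<length us] ! k) = (\<Sum>k<length us. [:l i j k:] * ?P k)"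
        by (intro sum.cong) auto
      then show "map ?P [0..<length us] ! j * map ?P [0..<length us] ! i =
          [:d i j:] * (map ?P [0..<length us] ! i * map ?P [0..<length us] ! j) +
          ([:l0 i j:] + (\<Sum>k<length us. [:l i j k:] * map ?P [0..<length us] ! k))"
        using relP[OF ij] ij by simp
    next
      fix h assume "algebra_hom sc (\<lambda>c. [:c:]) U.S h" "\<And>i. i < length us \<Longrightarrow> h (us ! i) = map ?P [0..<length us] ! i"
      then show thesis
        by (intro that[of h]) (simp_all add: U_S)
    qed simp
    have "h z mod g = \<pi> z mod g" if "z \<in> S" for z
      by (rule hom_lifts_pi[OF h _ that]) (simp add: hP)
    moreover have "h (\<phi> (us ! i)) = h (us ! i)" if "i < length us" for i
      using inv[OF h that] hP[OF that] P\<tau>[OF that] by simp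
    then have "h (peval g t) = 0"
      using hom_invariant[OF h] by (intro hom_kills_g[OF h]) auto
    ultimately show False
      using no_lift[OF h] degree_g by blast
  next
    case False
    then obtain a b where ab: "a < b" "b < length us" "e a = 1" "e b = 1" by blast
    \<comment> \<open>Otherwise \<open>\<phi>\<close> fixes all generators, so the identity map is
      invariant and would kill x.\<close>
    have "\<exists>k<length us. e k \<noteq> 1"
    proof (rule ccontr)
      assume "\<not> ?thesis"
      then have "algebra_hom sc sc S (\<lambda>z. z)" "\<And>i. i < length us \<Longrightarrow> \<phi> (us ! i) = us ! i"
        using es s0 by (auto intro!: algebra_hom.intro algebra_hom_axioms.intro central_algebra_axioms
            simp: sc_in_S S_add S_mult)
      then have "x = 0"
        using hom_invariant(1)[of sc "\<lambda>z. z"] by blast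
      then show False using x_nonzero by simp
    qed
    then obtain k where k: "k < length us" "e k \<noteq> 1" by blast
    then have "k \<noteq> a" "k \<noteq> b" using ab by auto
    then have all: "i = a \<or> i = b \<or> i = k" if "i < length us" for i
      using that ab k length_us_le_3 by linarith
    have fix_us: "\<phi> (us ! i) = us ! i" if "i < length us" "i \<noteq> k" for i
      using all[OF that(1)] that ab es[OF that(1)] s0[OF that(1)] by auto
    define v where "v = us ! k - sc (\<tau> k)"
    \<comment> \<open>Two fixed generators may have nonconstant remainders whose product is too
      large. The target is therefore the algebra itself instead of K[s]: the third generator is
      specialised to its fixed point, the other two are kept.\<close>
    define ps where "ps = map (\<lambda>i. if i = k then sc (\<tau> k) else us ! i) [0..<length us]"
    have v_S: "v \<in> S"
      unfolding v_def by (intro S_diff us_in_S sc_in_S k)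
    have \<phi>_v: "\<phi> v = sc (e k) * v"
    proof -
      have "\<phi> v = sc (e k) * us ! k + sc (s k) - sc (\<tau> k)"
        using k by (simp add: v_def \<phi>.h_diff us_in_S sc_in_S es \<phi>.h_sc)
      also have "sc (\<tau> k) = sc (e k) * sc (\<tau> k) + sc (s k)"
        using \<tau>[OF k(2)] by (metis sc_add sc_mult)
      finally show ?thesis by (simp add: v_def right_diff_distrib)
    qed
    have ps: "ps ! i \<in> S" "\<phi> (ps ! i) = ps ! i" "us ! i = ps ! i + (if i = k then v else 0)"
      if "i < length us" for i
      using that fix_us[OF that] by (auto simp: ps_def v_def sc_in_S us_in_S \<phi>.h_sc)
    have zero: "z = 0" if "sc (e k) * z = z" for z
    proof -
      have "sc (e k - 1) * z = 0"
        using that by (simp add: sc_diff left_diff_distrib)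
      then have "(sc (inverse (e k - 1)) * sc (e k - 1)) * z = 0"
        by (simp only: mult.assoc mult_zero_right)
      then show ?thesis using k(2) by (simp add: sc_inverse)
    qed
    \<comment> \<open>The defect \<open>F\<close> of a relation under the substitution is built from
      elements fixed by \<open>\<phi>\<close>, hence is fixed. It also differs from the true
      relation by terms of first order in \<open>v\<close>, hence has eigenvalue \<open>e k\<close>.
      As \<open>e k\<close> is not 1, it vanishes.\<close>
    have rel_ps: "ps ! j * ps ! i = sc (d i j) * (ps ! i * ps ! j)
        + (sc (l0 i j) + (\<Sum>m<length us. sc (l i j m) * ps ! m))" if ij: "i < j" "j < length us" for i j
    proof -
      have i: "i < length us" using ij by simp
      define F where "F = ps ! j * ps ! i - sc (d i j) * (ps ! i * ps ! j)
          - (sc (l0 i j) + (\<Sum>m<length us. sc (l i j m) * ps ! m))"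
      define pd where "pd i j = us ! i * us ! j - ps ! i * ps ! j" for i j
      \<comment> \<open>Because \<open>i\<close> and \<open>j\<close> differ, \<open>v\<close>
        occurs in at most one factor and no quadratic term in \<open>v\<close> arises.\<close>
      have pd: "pd i j \<in> S \<and> \<phi> (pd i j) = sc (e k) * pd i j"
        if ij: "i < length us" "j < length us" "i \<noteq> j" for i j
      proof -
        have "pd i j = (if i = k then v * ps ! j else if j = k then ps ! i * v else 0)"
          unfolding pd_def ps(3)[OF ij(1)] ps(3)[OF ij(2)] using ij(3)
          by (auto simp: distrib_left distrib_right)
        then show ?thesis
          using ps(1,2)[OF ij(1)] ps(1,2)[OF ij(2)] v_S \<phi>_v \<phi>.h_sc[of 0]
          by (auto simp: S_mult \<phi>.h_mult S_zero mult.assoc sc_left_commute[of "ps ! i"])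
      qed
      have sum: "(\<Sum>m<length us. sc (l i j m) * us ! m) = (\<Sum>m<length us. sc (l i j m) * ps ! m) + sc (l i j k) * v"
      proof -
        have "(\<Sum>m<length us. sc (l i j m) * us ! m)
            = (\<Sum>m<length us. sc (l i j m) * ps ! m + (if m = k then sc (l i j k) * v else 0))"
          using ps(3) by (intro sum.cong) (auto simp: distrib_left)
        then show ?thesis using k(1) by (simp add: sum.distrib)
      qed
      have F_eq: "F = sc (l i j k) * v + sc (d i j) * pd i j - pd j i"
        using rel[OF i ij(2)] sum by (simp add: F_def pd_def algebra_simps)
      have "\<phi> F = sc (e k) * F"
        using pd[OF i ij(2)] pd[OF ij(2) i] ij(1) v_S \<phi>_v
        by (simp add: F_eq \<phi>.h_diff \<phi>.h_add \<phi>.h_mult \<phi>.h_sc S_scale S_add sc_in_S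
            distrib_left right_diff_distrib mult.commute[of "e k"])
      moreover have "\<phi> F = F"
      proof -
        have terms: "\<phi> (\<Sum>m\<in>M. sc (l i j m) * ps ! m) = (\<Sum>m\<in>M. sc (l i j m) * ps ! m)
            \<and> (\<Sum>m\<in>M. sc (l i j m) * ps ! m) \<in> S" if "M \<subseteq> {..<length us}" "finite M" for M
          using that(2,1) \<phi>.h_sc[of 0]
          by (induct M rule: finite_induct)
            (auto simp: S_zero S_add S_scale ps \<phi>.h_add \<phi>.h_mult \<phi>.h_sc sc_in_S)
        show ?thesis
          unfolding F_def using terms[of "{..<length us}"] ps(1,2)[OF i] ps(1,2)[OF ij(2)]
          by (simp add: \<phi>.h_diff \<phi>.h_add \<phi>.h_mult \<phi>.h_sc S_mult S_add S_diff S_scale sc_in_S)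
      qed
      ultimately have "F = 0" using zero by simp
      then show ?thesis by (simp add: F_def diff_eq_eq add.commute)
    qed
    obtain h where h: "algebra_hom sc sc S h" and hps: "\<And>i. i < length us \<Longrightarrow> h (us ! i) = ps ! i"
    proof (rule U.universal_property[OF central_algebra_axioms, of ps d l0 l])
      show "length ps = length us" by (simp add: ps_def)
      fix i j assume ij: "i < j" "j < length us"
      show "us ! j * us ! i = sc (d i j) * (us ! i * us ! j) + (sc (l0 i j) + (\<Sum>k<length us. sc (l i j k) * us ! k))"
        using ij by (intro rel) simp_all
      show "ps ! j * ps ! i = sc (d i j) * (ps ! i * ps ! j) + (sc (l0 i j) + (\<Sum>k<length us. sc (l i j k) * ps ! k))"
        by (rule rel_ps[OF ij])
    next
      fix h assume "algebra_hom sc sc U.S h" "\<And>i. i < length us \<Longrightarrow> h (us ! i) = ps ! i"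
      then show thesis
        by (intro that[of h]) (simp_all add: U_S)
    qed
    interpret h: algebra_hom sc sc S h by (rule h)
    have "h (\<phi> (us ! i)) = h (us ! i)" if "i < length us" for i
      using inv[OF h that] hps[OF that] all[OF that] ab that by (auto simp: ps_def)
    then have hx: "h x = 0" and hy: "h y = 0"
      using hom_invariant[OF h] by auto
    have "peval g (h t) = 0"
      using hom_kills_g[OF h hx hy] h.h_peval[OF t_in_S] by simp
    moreover have "h t \<in> S"
      by (rule hom_maps_into[OF h, of "\<lambda>z. z \<in> S"]) (simp_all add: sc_in_S S_add S_mult hps ps(1) t_in_S)
    \<comment> \<open>A nonscalar \<open>h t\<close> would be transcendental. So x, y and t all map
      to scalars, which is incompatible with \<open>h\<close> fixing the nonscalar
      \<open>us ! a\<close>.\<close>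
    ultimately have ht: "h t \<in> range sc"
      using peval_nonzero[of "h t" g] degree_g by fastforce
    have closed: "u + z \<in> range sc" "u * z \<in> range sc" if "u \<in> range sc" "z \<in> range sc" for u z
      using that by (auto simp flip: sc_add sc_mult)
    have "h (us ! a) \<in> range sc"
      using us_in_S[of a] ab
    proof (rule_tac S_algebra_induct[of "us ! a" "\<lambda>z. h z \<in> range sc"])
      show "h x \<in> range sc" "h y \<in> range sc" "h t \<in> range sc"
        using hx hy ht rangeI[of sc 0] by auto
    qed (auto simp: h.h_sc h.h_add h.h_mult intro: closed)
    then show False
      using hps[of a] ab \<open>k \<noteq> a\<close> us_nonscalar[of a] by (simp add: ps_def)
  qed
qed

end

section \<open>The commutative case\<close>

locale qgh_commutative = qgh_PBW sc x y t q f g S \<pi> us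
  for sc :: "'k::field \<Rightarrow> 'a::ring_1" and x y t q f g S \<pi> us +
  fixes \<beta> :: 'k
  assumes degree_g: "2 \<le> Polynomial.degree g"
    and q1: "q = 1" and f1: "f = [:\<beta>, 1:]"
begin

interpretation H: quantum_space sc "[x, t, y]" heis_weight "{1}"
  by (rule heis_quantum_space[OF f1]) (simp_all add: q1)

interpretation HO: ordered_quantum_space sc "[x, t, y]" heis_weight "{1}" "H.key id"
  by (rule H.ordered_by_key) auto

lemma H_S: "H.S = S"
  unfolding H.S_def range_monomial_xty S_eq ..

abbreviation form :: "'k \<Rightarrow> (nat \<Rightarrow> 'k) \<Rightarrow> 'a" where
  "form l0 l \<equiv> sc l0 + (\<Sum>k<length us. sc (l k) * us ! k)"

lemma form_in_S: "form l0 l \<in> S"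
proof -
  have "(\<Sum>k\<in>M. sc (l k) * us ! k) \<in> S" if "M \<subseteq> {..<length us}" "finite M" for M
    using that(2,1) by (induct M rule: finite_induct) (auto simp: S_zero intro!: S_add S_scale us_in_S)
  then show ?thesis by (intro S_add sc_in_S) auto
qed

lemma form_low: "form l0 l \<in> low us (\<lambda>_. 1) 2"
proof -
  have "1 \<in> low us (\<lambda>_. 1) 2"
    using word_in_low[of "[]" us "\<lambda>_. 1" 2] by simp
  moreover have "us ! k \<in> low us (\<lambda>_. 1) 2" if "k < length us" for k
    using word_in_low[of "[k]" us "\<lambda>_. 1" 2] that by (simp add: word_Cons)
  ultimately have "sc l0 * 1 + (\<Sum>k<length us. sc (l k) * us ! k) \<in> low us (\<lambda>_. 1) 2"
    unfolding low_def by (intro vs.span_add vs.span_scale vs.span_sum) auto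
  then show ?thesis by simp
qed

text \<open>In the commutative associated graded algebra of the Heisenberg weight filtration, a relation
  with \<open>d \<noteq> 1\<close> forces the product of the leading terms of its generators into \<open>K + \<Sum> K u\<^sub>k\<close>.\<close>

lemma heavy_generator:
  assumes lead: "\<And>i. i < length us \<Longrightarrow> HO.lead (us ! i) (\<mu> i)"
    and ij: "i < length us" "j < length us" and d: "d \<noteq> 1"
    and rel: "us ! j * us ! i = sc d * (us ! i * us ! j) + form l0 l"
  obtains k where "k < length us" "l k \<noteq> 0"
    "H.key id (\<mu> i) + H.key id (\<mu> j) \<le> H.key id (\<mu> k)"
    "0 < H.key id (\<mu> i)" "0 < H.key id (\<mu> j)" "k \<noteq> i" "k \<noteq> j"
proof -
  let ?key = "H.key id"
  let ?m = "map2 (+) (\<mu> i) (\<mu> j)"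
  have pos: "0 < ?key (\<mu> m)" if "m < length us" for m
    using HO.lead_e0[of "us ! m"] us_nonscalar[OF that] lead[OF that] us_in_S[OF that] HO.lead_Ex[OF lead[OF that]]
    by (intro HO.key_pos) (auto simp: H_S)
  have "HO.lead (us ! j * us ! i - sc d * (us ! i * us ! j)) ?m"
    by (rule HO.lead_skew_commutator) (use d lead ij us_in_S H_S in auto)
  then have lead_form: "HO.lead (form l0 l) ?m"
    by (simp add: rel)
  have key_m: "?key ?m = ?key (\<mu> i) + ?key (\<mu> j)"
    using HO.lead_Ex lead ij by (intro HO.key_add) auto
  have mEx: "?m \<in> H.Ex" by (rule HO.lead_Ex[OF lead_form])
  have us_S: "sc (l k) * us ! k \<in> H.S" if "k < length us" for k
    using that by (simp add: H_S us_in_S S_scale)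
  have "H.co (form l0 l) ?m = H.co (sc l0) ?m + (\<Sum>k<length us. l k * H.co (us ! k) ?m)"
  proof -
    have "H.co (form l0 l) ?m = H.co (sc l0) ?m + H.co (\<Sum>k<length us. sc (l k) * us ! k) ?m"
      using us_S by (intro H.co_add H.sc_in_S H.S_sum) auto
    also have "H.co (\<Sum>k<length us. sc (l k) * us ! k) ?m = (\<Sum>k<length us. H.co (sc (l k) * us ! k) ?m)"
      using us_S by (intro H.co_sum) auto
    also have "\<dots> = (\<Sum>k<length us. l k * H.co (us ! k) ?m)"
      using us_in_S H_S by (intro sum.cong) (auto simp: H.co_scale)
    finally show ?thesis .
  qed
  moreover have "H.co (sc l0) ?m = 0"
  proof -
    have "?m \<noteq> H.e0"
      using key_m pos[OF ij(1)] pos[OF ij(2)] HO.key_e0 by auto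
    then show ?thesis using H.co_sc[OF mEx, of l0] by simp
  qed
  moreover have "H.co (form l0 l) ?m \<noteq> 0"
    using lead_form by (simp add: HO.lead_def H.supp_def)
  ultimately have "(\<Sum>k<length us. l k * H.co (us ! k) ?m) \<noteq> 0" by simp
  then obtain k where k: "k < length us" "l k * H.co (us ! k) ?m \<noteq> 0"
    by (meson lessThan_iff sum.neutral)
  then have "?m \<in> H.supp (us ! k)"
    using mEx by (simp add: H.supp_def)
  then have le: "?key (\<mu> i) + ?key (\<mu> j) \<le> ?key (\<mu> k)"
    using lead[OF k(1)] unfolding HO.lead_def key_m[symmetric] by blast
  moreover have "k \<noteq> i" "k \<noteq> j"
    using le pos[OF ij(1)] pos[OF ij(2)] by auto
  ultimately show ?thesis
    using that k pos ij by auto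
qed

section \<open>Quadratic coefficients in the given generators\<close>

lemma co_low2: "z \<in> low us (\<lambda>_. 1) 2 \<Longrightarrow> U.co z (letter_counts (length us) [i, k]) = 0"
  if "i < length us" "k < length us"
  using U.co_low[of z 2 "letter_counts (length us) [i, k]"] that
    weight_letter_counts[of "[i, k]" "length us" "\<lambda>_. 1"] by simp

lemma co_us_us:
  assumes "i < length us" "k < length us" "m < length us" "m' < length us"
  shows "U.co (us ! m * us ! m') (letter_counts (length us) [i, k]) = 0
    \<longleftrightarrow> letter_counts (length us) [m, m'] \<noteq> letter_counts (length us) [i, k]"
  using U.co_word(1)[of "[m, m']" "letter_counts (length us) [i, k]"] assms
    weight_letter_counts[of "[i, k]" "length us" "\<lambda>_. 1"] by (simp add: word_Cons)

lemma letter_counts_pair_eq: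
  assumes "i < n" "k < n" "i \<noteq> k" "letter_counts n [m, m'] = letter_counts n [i, k]"
  shows "(m = i \<and> m' = k) \<or> (m = k \<and> m' = i)"
  using arg_cong[OF assms(4), of "\<lambda>w. w ! i"] arg_cong[OF assms(4), of "\<lambda>w. w ! k"] assms(1-3)
  by (auto simp: nth_letter_counts split: if_splits)

lemma us_mult_in_U: "m < length us \<Longrightarrow> m' < length us \<Longrightarrow> us ! m * us ! m' \<in> U.S"
  by (simp add: U_S S_mult us_in_S)

lemma co_form_right:
  assumes "i < length us" "k < length us" "c < length us"
  shows "U.co (form r0 r * us ! c) (letter_counts (length us) [i, k])
    = (\<Sum>m<length us. r m * U.co (us ! m * us ! c) (letter_counts (length us) [i, k]))"
proof -
  have "us ! c \<in> low us (\<lambda>_. 1) 2"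
    using word_in_low[of "[c]" us "\<lambda>_. 1" 2] assms(3) by (simp add: word_Cons)
  then have c: "U.co (us ! c) (letter_counts (length us) [i, k]) = 0"
    by (rule co_low2[OF assms(1,2)])
  have "U.co (form r0 r * us ! c) (letter_counts (length us) [i, k])
      = U.co (sc r0 * us ! c + (\<Sum>m<length us. sc (r m) * (us ! m * us ! c))) (letter_counts (length us) [i, k])"
    by (simp add: distrib_right sum_distrib_right mult.assoc)
  also have "\<dots> = r0 * U.co (us ! c) (letter_counts (length us) [i, k])
      + U.co (\<Sum>m<length us. sc (r m) * (us ! m * us ! c)) (letter_counts (length us) [i, k])"
    using assms us_mult_in_U by (subst U.co_add) (auto intro!: U.S_sum U.S_scale U.us_in_S simp: U.co_scale U.us_in_S)
  also have "U.co (\<Sum>m<length us. sc (r m) * (us ! m * us ! c)) (letter_counts (length us) [i, k])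
      = (\<Sum>m<length us. U.co (sc (r m) * (us ! m * us ! c)) (letter_counts (length us) [i, k]))"
    using assms us_mult_in_U by (intro U.co_sum U.S_scale) auto
  also have "\<dots> = (\<Sum>m<length us. r m * U.co (us ! m * us ! c) (letter_counts (length us) [i, k]))"
    using assms us_mult_in_U by (intro sum.cong) (auto simp: U.co_scale)
  finally show ?thesis using c by simp
qed

lemma co_form_left:
  assumes "i < length us" "k < length us" "c < length us"
  shows "U.co (us ! c * form r0 r) (letter_counts (length us) [i, k])
    = (\<Sum>m<length us. r m * U.co (us ! c * us ! m) (letter_counts (length us) [i, k]))"
proof -
  have "us ! c \<in> low us (\<lambda>_. 1) 2"
    using word_in_low[of "[c]" us "\<lambda>_. 1" 2] assms(3) by (simp add: word_Cons)
  then have c: "U.co (us ! c) (letter_counts (length us) [i, k]) = 0"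
    by (rule co_low2[OF assms(1,2)])
  have "U.co (us ! c * form r0 r) (letter_counts (length us) [i, k])
      = U.co (sc r0 * us ! c + (\<Sum>m<length us. sc (r m) * (us ! c * us ! m))) (letter_counts (length us) [i, k])"
    by (simp add: distrib_left sum_distrib_left sc_left_commute[of "us ! c"] sc_central[of r0 "us ! c"])
  also have "\<dots> = r0 * U.co (us ! c) (letter_counts (length us) [i, k])
      + U.co (\<Sum>m<length us. sc (r m) * (us ! c * us ! m)) (letter_counts (length us) [i, k])"
    using assms us_mult_in_U by (subst U.co_add) (auto intro!: U.S_sum U.S_scale U.us_in_S simp: U.co_scale U.us_in_S)
  also have "U.co (\<Sum>m<length us. sc (r m) * (us ! c * us ! m)) (letter_counts (length us) [i, k])
      = (\<Sum>m<length us. U.co (sc (r m) * (us ! c * us ! m)) (letter_counts (length us) [i, k]))"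
    using assms us_mult_in_U by (intro U.co_sum U.S_scale) auto
  also have "\<dots> = (\<Sum>m<length us. r m * U.co (us ! c * us ! m) (letter_counts (length us) [i, k]))"
    using assms us_mult_in_U by (intro sum.cong) (auto simp: U.co_scale)
  finally show ?thesis using c by simp
qed

text \<open>Among words of length two only u_i u_k and u_k u_i have the exponent in question, so
  these coefficients isolate the coefficient of u_k in the form.\<close>

lemma co_form_values:
  assumes "i < length us" "k < length us" "c < length us" "i \<noteq> k"
  shows "c = i \<Longrightarrow> U.co (form r0 r * us ! c) (letter_counts (length us) [i, k])
      = r k * U.co (us ! k * us ! i) (letter_counts (length us) [i, k])"
    and "c = i \<Longrightarrow> U.co (us ! c * form r0 r) (letter_counts (length us) [i, k])
      = r k * U.co (us ! i * us ! k) (letter_counts (length us) [i, k])"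
    and "c \<noteq> i \<Longrightarrow> c \<noteq> k \<Longrightarrow> U.co (form r0 r * us ! c) (letter_counts (length us) [i, k]) = 0"
    and "c \<noteq> i \<Longrightarrow> c \<noteq> k \<Longrightarrow> U.co (us ! c * form r0 r) (letter_counts (length us) [i, k]) = 0"
proof -
  let ?e = "\<lambda>z. U.co z (letter_counts (length us) [i, k])"
  have z: "?e (us ! m * us ! m') = 0" if "m < length us" "m' < length us" "\<not> (m = i \<and> m' = k)" "\<not> (m = k \<and> m' = i)" for m m'
    using co_us_us[OF assms(1,2) that(1,2)] letter_counts_pair_eq[OF assms(1,2,4), of m m'] that(3,4) by blast
  have single: "(\<Sum>m<length us. r m * F m) = r k * F k" if "\<And>m. m < length us \<Longrightarrow> m \<noteq> k \<Longrightarrow> F m = 0" for F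
  proof -
    have "(\<Sum>m<length us. r m * F m) = (\<Sum>m\<in>{k}. r m * F m)"
      using assms(2) that by (intro sum.mono_neutral_right) auto
    then show ?thesis by simp
  qed
  show "?e (form r0 r * us ! c) = r k * ?e (us ! k * us ! i)" if "c = i"
    unfolding co_form_right[OF assms(1-3)] unfolding that using z assms by (intro single) auto
  show "?e (us ! c * form r0 r) = r k * ?e (us ! i * us ! k)" if "c = i"
    unfolding co_form_left[OF assms(1-3)] unfolding that using z assms by (intro single) auto
  show "?e (form r0 r * us ! c) = 0" if "c \<noteq> i" "c \<noteq> k"
    unfolding co_form_right[OF assms(1-3)] using z assms that by (intro sum.neutral) auto
  show "?e (us ! c * form r0 r) = 0" if "c \<noteq> i" "c \<noteq> k"
    unfolding co_form_left[OF assms(1-3)] using z assms that by (intro sum.neutral) auto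
qed

text \<open>Comparing coefficients after commuting \<open>u\<^sub>k\<close> past the relation between \<open>u\<^sub>a\<close> and \<open>u\<^sub>b\<close>.\<close>

lemma overlap:
  assumes lt: "a < length us" "b < length us" "k < length us" and ne: "a \<noteq> b" "k \<noteq> a" "k \<noteq> b"
    and all: "{..<length us} = {a, b, k}" and d: "d \<noteq> 1"
    and rel: "us ! b * us ! a = sc d * (us ! a * us ! b) + form l0 l"
    and m: "us ! k * us ! a - us ! a * us ! k = form m0 m"
    and p: "us ! k * us ! b - us ! b * us ! k = form p0 p"
  shows "m k = 0" "p k = 0"
proof -
  let ?u = "us ! a" and ?v = "us ! b" and ?z = "us ! k"
  let ?m = "form m0 m" and ?p = "form p0 p"
  have l_form: "form l0 l = sc l0 + (sc (l a) * ?u + (sc (l b) * ?v + sc (l k) * ?z))"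
    using ne by (simp add: all)
  \<comment> \<open>The commutator of u_k with the affine form is computed twice: here through its
    expansion in the generators, where it stays of degree at most 1, and then through u_b u_a - d
    u_a u_b, where quadratic terms appear.\<close>
  have "?z * form l0 l - form l0 l * ?z = sc (l a) * ?m + sc (l b) * ?p"
    unfolding l_form m[symmetric] p[symmetric]
    by (simp add: distrib_left distrib_right right_diff_distrib mult.assoc sc_left_commute[of ?z] sc_central[of l0 ?z])
  moreover have "?z * form l0 l - form l0 l * ?z = (?p * ?u + ?v * ?m) - sc d * (?m * ?v + ?u * ?p)"
  proof -
    have f: "form l0 l = ?v * ?u - sc d * (?u * ?v)"
      by (simp add: rel)
    show ?thesis
      unfolding f m[symmetric] p[symmetric]
      by (simp add: distrib_left left_diff_distrib right_diff_distrib mult.assoc sc_left_commute[of ?z])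
  qed
  ultimately have T: "(?p * ?u + ?v * ?m) - sc d * (?m * ?v + ?u * ?p) = sc (l a) * ?m + sc (l b) * ?p"
    by simp
  have low: "(?p * ?u + ?v * ?m) - sc d * (?m * ?v + ?u * ?p) \<in> low us (\<lambda>_. 1) 2"
  proof -
    have "sc (l a) * ?m \<in> low us (\<lambda>_. 1) 2"
      using form_low[of m0 m] unfolding low_def by (rule vs.span_scale)
    moreover have "sc (l b) * ?p \<in> low us (\<lambda>_. 1) 2"
      using form_low[of p0 p] unfolding low_def by (rule vs.span_scale)
    ultimately show ?thesis
      unfolding T unfolding low_def by (rule vs.span_add)
  qed
  have mem: "?p * ?u \<in> U.S" "?v * ?m \<in> U.S" "?m * ?v \<in> U.S" "?u * ?p \<in> U.S"
    using lt by (auto simp: U_S intro!: S_mult us_in_S form_in_S)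
  have co: "U.co (?p * ?u) \<gamma> + U.co (?v * ?m) \<gamma> = d * (U.co (?m * ?v) \<gamma> + U.co (?u * ?p) \<gamma>)"
    if "\<gamma> = letter_counts (length us) [c, k]" "c < length us" for \<gamma> c
  proof -
    have "U.co ((?p * ?u + ?v * ?m) - sc d * (?m * ?v + ?u * ?p)) \<gamma> = 0"
      unfolding that(1) by (rule co_low2[OF that(2) lt(3) low])
    moreover have "U.co ((?p * ?u + ?v * ?m) - sc d * (?m * ?v + ?u * ?p)) \<gamma>
        = U.co (?p * ?u) \<gamma> + U.co (?v * ?m) \<gamma> - d * (U.co (?m * ?v) \<gamma> + U.co (?u * ?p) \<gamma>)"
      using mem by (simp only: U.co_diff U.co_add U.co_scale U.S_add U.S_scale)
    ultimately show ?thesis by simp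
  qed
  have sym: "U.co (?z * us ! c) (letter_counts (length us) [c, k]) = U.co (us ! c * ?z) (letter_counts (length us) [c, k])"
    if "c < length us" "?z * us ! c - us ! c * ?z = form r0 r" for c r0 r
  proof -
    have "U.co (?z * us ! c - us ! c * ?z) (letter_counts (length us) [c, k]) = 0"
      unfolding that(2) by (rule co_low2[OF that(1) lt(3) form_low])
    then show ?thesis
      using us_mult_in_U that(1) lt(3) by (simp add: U.co_diff)
  qed
  have nz: "U.co (us ! c * ?z) (letter_counts (length us) [c, k]) \<noteq> 0" if "c < length us" for c
    using co_us_us[of c k c k] that lt(3) by simp
  \<comment> \<open>At the exponent of u_a u_k the quadratic terms reduce, up to a nonzero factor,
    to p_k = d p_k; at that of u_b u_k they give the same equation for m_k.\<close>
  have "p k * U.co (?u * ?z) (letter_counts (length us) [a, k]) = d * (p k * U.co (?u * ?z) (letter_counts (length us) [a, k]))"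
    using co[OF refl lt(1)] co_form_values[OF lt(1,3,1)] co_form_values[OF lt(1,3,2)] ne sym[OF lt(1) m] by auto
  then show "p k = 0" using nz[OF lt(1)] d by simp
  have "m k * U.co (?v * ?z) (letter_counts (length us) [b, k]) = d * (m k * U.co (?v * ?z) (letter_counts (length us) [b, k]))"
    using co[OF refl lt(2)] co_form_values[OF lt(2,3,2)] co_form_values[OF lt(2,3,1)] ne sym[OF lt(2) p] by auto
  then show "m k = 0" using nz[OF lt(2)] d by simp
qed

text \<open>For q = 1 the element g(t) is the commutator of y and x, so every homomorphism to K[s]
  kills it.\<close>

lemma no_commutative_lift:
  assumes "length Ps = length us" "\<And>i. i < length us \<Longrightarrow> Ps ! i mod g = \<pi> (us ! i) mod g"
    and rel: "\<And>i j. i < j \<Longrightarrow> j < length us \<Longrightarrow> us ! j * us ! i = sc (d i j) * (us ! i * us ! j) + form (l0 i j) (l i j)"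
    and rel': "\<And>i j. i < j \<Longrightarrow> j < length us \<Longrightarrow> Ps ! j * Ps ! i = [:d i j:] * (Ps ! i * Ps ! j)
      + ([:l0 i j:] + (\<Sum>m<length us. [:l i j m:] * Ps ! m))"
  shows False
proof -
  obtain h where h: "algebra_hom sc (\<lambda>c. [:c:]) S h" and hP: "\<And>i. i < length us \<Longrightarrow> h (us ! i) = Ps ! i"
  proof (rule U.universal_property[OF pc.central_algebra_axioms assms(1) rel rel'])
    fix h assume "algebra_hom sc (\<lambda>c. [:c:]) U.S h" "\<And>i. i < length us \<Longrightarrow> h (us ! i) = Ps ! i"
    then show thesis
      by (intro that[of h]) (simp_all add: U_S)
  qed
  interpret h: algebra_hom sc "\<lambda>c. [:c:]" S h by (rule h)
  have "h z mod g = \<pi> z mod g" if "z \<in> S" for z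
    by (rule hom_lifts_pi[OF h _ that]) (simp add: hP assms(2))
  moreover have "peval g t = y * x - x * y"
    by (simp add: yx q1)
  then have "h (peval g t) = 0"
    by (simp add: h.h_diff h.h_mult x_in_S y_in_S S_mult mult.commute)
  ultimately show False
    using no_lift[OF h] degree_g by blast
qed

lemma contradiction: False
proof -
  let ?P = "\<lambda>i. \<pi> (us ! i) mod g"
  have g: "0 < Polynomial.degree g" using degree_g by simp
  obtain d l0 l where "\<And>i j. i < length us \<Longrightarrow> j < length us \<Longrightarrow> d i j \<noteq> 0"
    and rel: "\<And>i j. i < length us \<Longrightarrow> j < length us \<Longrightarrow>
      us ! j * us ! i = sc (d i j) * (us ! i * us ! j) + form (l0 i j) (l i j)"
    by (rule relation_coefficients, rule that)
  \<comment> \<open>For d = 1 the quadratic part of the remainders cancels by commutativity,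
    whatever the degrees, so the affine part must vanish as well.\<close>
  have rel1: "[:l0 i j:] + (\<Sum>m<length us. [:l i j m:] * ?P m) = 0"
    if ij: "i < length us" "j < length us" "d i j = 1" for i j
  proof -
    have "?P j * ?P i = [:d i j:] * (?P i * ?P j) + ([:l0 i j:] + (\<Sum>m<length us. [:l i j m:] * ?P m))"
      using g ij by (intro relation_mod rel) (simp_all add: mult.commute)
    then show ?thesis using ij(3) by (simp add: mult.commute)
  qed
  show False
  proof (cases "\<forall>i j. i < j \<longrightarrow> j < length us \<longrightarrow> d i j = 1")
    case True
    show False
    proof (rule no_commutative_lift[of "map ?P [0..<length us]" d l0 l])
      fix i j assume ij: "i < j" "j < length us"
      then show "us ! j * us ! i = sc (d i j) * (us ! i * us ! j) + form (l0 i j) (l i j)"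
        by (intro rel) simp_all
      have "(\<Sum>m<length us. [:l i j m:] * map ?P [0..<length us] ! m) = (\<Sum>m<length us. [:l i j m:] * ?P m)"
        by (intro sum.cong) auto
      then show "map ?P [0..<length us] ! j * map ?P [0..<length us] ! i =
          [:d i j:] * (map ?P [0..<length us] ! i * map ?P [0..<length us] ! j) +
          ([:l0 i j:] + (\<Sum>m<length us. [:l i j m:] * map ?P [0..<length us] ! m))"
        using rel1[of i j] True ij by (simp add: mult.commute)
    qed auto
  next
    case False
    then obtain a b where ab: "a < b" "b < length us" "d a b \<noteq> 1" by blast
    have a: "a < length us" using ab by simp
    define \<mu> where "\<mu> i = (SOME \<alpha>. HO.lead (us ! i) \<alpha>)" for i
    have lead: "HO.lead (us ! i) (\<mu> i)" if i: "i < length us" for i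
    proof -
      have "us ! i \<noteq> 0"
        using us_nonscalar[OF i] rangeI[of sc 0] by auto
      moreover have "us ! i \<in> H.S" using us_in_S[OF i] H_S by simp
      ultimately obtain \<alpha> where "HO.lead (us ! i) \<alpha>"
        using HO.lead_exists[of "us ! i"] by blast
      then show ?thesis unfolding \<mu>_def by (rule someI)
    qed
    define \<kappa> where "\<kappa> i = H.key id (\<mu> i)" for i
    have heavy: "\<exists>k<length us. l i j k \<noteq> 0 \<and> \<kappa> i + \<kappa> j \<le> \<kappa> k \<and> 0 < \<kappa> i \<and> 0 < \<kappa> j \<and> k \<noteq> i \<and> k \<noteq> j"
      if ij: "i < length us" "j < length us" "d i j \<noteq> 1" for i j
      by (rule heavy_generator[OF lead ij rel[OF ij(1,2)]]) (auto simp: \<kappa>_def)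
    obtain k where k: "k < length us" "l a b k \<noteq> 0" "\<kappa> a + \<kappa> b \<le> \<kappa> k" "0 < \<kappa> a" "0 < \<kappa> b" "k \<noteq> a" "k \<noteq> b"
      using heavy[OF a ab(2,3)] by blast
    have mem: "i = a \<or> i = b \<or> i = k" if "i < length us" for i
      using that ab k(1,6,7) length_us_le_3 by linarith
    have all: "{..<length us} = {a, b, k}"
      using mem a ab(2) k(1) by auto
    \<comment> \<open>A second pair with d different from 1 would contain k, so its heavy generator
      would be a or b and lie above k, whereas both a and b lie below k.\<close>
    have d1: "d i j = 1" if ij: "i < j" "j < length us" "(i, j) \<noteq> (a, b)" for i j
    proof (rule ccontr)
      assume "d i j \<noteq> 1"
      moreover have i: "i < length us" using ij by simp
      ultimately obtain k' where k': "k' < length us" "\<kappa> i + \<kappa> j \<le> \<kappa> k'" "0 < \<kappa> i" "0 < \<kappa> j" "k' \<noteq> i" "k' \<noteq> j"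
        using heavy[of i j] ij(2) by blast
      have "k = i \<or> k = j"
        using mem[OF i] mem[OF ij(2)] ij ab(1) by auto
      then have "\<kappa> k < \<kappa> k'"
        using k'(2-4) less_le_trans[of "\<kappa> k" "\<kappa> i + \<kappa> j" "\<kappa> k'"] by auto
      moreover have "k' = a \<or> k' = b"
        using mem[OF k'(1)] k'(5,6) \<open>k = i \<or> k = j\<close> by auto
      then have "\<kappa> k' < \<kappa> k"
        using k(3-5) less_le_trans[of "\<kappa> k'" "\<kappa> a + \<kappa> b" "\<kappa> k"] by auto
      ultimately show False by simp
    qed
    have comm: "\<exists>m0 m. us ! k * us ! c - us ! c * us ! k = form m0 m \<and>
        (m k = 0 \<longrightarrow> (if c < k then l c k k = 0 else l k c k = 0))"
      if c: "c < length us" "c \<noteq> k" "d c k = 1 \<or> k < c" "d k c = 1 \<or> c < k" for c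
    proof (cases "c < k")
      case True
      then have "us ! k * us ! c - us ! c * us ! k = form (l0 c k) (l c k)"
        using rel[OF c(1) k(1)] c(3) by simp
      then show ?thesis using True by auto
    next
      case False
      then have "us ! k * us ! c - us ! c * us ! k = - form (l0 k c) (l k c)"
        using rel[OF k(1) c(1)] c(2,4) by simp
      also have "\<dots> = form (- l0 k c) (\<lambda>m. - l k c m)"
        by (simp add: sc_minus sum_negf)
      finally show ?thesis using False by fastforce
    qed
    have ck: "d c k = 1 \<or> k < c" "d k c = 1 \<or> c < k" if "c < length us" "c \<noteq> k" for c
      using d1[of c k] d1[of k c] that k(1,6,7) by (auto simp: linorder_neq_iff)
    obtain m0 m where m: "us ! k * us ! a - us ! a * us ! k = form m0 m"
        "m k = 0 \<longrightarrow> (if a < k then l a k k = 0 else l k a k = 0)"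
      using comm[OF a _ ck[OF a]] k(6) by blast
    obtain p0 p where p: "us ! k * us ! b - us ! b * us ! k = form p0 p"
        "p k = 0 \<longrightarrow> (if b < k then l b k k = 0 else l k b k = 0)"
      using comm[OF ab(2) _ ck[OF ab(2)]] k(7) by blast
    have "m k = 0" "p k = 0"
      using overlap[OF a ab(2) k(1) _ k(6,7) all ab(3) rel[OF a ab(2)] m(1) p(1)] ab(1) by auto
    then have lk: "if a < k then l a k k = 0 else l k a k = 0" "if b < k then l b k k = 0 else l k b k = 0"
      using m(2) p(2) by blast+
    have l_k: "l i j k = 0" if ij: "i < j" "j < length us" "(i, j) \<noteq> (a, b)" for i j
    proof -
      have "i < length us" using ij by simp
      then have "(i = a \<and> j = k) \<or> (i = k \<and> j = a) \<or> (i = b \<and> j = k) \<or> (i = k \<and> j = b)"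
        using mem[of i] mem[OF ij(2)] ij ab(1) by auto
      then show ?thesis using lk ij(1) by (auto split: if_splits)
    qed
    let ?l = "l a b"
    let ?X = "?P b * ?P a - [:d a b:] * (?P a * ?P b) - [:l0 a b:] - [:?l a:] * ?P a - [:?l b:] * ?P b"
    \<comment> \<open>The exceptional relation is solved for its u_k term, and the result replaces
      the remainder of u_k. Its degree may be large, but the other relations have d = 1 and affine
      parts without u_k, so they still hold.\<close>
    define Q where "Q i = (if i = k then [:inverse (?l k):] * ?X else ?P i)" for i
    have lkQ: "[:?l k:] * Q k = ?X"
    proof -
      have "[:?l k:] * ([:inverse (?l k):] * ?X) = ([:?l k:] * [:inverse (?l k):]) * ?X"
        by (rule mult.assoc[symmetric])
      also have "[:?l k:] * [:inverse (?l k):] = 1"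
        using k(2) by (simp add: pCons_one)
      finally show ?thesis by (simp add: Q_def)
    qed
    have Qab: "Q a = ?P a" "Q b = ?P b"
      using k(6,7) by (simp_all add: Q_def)
    have sum3: "(\<Sum>i\<in>{a, b, k}. F i) = F a + (F b + F k)" for F :: "nat \<Rightarrow> 'k poly"
      using ab(1) k(6,7) by simp
    \<comment> \<open>Applying \<open>\<pi>\<close> to the exceptional relation identifies the
      solved expression, before division by the coefficient of u_k, with that coefficient times
      \<open>\<pi> (us ! k)\<close> modulo g.\<close>
    have Qmod: "Q i mod g = \<pi> (us ! i) mod g" if "i < length us" for i
    proof (cases "i = k")
      case True
      have "?X mod g = (\<pi> (us ! b * us ! a) - [:d a b:] * \<pi> (us ! a * us ! b) - [:l0 a b:]
          - [:?l a:] * \<pi> (us ! a) - [:?l b:] * \<pi> (us ! b)) mod g"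
      proof -
        have 1: "(?P b * ?P a) mod g = \<pi> (us ! b * us ! a) mod g"
          using pi_mult_mod[OF us_in_S[OF ab(2)]] by (simp add: mod_mult_eq)
        have 2: "(?P a * ?P b) mod g = \<pi> (us ! a * us ! b) mod g"
          using pi_mult_mod[OF us_in_S[OF a]] by (simp add: mod_mult_eq)
        show ?thesis
          by (intro mod_diff_cong mod_mult_cong 1 2 refl mod_mod_trivial)
      qed
      also have "\<pi> (us ! b * us ! a) - [:d a b:] * \<pi> (us ! a * us ! b) - [:l0 a b:]
          - [:?l a:] * \<pi> (us ! a) - [:?l b:] * \<pi> (us ! b) = [:?l k:] * \<pi> (us ! k)"
        unfolding rel[OF a ab(2)] all using ab(1) k(6,7) by (simp add: pi_add pi_scale pi_sc)
      finally have X: "?X mod g = ([:?l k:] * \<pi> (us ! k)) mod g" .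
      have "Q k mod g = ([:inverse (?l k):] * ([:?l k:] * \<pi> (us ! k))) mod g"
        unfolding Q_def using X by (simp only: if_True simp_thms) (rule mod_mult_cong[OF refl])
      also have "[:inverse (?l k):] * ([:?l k:] * \<pi> (us ! k)) = \<pi> (us ! k)"
        using k(2) by simp
      finally show ?thesis using True by simp
    qed (simp add: Q_def)
    show False
    proof (rule no_commutative_lift[of "map Q [0..<length us]" d l0 l])
      fix i j assume ij: "i < j" "j < length us"
      then show "us ! j * us ! i = sc (d i j) * (us ! i * us ! j) + form (l0 i j) (l i j)"
        by (intro rel) simp_all
      have sum: "(\<Sum>m<length us. [:l i j m:] * map Q [0..<length us] ! m) = (\<Sum>m<length us. [:l i j m:] * Q m)"
        by (intro sum.cong) auto
      have "Q j * Q i = [:d i j:] * (Q i * Q j) + ([:l0 i j:] + (\<Sum>m<length us. [:l i j m:] * Q m))"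
      proof (cases "(i, j) = (a, b)")
        case True
        then have "i = a" "j = b" by auto
        then show ?thesis
          unfolding all sum3 by (simp only: lkQ Qab) (simp add: algebra_simps)
      next
        case False
        have "(\<Sum>m<length us. [:l i j m:] * Q m) = (\<Sum>m<length us. [:l i j m:] * ?P m)"
          using l_k[OF ij False] by (intro sum.cong) (auto simp: Q_def)
        then show ?thesis
          using rel1[of i j] d1[OF ij False] ij by (simp add: mult.commute)
      qed
      then show "map Q [0..<length us] ! j * map Q [0..<length us] ! i =
          [:d i j:] * (map Q [0..<length us] ! i * map Q [0..<length us] ! j) +
          ([:l0 i j:] + (\<Sum>m<length us. [:l i j m:] * map Q [0..<length us] ! m))"
        using ij by (simp only: sum) simp
    qed (use Qmod in auto)
  qed
qed

end

section \<open>The classification\<close>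

text \<open>The operator h -> q h - h(t + \<beta>) multiplies leading coefficients by q - 1 and
  keeps degrees, so the top term of g can be removed repeatedly.\<close>

lemma normal_form_exists:
  fixes q \<beta> :: "'k::field"
  assumes "q \<noteq> 1"
  shows "\<exists>h. Polynomial.smult q h - pcompose h [:\<beta>, 1:] = g"
proof (induct "Polynomial.degree g" arbitrary: g rule: less_induct)
  case less
  show ?case
  proof (cases "g = 0")
    case True
    then show ?thesis by (intro exI[of _ 0]) simp
  next
    case False
    let ?k = "Polynomial.degree g"
    let ?f = "[:\<beta>, 1:]"
    define c where "c = Polynomial.lead_coeff g / (q - 1)"
    define h0 where "h0 = Polynomial.monom c ?k"
    define r where "r = g - (Polynomial.smult q h0 - pcompose h0 ?f)"
    have monic: "Polynomial.degree (?f ^ j) = j \<and> Polynomial.coeff (?f ^ j) j = 1" for j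
      using lead_coeff_power[of ?f j] by (simp add: degree_power_eq)
    have comp: "pcompose h0 ?f = Polynomial.smult c (?f ^ ?k)"
    proof -
      have "pcompose (Polynomial.monom c j) ?f = Polynomial.smult c (?f ^ j)" for c j
        by (induct j) (simp_all add: monom_0 monom_Suc pcompose_pCons)
      then show ?thesis by (simp add: h0_def)
    qed
    have "Polynomial.coeff h0 ?k = c"
      by (simp add: h0_def)
    moreover have "Polynomial.coeff (pcompose h0 ?f) ?k = c"
      unfolding comp using monic[of ?k] by simp
    moreover have "(q - 1) * c = Polynomial.lead_coeff g"
      using assms by (simp add: c_def)
    then have "q * c - c = Polynomial.lead_coeff g"
      by (simp add: left_diff_distrib)
    ultimately have coeff: "Polynomial.coeff r ?k = 0"
      unfolding r_def Polynomial.coeff_diff Polynomial.coeff_smult by simp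
    have "Polynomial.degree (Polynomial.smult q h0) \<le> ?k"
      using degree_smult_le[of q h0] degree_monom_le[of c ?k] unfolding h0_def by (rule order_trans)
    moreover have "Polynomial.degree (pcompose h0 ?f) \<le> ?k"
      unfolding comp using degree_smult_le[of c "?f ^ ?k"] monic[of ?k] by simp
    ultimately have deg: "Polynomial.degree r \<le> ?k"
      unfolding r_def by (intro degree_diff_le) simp_all
    have "\<exists>h. Polynomial.smult q h - pcompose h ?f = r"
    proof (cases "r = 0")
      case True
      then show ?thesis by (intro exI[of _ 0]) simp
    next
      case False
      then have "Polynomial.degree r \<noteq> ?k"
        using coeff by (metis leading_coeff_0_iff)
      then show ?thesis using less deg by simp
    qed
    then obtain h where h: "Polynomial.smult q h - pcompose h ?f = r" by blast
    have "Polynomial.smult q (h0 + h) - pcompose (h0 + h) ?f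
        = (Polynomial.smult q h0 - pcompose h0 ?f) + (Polynomial.smult q h - pcompose h ?f)"
      unfolding smult_add_right pcompose_add by (rule add_diff_add)
    also have "\<dots> = g"
    proof -
      have "u + (v - u) = v" for u v :: "'k poly" by simp
      then show ?thesis unfolding h r_def .
    qed
    finally have "Polynomial.smult q (h0 + h) - pcompose (h0 + h) ?f = g" .
    then show ?thesis by blast
  qed
qed

lemma (in qgh_PBW) degree_g_le_1: "Polynomial.degree g \<le> 1"
proof (rule ccontr)
  assume "\<not> Polynomial.degree g \<le> 1"
  then have g: "2 \<le> Polynomial.degree g" by simp
  obtain a b where f: "f = [:b, a:]" and a: "a \<noteq> 0" by (rule f_linear)
  consider "a \<noteq> 1" | "a = 1" "q \<noteq> 1" | "a = 1" "q = 1" by blast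
  then show False
  proof cases
    case 1
    \<comment> \<open>The fixed point of f, so that f(t) - \<tau> = a (t - \<tau>).\<close>
    define \<tau> where "\<tau> = b / (1 - a)"
    have b: "b - \<tau> = - (a * \<tau>)"
      using 1 by (simp add: \<tau>_def field_simps)
    have ft: "peval f t - sc \<tau> = sc a * (t - sc \<tau>)"
    proof -
      have "peval f t - sc \<tau> = sc (b - \<tau>) + sc a * t"
        by (simp add: f sc_diff sc_central[of a t])
      also have "\<dots> = sc a * (t - sc \<tau>)"
        unfolding b by (simp add: right_diff_distrib sc_minus sc_mult)
      finally show ?thesis .
    qed
    interpret qgh_normal sc x y t q f g S \<pi> us "t - sc \<tau>" a
    proof
      show "(t - sc \<tau>) * x = sc a * x * (t - sc \<tau>)"
      proof -
        have "(t - sc \<tau>) * x = x * (peval f t - sc \<tau>)"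
          by (simp add: left_diff_distrib right_diff_distrib tx sc_central)
        then show ?thesis by (simp add: ft sc_left_commute[of x] mult.assoc)
      qed
      show "y * (t - sc \<tau>) = sc a * (t - sc \<tau>) * y"
      proof -
        have "y * (t - sc \<tau>) = (peval f t - sc \<tau>) * y"
          by (simp add: left_diff_distrib right_diff_distrib yt sc_central)
        then show ?thesis by (simp add: ft)
      qed
      show "(t - sc \<tau>) * t = t * (t - sc \<tau>)"
        by (simp add: left_diff_distrib right_diff_distrib sc_central)
    qed (use g a 1 t_nonscalar in \<open>auto intro: S_diff t_in_S sc_in_S\<close>)
    show False by (rule contradiction)
  next
    case 2
    \<comment> \<open>This equation reads g(t) + h(f(t)) = q h(t), which is what turns x (y x +
      h(f(t))) into q x (x y + h(t)).\<close>
    obtain h where h: "Polynomial.smult q h - pcompose h f = g"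
      using normal_form_exists[OF 2(2), of b g] f 2(1) by auto
    then have g_eq: "peval g t = sc q * peval h t - peval h (peval f t)"
      by (metis peval_diff peval_smult peval_pcompose)
    let ?w = "x * y + peval h t"
    interpret qgh_normal sc x y t q f g S \<pi> us ?w q
    proof
      show "?w * x = sc q * x * ?w"
      proof -
        have "?w * x = x * (y * x + peval h (peval f t))"
          by (simp add: distrib_left distrib_right peval_x mult.assoc)
        also have "\<dots> = x * (sc q * (x * y + peval h t))"
          by (simp add: yx g_eq distrib_left mult.assoc)
        finally show ?thesis by (simp add: sc_left_commute[of x] mult.assoc)
      qed
      show "y * ?w = sc q * ?w * y"
      proof -
        have "y * ?w = (y * x + peval h (peval f t)) * y"
          by (simp add: distrib_left distrib_right y_peval mult.assoc)
        also have "\<dots> = (sc q * (x * y + peval h t)) * y"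
          by (simp add: yx g_eq distrib_left mult.assoc)
        finally show ?thesis .
      qed
      show "?w * t = t * ?w"
      proof -
        have "x * y * t = x * (peval f t * y)"
          by (simp add: mult.assoc yt)
        also have "\<dots> = t * x * y"
          by (simp add: tx mult.assoc)
        finally show ?thesis
          by (simp add: distrib_left distrib_right peval_commute mult.assoc)
      qed
    qed (use g q_nonzero 2 xy_plus_peval_nonzero in \<open>auto intro: S_add S_mult x_in_S y_in_S t_in_S peval_in_S\<close>)
    show False by (rule contradiction)
  next
    case 3
    interpret qgh_commutative sc x y t q f g S \<pi> us b
      by unfold_locales (use 3 f g in auto)
    show False by (rule contradiction)
  qed
qed

context central_algebra
begin

text \<open>The constant d is invertible, so the relation can be solved for the other product; one
  order of each pair of generators is then enough to check.\<close>

lemma skew_commute_sym: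
  assumes "skew_commute us i j"
  shows "skew_commute us j i"
proof -
  obtain d l0 l where d: "d \<noteq> 0" and rel:
      "us ! j * us ! i = sc d * (us ! i * us ! j) + (sc l0 + (\<Sum>k<length us. sc (l k) * us ! k))"
    using assms by (auto simp: skew_commute_def)
  let ?e = "inverse d"
  have "sc ?e * (us ! j * us ! i) = us ! i * us ! j + (sc (?e * l0) + (\<Sum>k<length us. sc (?e * l k) * us ! k))"
    using d unfolding rel distrib_left sum_distrib_left by (simp flip: sc_mult)
  then have "us ! i * us ! j = sc ?e * (us ! j * us ! i)
      + (sc (- (?e * l0)) + (\<Sum>k<length us. sc (- (?e * l k)) * us ! k))"
    by (simp add: sc_minus sum_negf)
  then show ?thesis
    using d unfolding skew_commute_def by (intro exI[of _ ?e] exI[of _ "- (?e * l0)"] exI[of _ "\<lambda>k. - (?e * l k)"]) auto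
qed

lemma skew_commute_refl: "skew_commute us i i"
  unfolding skew_commute_def by (intro exI[of _ 1] exI[of _ 0] exI[of _ "\<lambda>_. 0"]) simp

end

context qgh_model
begin

lemma skew_PBW_gens_xty:
  assumes f: "Polynomial.degree f = 1" and g: "Polynomial.degree g \<le> 1" and q: "q \<noteq> 0"
  shows "skew_PBW_gens [x, t, y] S"
proof -
  define a b where "a = Polynomial.coeff f 1" and "b = Polynomial.coeff f 0"
  have fe: "f = [:b, a:]"
    using f by (intro poly_eqI) (auto simp: a_def b_def coeff_pCons coeff_eq_0 split: nat.split)
  have a: "a \<noteq> 0"
    using f leading_coeff_0_iff[of f] by (auto simp: a_def)
  define c0 c1 where "c0 = Polynomial.coeff g 0" and "c1 = Polynomial.coeff g 1"
  have ge: "g = [:c0, c1:]"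
    using g by (intro poly_eqI) (auto simp: c0_def c1_def coeff_pCons coeff_eq_0 split: nat.split)
  have ft: "peval f t = sc b + sc a * t" and gt: "peval g t = sc c0 + sc c1 * t"
    by (simp_all add: fe ge sc_central[of a t] sc_central[of c1 t])
  have sum3: "(\<Sum>k<length [x, t, y]. F k) = F 0 + (F 1 + F 2)" for F :: "nat \<Rightarrow> 'a"
    by (simp add: eval_nat_numeral add.assoc)
  have 01: "skew_commute [x, t, y] 0 1"
    unfolding skew_commute_def sum3
    by (intro exI[of _ a] exI[of _ 0] exI[of _ "\<lambda>k. if k = 0 then b else 0"])
      (simp add: a tx ft distrib_left sc_left_commute[of x] sc_central[of b x] add.commute)
  have 02: "skew_commute [x, t, y] 0 2"
    unfolding skew_commute_def sum3
    by (intro exI[of _ q] exI[of _ c0] exI[of _ "\<lambda>k. if k = 1 then c1 else 0"])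
      (simp add: q yx gt mult.assoc)
  have 12: "skew_commute [x, t, y] 1 2"
    unfolding skew_commute_def sum3
    by (intro exI[of _ a] exI[of _ 0] exI[of _ "\<lambda>k. if k = 2 then b else 0"])
      (simp add: a yt ft distrib_right mult.assoc add.commute)
  have "skew_commute [x, t, y] i j" if "i < 3" "j < 3" for i j
  proof -
    have "(i = 0 \<or> i = 1 \<or> i = 2) \<and> (j = 0 \<or> j = 1 \<or> j = 2)"
      using that by linarith
    then show ?thesis
      using 01 02 12 skew_commute_sym[OF 01] skew_commute_sym[OF 02] skew_commute_sym[OF 12] skew_commute_refl
      by auto
  qed
  then show ?thesis
    unfolding skew_PBW_gens_def range_monomial_xty
    using inj_monomial_xty independent_nm x_in_S y_in_S t_in_S by (simp add: S_eq numeral_3_eq_3)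
qed

text \<open>With unit weights the affine parts of the relations have weight at most 1, below the
  weight 2 of a product of two generators.\<close>

lemma qgh_PBW_I:
  assumes "skew_PBW_gens us S"
  shows "qgh_PBW sc x y t q f g S \<pi> us"
proof -
  note us = assms[unfolded skew_PBW_gens_def]
  have reorder: "\<exists>c\<in>UNIV - {0}. us ! j * us ! i - sc c * (us ! i * us ! j) \<in> low us (\<lambda>_. 1) (1 + 1)"
    if ij: "i < j" "j < length us" for i j
  proof -
    have "i < length us" using ij by simp
    then have "skew_commute us i j" using us ij by blast
    then obtain d l0 l where d: "d \<noteq> 0" "us ! j * us ! i = sc d * (us ! i * us ! j)
        + (sc l0 + (\<Sum>k<length us. sc (l k) * us ! k))"
      unfolding skew_commute_def by blast
    have "1 \<in> low us (\<lambda>_. 1) 2"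
      using word_in_low[of "[]" us "\<lambda>_. 1" 2] by simp
    moreover have "us ! k \<in> low us (\<lambda>_. 1) 2" if "k < length us" for k
      using word_in_low[of "[k]" us "\<lambda>_. 1" 2] that by (simp add: word_Cons)
    ultimately have "sc l0 * 1 + (\<Sum>k<length us. sc (l k) * us ! k) \<in> low us (\<lambda>_. 1) 2"
      unfolding low_def by (intro vs.span_add vs.span_scale vs.span_sum) auto
    then show ?thesis
      using d by (intro bexI[of _ d]) (simp_all add: numeral_2_eq_2)
  qed
  interpret U: quantum_space sc us "\<lambda>_. 1" "UNIV - {0}"
    using us reorder by unfold_locales auto
  have word: "set w \<subseteq> {..<length us} \<Longrightarrow> word us w \<in> S" for w
    using us by (induct w) (auto simp: word_Cons one_in_S intro!: S_mult)
  have "U.S \<subseteq> S"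
    unfolding U.S_def
  proof (rule vs.span_minimal)
    show "monomial us ` exponents (length us) \<subseteq> S"
    proof safe
      fix \<alpha> :: "nat list" assume "length \<alpha> = length us"
      then show "monomial us \<alpha> \<in> S"
        using word[of "expand 0 \<alpha>"] set_expand[of 0 \<alpha>] by (simp add: monomial_eq_word atLeast0LessThan)
    qed
  qed (simp add: S_eq)
  moreover have "S \<subseteq> U.S"
    using us by (simp add: U.S_def)
  ultimately show ?thesis
    using us by unfold_locales auto
qed

lemma skew_PBW_gens_iff:
  "(\<exists>us. skew_PBW_gens us S) \<longleftrightarrow> q \<noteq> 0 \<and> Polynomial.degree f = 1 \<and> Polynomial.degree g \<le> 1"
proof
  assume "\<exists>us. skew_PBW_gens us S"
  then obtain us where "skew_PBW_gens us S" by blast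
  then interpret qgh_PBW sc x y t q f g S \<pi> us by (rule qgh_PBW_I)
  show "q \<noteq> 0 \<and> Polynomial.degree f = 1 \<and> Polynomial.degree g \<le> 1"
    using q_nonzero degree_f degree_g_le_1 by blast
qed (use skew_PBW_gens_xty in blast)

end

lemma qgh_model_operators:
  fixes q :: "'k::field" and f g :: "'k poly"
  shows "qgh_model lop_sc opX (opY q f g) (opT f) q f g
    (lop.vs.span (range (normal_monomial opX (opY q f g) (opT f)))) op_pi"
proof
  let ?S = "lop.vs.span (range (normal_monomial opX (opY q f g) (opT f)))"
  show "z * w \<in> ?S" if zw: "z \<in> ?S" "w \<in> ?S" for z w
  proof -
    obtain p where "z = rho q f g p"
      using zw(1) unfolding range_rho[symmetric] by blast
    moreover obtain p' where "w = rho q f g p'"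
      using zw(2) unfolding range_rho[symmetric] by blast
    ultimately have "z * w = rho q f g (p * p')"
      by (simp add: rho_def lop.ev_mult)
    then show ?thesis unfolding range_rho[symmetric] by blast
  qed
  show "op_pi opX = (0 :: 'k poly)"
    using op_pi_x[of 1] by simp
  show "g dvd op_pi (opY q f g)"
    using op_pi_y[of g q f 1] by simp
  show "op_pi (opT f) = [:0, 1:]"
    using op_pi_t[of f 1] by (simp add: op_pi_one)
qed (simp_all add: op_tx op_yt op_yx normal_monomials_independent op_pi_add op_pi_sc_mult op_pi_one op_pi_mult)

theorem proposition5p4:
  fixes q :: "'k::field" and f g :: "'k poly"
  shows "skew_PBW_extension_via (ring_of_type_algebra :: 'k ring)
           (qgh_algebra q f g) (qgh_scalar q f g)
         \<longleftrightarrow> q \<noteq> 0 \<and> Polynomial.degree f = 1 \<and> Polynomial.degree g \<le> 1"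
  unfolding skew_PBW_extension_via_iff by (rule qgh_model.skew_PBW_gens_iff[OF qgh_model_operators])

end
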